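(* Let $n\in\mathbb{N}$ and $1<p<n$, and put $p^{\ast}=\frac{pn}{n-p}$. Then for every $\varepsilon>0$ there is a constant $c_{\varepsilon}$ (independent of $u$) such that for every $u\in W^{1,p}(\mathbb{S}^n)$ satisfying $$\int_{\mathbb{S}^n} f|u|^{p^{\ast}}\,d\mu=0\quad\text{for all } f\in\overset{\circ}{\mathcal{P}}_2,$$ one has $$\|u\|_{L^{p^{\ast}}(\mathbb{S}^n)}^p\le\left(\frac{S_{n,p}^p}{(n+2)^{\frac pn}}+\varepsilon\right)\|\nabla u\|_{L^p(\mathbb{S}^n)}^p+c_{\varepsilon}\|u\|_{L^p(\mathbb{S}^n)}^p.$$
   Context: $\mathbb{S}^n\subset\mathbb{R}^{n+1}$ is the unit sphere with its standard metric and $\mu$ is the associated (standard) measure; functions are real-valued. $\overset{\circ}{\mathcal{P}}_2$ is the set of all polynomials $f$ on $\mathbb{R}^{n+1}$ of degree at most $2$ with $\int_{\mathbb{S}^n}f\,d\mu=0$. $S_{n,p}$ is the sharp constant in the Sobolev inequality on $\mathbb{R}^n$, $S_{n,p}=\sup_{\varphi\in C_c^\infty(\mathbb{R}^n)\setminus\{0\}}\frac{\|\varphi\|_{L^{p^{\ast}}}}{\|\nabla\varphi\|_{L^p}}$, whose known value is $$S_{n,p}=\frac1n\left(\frac{n(p-1)}{n-p}\right)^{1-\frac1p}\left(\frac{n!}{\Gamma\left(\frac np\right)\Gamma\left(n+1-\frac np\right)|\mathbb{S}^{n-1}|}\right)^{\frac1n}.$$ *)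

theory Defs
  imports "HOL-Analysis.Analysis"
begin

(* Lebesgue spaces. "norm" makes the definitions apply to functions and to vector fields.
   lp_norm is meaningful only together with in_Lp: the Bochner integral of a
   non-integrable function is 0. *)

definition in_Lp :: "'a measure \<Rightarrow> real \<Rightarrow> ('a \<Rightarrow> 'b::euclidean_space) \<Rightarrow> bool" where
  "in_Lp M q f \<longleftrightarrow> f \<in> borel_measurable M \<and> integrable M (\<lambda>x. norm (f x) powr q)"

definition lp_norm :: "'a measure \<Rightarrow> real \<Rightarrow> ('a \<Rightarrow> 'b::euclidean_space) \<Rightarrow> real" where
  "lp_norm M q f = (\<integral>x. norm (f x) powr q \<partial>M) powr (1 / q)"

definition sobolev_exponent :: "nat \<Rightarrow> real \<Rightarrow> real" where
  "sobolev_exponent n p = p * real n / (real n - p)"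


(* k-times continuous differentiability on the whole space, through directional derivatives
   of total derivatives; smooth = C-infinity. *)

primrec times_cont_diff :: "nat \<Rightarrow> ('a::euclidean_space \<Rightarrow> 'b::euclidean_space) \<Rightarrow> bool" where
  "times_cont_diff 0 f \<longleftrightarrow> continuous_on UNIV f"
| "times_cont_diff (Suc k) f \<longleftrightarrow>
     (\<forall>x. f differentiable (at x)) \<and>
     (\<forall>v. times_cont_diff k (\<lambda>x. frechet_derivative f (at x) v))"

definition smooth :: "('a::euclidean_space \<Rightarrow> 'b::euclidean_space) \<Rightarrow> bool" where
  "smooth f \<longleftrightarrow> (\<forall>k. times_cont_diff k f)"

definition grad :: "('a::euclidean_space \<Rightarrow> real) \<Rightarrow> 'a \<Rightarrow> 'a" where
  "grad f x = (\<Sum>b\<in>Basis. frechet_derivative f (at x) b *\<^sub>R b)"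


(* The sharp constant of the Sobolev inequality on the Euclidean space 'a. The set is bounded
   above precisely because of the Sobolev inequality, which holds for 1 <= p < DIM('a);
   outside that range the real-valued Sup carries no information. *)

definition test_functions :: "('a::euclidean_space \<Rightarrow> real) set" where
  "test_functions = {\<phi>. smooth \<phi> \<and> compact (closure {x. \<phi> x \<noteq> 0})}"

definition sobolev_const :: "'a::euclidean_space itself \<Rightarrow> real \<Rightarrow> real" where
  "sobolev_const _ p =
     (SUP \<phi> \<in> (test_functions :: ('a \<Rightarrow> real) set) - {\<lambda>x. 0}.
        lp_norm lborel (sobolev_exponent DIM('a) p) \<phi> / lp_norm lborel p (grad \<phi>))"


(* The standard surface measure of the unit sphere: by integration in polar coordinates, the
   surface measure of A is DIM('a) times the Lebesgue measure of the cone
   {x. 0 < norm x <= 1, x / norm x \<in> A} over A. *)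

definition sphere_measure :: "'a::euclidean_space measure" where
  "sphere_measure = scale_measure (of_nat DIM('a))
     (distr (restrict_space lborel (cball 0 1 - {0})) (restrict_space borel (sphere 0 1))
        (\<lambda>x. x /\<^sub>R norm x))"


(* For a unit vector x this is the orthogonal projection onto the tangent space of the
   unit sphere at x. *)

definition tangent_proj :: "'a::euclidean_space \<Rightarrow> 'a \<Rightarrow> 'a" where
  "tangent_proj x v = v - (v \<bullet> x) *\<^sub>R x"

(* Smooth tangent vector fields on the sphere, represented by smooth extensions to the
   ambient space; every smooth tangent field has one. *)

definition smooth_tangent_fields :: "('a::euclidean_space \<Rightarrow> 'a) set" where
  "smooth_tangent_fields = {X. smooth X \<and> (\<forall>x\<in>sphere 0 1. X x \<bullet> x = 0)}"

(* Riemannian divergence of a tangent field, i.e. the trace of its covariant derivative. The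
   Levi-Civita connection of the sphere is the tangential part of the ambient derivative, so
   this is the trace of P o DX(x) o P with P = tangent_proj x; it depends only on X
   restricted to the sphere. *)

definition sphere_div :: "('a::euclidean_space \<Rightarrow> 'a) \<Rightarrow> 'a \<Rightarrow> real" where
  "sphere_div X x =
     (\<Sum>b\<in>Basis. frechet_derivative X (at x) (tangent_proj x b) \<bullet> tangent_proj x b)"

(* G is the weak gradient of u on the sphere and lies in L^p; it is unique up to
   null sets. *)

definition sphere_weak_gradient ::
    "real \<Rightarrow> ('a::euclidean_space \<Rightarrow> real) \<Rightarrow> ('a \<Rightarrow> 'a) \<Rightarrow> bool" where
  "sphere_weak_gradient p u G \<longleftrightarrow>
     in_Lp sphere_measure p G \<and>
     (AE x in sphere_measure. G x \<bullet> x = 0) \<and>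
     (\<forall>X\<in>smooth_tangent_fields.
        (\<integral>x. G x \<bullet> X x \<partial>sphere_measure) = - (\<integral>x. u x * sphere_div X x \<partial>sphere_measure))"

definition sphere_W1 :: "real \<Rightarrow> ('a::euclidean_space \<Rightarrow> real) set" where
  "sphere_W1 p = {u. in_Lp sphere_measure p u \<and> (\<exists>G. sphere_weak_gradient p u G)}"


(* Polynomial functions of total degree at most k; \<alpha> ranges over the multi-indices. *)

definition polys_upto :: "nat \<Rightarrow> ('a::euclidean_space \<Rightarrow> real) set" where
  "polys_upto k =
     {f. \<exists>c. f = (\<lambda>x. \<Sum>\<alpha> | \<alpha> \<in> Basis \<rightarrow>\<^sub>E {..k} \<and> sum \<alpha> Basis \<le> k.
                      c \<alpha> * (\<Prod>b\<in>Basis. (x \<bullet> b) ^ \<alpha> b))}"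

definition mean_zero_polys :: "nat \<Rightarrow> ('a::euclidean_space \<Rightarrow> real) set" where
  "mean_zero_polys k = {f \<in> polys_upto k. (\<integral>x. f x \<partial>sphere_measure) = 0}"

end

theory Submission
  imports Defs "HOL-Probability.Probability"
begin

text \<open>No concentration-compactness is needed. If \<open>\<bar>u\<bar>\<^sup>q d\<mu>\<close>, with \<open>q = pn/(n - p)\<close>, has the same moments
  of order at most two as the normalised measure, then integrating \<open>(a + x \<bullet> z)\<^sup>2\<close> against it shows that
  every small cap carries at most about \<open>1/(n + 2)\<close> of its mass. Let \<open>\<phi>\<^sub>z\<close> be a bump supported in
  the small cap around \<open>z\<close>. Hoelder's inequality on that cap gives
  approximately \<open>\<integral>\<phi>\<^sub>z\<^sup>p \<bar>u\<bar>\<^sup>q \<le> \<parallel>\<phi>\<^sub>z u\<parallel>\<^sub>q\<^sup>p (M / (n + 2))\<^sup>p\<^sup>/\<^sup>n\<close> with \<open>M = \<integral>\<bar>u\<bar>\<^sup>q\<close>. The norm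
  \<open>\<parallel>\<phi>\<^sub>z u\<parallel>\<^sub>q\<close> is estimated by the Euclidean Sobolev inequality in a gnomonic chart, in which the gradient does
  not grow and the measure is almost preserved, and integrating over \<open>z\<close> adds up the local estimates.

  Weakly differentiable \<open>u\<close> are handled by convolution with the zonal kernels \<open>(1 + x \<bullet> y)\<^sup>d\<close>. Since these are
  polynomials invariant under simultaneous rotations, testing the weak gradient with kernel times
  Killing field bounds the gradient of the convolution by the convolution of the gradient norm.
  Finiteness of the Sobolev constant follows from Maz'ya's truncation method.\<close>


section \<open>Smooth functions\<close>

text \<open>The identity p/q + p/n = 1 shapes the argument. With w = |u|^q = |u|^p |u|^(q-p) and M
  its integral, Hoelder's inequality with exponents q/p and n/p separates the norm of the cut-off
  function from the mass of w in the cap, which enters as (\<theta> M)^(p/n). The cut-off occurs as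
  its p-th power on both sides, so averaging over the centres is exact: its p-th power integrates
  over the centre to a constant, by rotation invariance, and this constant cancels from the gradient
  term. What is left bounds M by (\<theta> M)^(p/n) times the right-hand side, and M^(p/n) is
  divided out. This needs M finite, which is itself obtained by averaging the local inequalities.
  The number 1/(n+2) is the minimum over a of (a^2 + 1/(n+1)) / (a+1)^2, the mean of (a + x.z)^2 on
  the sphere divided by its value at x = z. Mollified gradients are never shown to converge. The
  mollifier is self-adjoint, so it can be moved from the p-th power of the gradient norm to the
  continuous cut-off, where convergence is uniform.\<close>

lemma times_cont_diff_SucI:
  assumes "\<And>x. (f has_derivative D x) (at x)" and "\<And>v. times_cont_diff k (\<lambda>x. D x v)"
  shows "times_cont_diff (Suc k) f"
proof -
  have "frechet_derivative f (at x) = D x" for x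
    using frechet_derivative_at[OF assms(1)] by simp
  then show ?thesis using assms by (auto simp: differentiable_def)
qed

lemma times_cont_diff_SucD:
  assumes "times_cont_diff (Suc k) f"
  shows "(f has_derivative frechet_derivative f (at x)) (at x)"
    and "times_cont_diff k (\<lambda>x. frechet_derivative f (at x) v)"
  using assms by (auto simp: frechet_derivative_works)

lemma times_cont_diff_Suc_imp: "times_cont_diff (Suc k) f \<Longrightarrow> times_cont_diff k f"
proof (induction k arbitrary: f)
  case 0
  then show ?case
    by (auto intro!: continuous_at_imp_continuous_on differentiable_imp_continuous_within)
next
  case (Suc k)
  show ?case
    using Suc.prems by (intro times_cont_diff_SucI[OF times_cont_diff_SucD(1)[OF Suc.prems]])
      (auto intro!: Suc.IH)
qed

lemma times_cont_diff_continuous: "times_cont_diff k f \<Longrightarrow> continuous_on UNIV f"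
  by (induction k) (auto simp del: times_cont_diff.simps(2) dest: times_cont_diff_Suc_imp)

lemma times_cont_diff_const: "times_cont_diff k (\<lambda>x. c)"
proof (induction k arbitrary: c)
  case (Suc k)
  show ?case by (rule times_cont_diff_SucI[where D="\<lambda>x v. 0"]) (auto simp: Suc)
qed auto

lemma times_cont_diff_bounded_linear:
  assumes "bounded_linear f" shows "times_cont_diff k f"
proof (cases k)
  case 0
  then show ?thesis using assms by (auto intro: linear_continuous_on)
next
  case (Suc j)
  then show ?thesis unfolding Suc
    by (intro times_cont_diff_SucI[where D="\<lambda>x. f"])
       (auto simp: assms bounded_linear_imp_has_derivative times_cont_diff_const)
qed

lemma times_cont_diff_add:
  "times_cont_diff k f \<Longrightarrow> times_cont_diff k g \<Longrightarrow> times_cont_diff k (\<lambda>x. f x + g x)"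
proof (induction k arbitrary: f g)
  case 0
  then show ?case by (auto intro: continuous_intros)
next
  case (Suc k)
  show ?case
    by (rule times_cont_diff_SucI[OF has_derivative_add[OF Suc.prems[THEN times_cont_diff_SucD(1)]]])
       (intro Suc.IH Suc.prems[THEN times_cont_diff_SucD(2)])
qed

lemma times_cont_diff_scaleR:
  fixes f :: "'a::euclidean_space \<Rightarrow> real" and g :: "'a \<Rightarrow> 'b::euclidean_space"
  shows "times_cont_diff k f \<Longrightarrow> times_cont_diff k g \<Longrightarrow> times_cont_diff k (\<lambda>x. f x *\<^sub>R g x)"
proof (induction k arbitrary: f g)
  case 0
  then show ?case by (auto intro: continuous_intros)
next
  case (Suc k)
  show ?case
    by (rule times_cont_diff_SucI[OF has_derivative_scaleR[OF Suc.prems[THEN times_cont_diff_SucD(1)]]])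
       (intro times_cont_diff_add Suc.IH Suc.prems[THEN times_cont_diff_SucD(2)]
          Suc.prems[THEN times_cont_diff_Suc_imp])
qed

lemma times_cont_diff_mult:
  fixes f g :: "'a::euclidean_space \<Rightarrow> real"
  shows "times_cont_diff k f \<Longrightarrow> times_cont_diff k g \<Longrightarrow> times_cont_diff k (\<lambda>x. f x * g x)"
  using times_cont_diff_scaleR[of k f g] by simp

lemma times_cont_diff_sum:
  assumes "\<And>i. i \<in> I \<Longrightarrow> times_cont_diff k (f i)"
  shows "times_cont_diff k (\<lambda>x. \<Sum>i\<in>I. f i x)"
  using assms
  by (induction I rule: infinite_finite_induct)
     (auto intro: times_cont_diff_const times_cont_diff_add)

lemma times_cont_diff_powr:
  fixes g :: "'a::euclidean_space \<Rightarrow> real"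
  shows "times_cont_diff k g \<Longrightarrow> (\<And>x. g x > 0) \<Longrightarrow> times_cont_diff k (\<lambda>x. g x powr a)"
proof (induction k arbitrary: a)
  case 0
  then show ?case by (auto intro!: continuous_intros simp: less_le)
next
  case (Suc k)
  have "((\<lambda>x. g x powr a) has_derivative (\<lambda>v. frechet_derivative g (at x) v * (a * g x powr (a - 1)))) (at x)" for x
    by (rule DERIV_compose_FDERIV[OF _ times_cont_diff_SucD(1)[OF Suc.prems(1)]])
       (rule has_real_derivative_powr[OF Suc.prems(2)])
  then show ?case
    by (rule times_cont_diff_SucI)
       (intro times_cont_diff_mult times_cont_diff_const Suc.IH Suc.prems(2)
          times_cont_diff_SucD(2)[OF Suc.prems(1)] times_cont_diff_Suc_imp[OF Suc.prems(1)])
qed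

text \<open>Derivatives of exp(-1/t) are polynomials in 1/t times the same exponential. Carrying the
  polynomial \<open>q\<close> as a parameter closes the family under differentiation, so that
  smoothness becomes an induction with \<open>q\<close> arbitrary.\<close>

definition exp_flat :: "real poly \<Rightarrow> real \<Rightarrow> real" where
  "exp_flat q t = (if t > 0 then poly q (1 / t) * exp (- (1 / t)) else 0)"

lemma poly_times_exp_minus_tendsto_0:
  fixes q :: "real poly"
  shows "((\<lambda>s. poly q s * exp (- s)) \<longlongrightarrow> 0) at_top"
proof -
  have "((\<lambda>s. \<Sum>i\<le>degree q. coeff q i * (s ^ i / exp s)) \<longlongrightarrow> (\<Sum>i\<le>degree q. coeff q i * 0)) at_top"
    by (intro tendsto_intros tendsto_power_div_exp_0)
  then show ?thesis
    by (simp add: poly_altdef exp_minus sum_distrib_right divide_inverse mult.assoc)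
qed

text \<open>With s = 1/t one has ds/dt = -s^2, so q(s) exp(-s) differentiates to s^2 (q - q')(s)
  exp(-s); the factor s^2 is \<open>[:0, 0, 1:]\<close>. At \<open>t = 0\<close> the exponential
  decay makes the right-hand difference quotient tend to 0.\<close>

lemma DERIV_exp_flat:
  "(exp_flat q has_real_derivative exp_flat ([:0, 0, 1:] * (q - pderiv q)) t) (at t)"
proof -
  consider "t > 0" | "t < 0" | "t = 0" by linarith
  then show ?thesis
  proof cases
    case 1
    have "((\<lambda>t. poly q (1 / t) * exp (- (1 / t))) has_real_derivative
        exp_flat ([:0, 0, 1:] * (q - pderiv q)) t) (at t)"
      using 1 unfolding exp_flat_def
      by (auto intro!: derivative_eq_intros DERIV_chain2[of "poly q"] poly_DERIV
          simp: field_simps power2_eq_square)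
    then show ?thesis
      by (rule has_field_derivative_transform_within_open[where S="{0<..}"])
         (use 1 in \<open>auto simp: exp_flat_def\<close>)
  next
    case 2
    have "((\<lambda>t. 0) has_real_derivative exp_flat ([:0, 0, 1:] * (q - pderiv q)) t) (at t)"
      using 2 by (auto simp: exp_flat_def)
    then show ?thesis
      by (rule has_field_derivative_transform_within_open[where S="{..<0}"])
         (use 2 in \<open>auto simp: exp_flat_def\<close>)
  next
    case 3
    have r: "((\<lambda>h. exp_flat q h / h) \<longlongrightarrow> 0) (at_right 0)"
    proof -
      \<comment> \<open>\<open>pCons 0 q\<close> evaluates to s q(s): dividing by \<open>h\<close>
        is multiplying by s = 1/h.\<close>
      have "((\<lambda>h. poly (pCons 0 q) (inverse h) * exp (- inverse h)) \<longlongrightarrow> 0) (at_right 0)"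
        by (rule filterlim_compose[OF poly_times_exp_minus_tendsto_0 filterlim_inverse_at_top_right])
      then show ?thesis
        by (rule Lim_transform_eventually)
           (auto simp: eventually_at_right_less exp_flat_def field_simps eventually_at_filter)
    qed
    have l: "((\<lambda>h. exp_flat q h / h) \<longlongrightarrow> 0) (at_left 0)"
      by (rule Lim_transform_eventually[OF tendsto_const])
         (auto simp: exp_flat_def eventually_at_filter)
    have "((\<lambda>h. exp_flat q h / h) \<longlongrightarrow> 0) (at 0)"
      using l r by (simp add: filterlim_split_at)
    then show ?thesis
      using 3 by (simp add: DERIV_def exp_flat_def)
  qed
qed

lemma times_cont_diff_exp_flat:
  fixes g :: "'a::euclidean_space \<Rightarrow> real"
  shows "times_cont_diff k g \<Longrightarrow> times_cont_diff k (\<lambda>x. exp_flat q (g x))"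
proof (induction k arbitrary: q)
  case 0
  have "continuous_on UNIV (exp_flat q)"
    by (rule DERIV_continuous_on[OF has_field_derivative_at_within[OF DERIV_exp_flat]])
  then show ?case
    using 0 continuous_on_compose2[of UNIV "exp_flat q" UNIV g] by auto
next
  case (Suc k)
  show ?case
    by (rule times_cont_diff_SucI[OF DERIV_compose_FDERIV[OF DERIV_exp_flat
            times_cont_diff_SucD(1)[OF Suc.prems]]])
       (intro times_cont_diff_mult Suc.IH times_cont_diff_SucD(2)[OF Suc.prems]
          times_cont_diff_Suc_imp[OF Suc.prems])
qed

text \<open>Increasing rather than compactly supported: it is exp(-1/t) on the positive half line.
  Localisation comes from evaluating it at \<open>x \<bullet> z - \<tau>\<close>, which is positive
  only on a cap around \<open>z\<close>.\<close>

definition bump :: "real \<Rightarrow> real" where "bump = exp_flat 1"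

lemma bump_nonneg: "0 \<le> bump t" and bump_le_1: "bump t \<le> 1"
  and bump_pos_iff: "0 < bump t \<longleftrightarrow> 0 < t" and bump_eq_0: "t \<le> 0 \<Longrightarrow> bump t = 0"
  by (auto simp: bump_def exp_flat_def)

definition bump' :: "real \<Rightarrow> real" where "bump' = exp_flat [:0, 0, 1:]"

lemma DERIV_bump: "(bump has_real_derivative bump' t) (at t)"
  using DERIV_exp_flat[of 1 t] by (simp add: bump_def bump'_def pderiv_1)

text \<open>The factor 2 comes from s^2/2 \<le> exp s at s = 1/t. It reappears as the factor 2 of
  the zero-order term in \<open>local_sobolev\<close>.\<close>

lemma bump'_bounds: "0 \<le> bump' t" "bump' t \<le> 2" "t \<le> 0 \<Longrightarrow> bump' t = 0"
proof -
  have "s * s \<le> 2 * exp s" if "s > 0" for s :: real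
    using exp_lower_Taylor_quadratic[of s] that by (simp add: power2_eq_square)
  from this[of "1 / t"] show "bump' t \<le> 2"
    by (auto simp: bump'_def exp_flat_def exp_minus field_simps)
qed (auto simp: bump'_def exp_flat_def)

lemma continuous_on_bump [continuous_intros]:
  "continuous_on S g \<Longrightarrow> continuous_on S (\<lambda>x. bump (g x))"
  by (rule continuous_on_compose2[OF DERIV_continuous_on[OF has_field_derivative_at_within[OF DERIV_bump], of UNIV]])
     auto

lemma borel_measurable_bump [measurable]: "bump \<in> borel_measurable borel"
  by (intro borel_measurable_continuous_onI continuous_intros)

section \<open>The Sobolev inequality on Euclidean space\<close>

lemma powr_tangent_line:
  fixes a l p :: real
  assumes "1 < p" "0 \<le> a" "0 \<le> l"
  shows "l powr p + p * l powr (p - 1) * (a - l) \<le> a powr p"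
proof -
  have "a * l powr (p - 1) \<le> a powr p / p + (l powr (p - 1)) powr (p / (p - 1)) / (p / (p - 1))"
    using assms by (intro Youngs_inequality) (auto simp: field_simps)
  also have "(l powr (p - 1)) powr (p / (p - 1)) = l powr p"
    using assms by (simp add: powr_powr)
  finally have "p * (a * l powr (p - 1)) \<le> p * (a powr p / p + l powr p / (p / (p - 1)))"
    using assms by (intro mult_left_mono) auto
  also have "\<dots> = a powr p + (p - 1) * l powr p"
    using assms by (simp add: field_simps)
  finally have "p * (a * l powr (p - 1)) \<le> a powr p + (p - 1) * l powr p" .
  moreover have "l powr (p - 1) * l = l powr p"
    using assms powr_mult_base[of l "p - 1"] by (cases "l = 0") (auto simp: mult.commute)
  moreover have "p * l powr (p - 1) * (a - l) = p * (a * l powr (p - 1)) - p * (l powr (p - 1) * l)"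
    by (simp add: algebra_simps)
  ultimately show ?thesis by (simp add: left_diff_distrib)
qed

text \<open>Jensen's inequality: integrate the tangent line at the mean \<open>l\<close>, whose
  linear term has expectation 0.\<close>

lemma (in prob_space) expectation_powr_le:
  fixes f :: "'a \<Rightarrow> real"
  assumes "1 < p" and int: "integrable M f" "integrable M (\<lambda>x. f x powr p)"
    and nn: "\<And>x. x \<in> space M \<Longrightarrow> 0 \<le> f x"
  shows "expectation f powr p \<le> expectation (\<lambda>x. f x powr p)"
proof -
  define l where "l = expectation f"
  have l: "0 \<le> l" unfolding l_def by (rule integral_nonneg_AE) (auto intro!: AE_I2 nn)
  have "expectation (\<lambda>x. l powr p + p * l powr (p - 1) * (f x - l)) \<le> expectation (\<lambda>x. f x powr p)"
    using int nn l assms(1) by (intro integral_mono powr_tangent_line) auto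
  also have "expectation (\<lambda>x. l powr p + p * l powr (p - 1) * (f x - l)) = l powr p"
    using int by (simp add: prob_space l_def)
  finally show ?thesis by (simp add: l_def)
qed

section \<open>Continuously differentiable truncation and level-set estimates\<close>

lemma DERIV_pos_part_square:
  "((\<lambda>x::real. (max 0 x)\<^sup>2) has_real_derivative 2 * max 0 x) (at x)"
proof -
  consider "x > 0" | "x < 0" | "x = 0" by linarith
  then show ?thesis
  proof cases
    case 1
    have "((\<lambda>x. x\<^sup>2) has_real_derivative 2 * max 0 x) (at x)"
      using 1 by (auto intro!: derivative_eq_intros)
    then show ?thesis
      by (rule has_field_derivative_transform_within_open[where S="{0<..}"]) (use 1 in auto)
  next
    case 2
    have "((\<lambda>x. 0) has_real_derivative 2 * max 0 x) (at x)"
      using 2 by auto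
    then show ?thesis
      by (rule has_field_derivative_transform_within_open[where S="{..<0}"]) (use 2 in auto)
  next
    case 3
    have "((\<lambda>h::real. (max 0 h)\<^sup>2 / h) \<longlongrightarrow> 0) (at 0)"
    proof (rule Lim_null_comparison)
      show "\<forall>\<^sub>F h::real in at 0. norm ((max 0 h)\<^sup>2 / h) \<le> \<bar>h\<bar>"
        by (auto simp: eventually_at_filter max_def power2_eq_square)
      show "((\<lambda>h::real. \<bar>h\<bar>) \<longlongrightarrow> 0) (at 0)" by (auto intro!: tendsto_eq_intros)
    qed
    then show ?thesis using 3 by (simp add: DERIV_def)
  qed
qed

text \<open>A quadratic spline rising from 0 at 1 to 1 at 2, with second derivative 4 on the first
  half of the interval and -4 on the second; its slope peaks at 3/2 with the value 2. One continuous
  derivative suffices, as the truncation enters only through a continuous gradient.\<close>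

definition smoothstep :: "real \<Rightarrow> real" where
  "smoothstep r = 2 * (max 0 (r - 1))\<^sup>2 - 4 * (max 0 (r - 3/2))\<^sup>2 + 2 * (max 0 (r - 2))\<^sup>2"

definition smoothstep' :: "real \<Rightarrow> real" where
  "smoothstep' r = 4 * max 0 (r - 1) - 8 * max 0 (r - 3/2) + 4 * max 0 (r - 2)"

lemma DERIV_smoothstep: "(smoothstep has_real_derivative smoothstep' r) (at r)"
proof -
  have "((\<lambda>r. (max 0 (r - c))\<^sup>2) has_real_derivative 2 * max 0 (r - c)) (at r)" for c :: real
  proof -
    have "((\<lambda>r. r - c) has_real_derivative 1) (at r)" by (auto intro!: derivative_eq_intros)
    from DERIV_chain2[OF DERIV_pos_part_square this] show ?thesis by simp
  qed
  from DERIV_add[OF DERIV_diff[OF DERIV_cmult[OF this[of 1], of 2] DERIV_cmult[OF this[of "3/2"], of 4]]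
      DERIV_cmult[OF this[of 2], of 2]]
  show ?thesis
    unfolding smoothstep_def[abs_def] smoothstep'_def by simp
qed

lemma smoothstep_eq: "r \<le> 1 \<Longrightarrow> smoothstep r = 0" "2 \<le> r \<Longrightarrow> smoothstep r = 1"
  and smoothstep'_eq_0: "r \<le> 1 \<or> 2 \<le> r \<Longrightarrow> smoothstep' r = 0"
  and abs_smoothstep'_le: "\<bar>smoothstep' r\<bar> \<le> 2"
  by (auto simp: smoothstep_def smoothstep'_def max_def power2_eq_square algebra_simps)

text \<open>The fundamental theorem of calculus along the segment from \<open>x\<close> to
  \<open>x + h\<close>, Jensen's inequality in the segment parameter, and translation invariance in
  \<open>x\<close>.\<close>

lemma integral_translate_difference_le:
  fixes F :: "'a::euclidean_space \<Rightarrow> real" and G :: "'a \<Rightarrow> 'a"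
  assumes der: "\<And>x. (F has_derivative (\<lambda>h. G x \<bullet> h)) (at x)" and cont: "continuous_on UNIV G" and p: "1 < p"
  shows "(\<integral>\<^sup>+x. ennreal (\<bar>F (x + h) - F x\<bar> powr p) \<partial>lborel) \<le> norm h powr p * (\<integral>\<^sup>+x. ennreal (norm (G x) powr p) \<partial>lborel)"
proof -
  \<comment> \<open>The uniform probability measure on the unit interval, so that Jensen's
    inequality applies to averages along the segment.\<close>
  define U where "U = restrict_space lborel {0..1::real}"
  interpret U: prob_space U
    by (rule prob_spaceI) (simp add: U_def emeasure_restrict_space space_restrict_space)
  have [measurable]: "G \<in> borel_measurable borel" 
    using cont by (rule borel_measurable_continuous_onI)
  have [measurable]: "F \<in> borel_measurable borel"
    by (intro borel_measurable_continuous_onI continuous_at_imp_continuous_on ballI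
        has_derivative_continuous[OF der])
  have contl: "continuous_on {0..1} (\<lambda>s. G (x + s *\<^sub>R h))" for x
    by (intro continuous_on_compose2[OF cont] continuous_intros) auto
  have intU: "integrable U f" if "continuous_on {0..1} f" for f :: "real \<Rightarrow> real"
    using borel_integrable_atLeastAtMost'[OF that] unfolding U_def set_integrable_def
    by (subst integrable_restrict_space) auto
  have pw: "\<bar>F (x + h) - F x\<bar> powr p \<le> norm h powr p * (\<integral>s. norm (G (x + s *\<^sub>R h)) powr p \<partial>U)" for x
  proof -
    have "((\<lambda>s. F (x + s *\<^sub>R h)) has_real_derivative G (x + s *\<^sub>R h) \<bullet> h) (at s within {0..1})" for s
      unfolding has_field_derivative_def
      by (rule has_derivative_eq_rhs[OF has_derivative_compose[OF _ der, of "\<lambda>s. x + s *\<^sub>R h" "\<lambda>r. r *\<^sub>R h"]])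
         (auto intro!: derivative_eq_intros simp: fun_eq_iff)
    then have "(LBINT s. indicator {0..1} s *\<^sub>R (G (x + s *\<^sub>R h) \<bullet> h)) = F (x + 1 *\<^sub>R h) - F (x + 0 *\<^sub>R h)"
      by (intro integral_FTC_Icc)
         (auto simp: has_real_derivative_iff_has_vector_derivative[symmetric] intro!: continuous_intros contl)
    then have "F (x + h) - F x = (\<integral>s. G (x + s *\<^sub>R h) \<bullet> h \<partial>U)"
      unfolding U_def by (subst integral_restrict_space) auto
    then have "\<bar>F (x + h) - F x\<bar> \<le> (\<integral>s. \<bar>G (x + s *\<^sub>R h) \<bullet> h\<bar> \<partial>U)"
      by simp
    also have "\<dots> \<le> (\<integral>s. norm h * norm (G (x + s *\<^sub>R h)) \<partial>U)"
      by (intro integral_mono intU continuous_intros contl)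
         (auto simp: mult.commute[of "norm h"] Cauchy_Schwarz_ineq2)
    finally have "\<bar>F (x + h) - F x\<bar> \<le> norm h * (\<integral>s. norm (G (x + s *\<^sub>R h)) \<partial>U)" by simp
    then have "\<bar>F (x + h) - F x\<bar> powr p \<le> (norm h * (\<integral>s. norm (G (x + s *\<^sub>R h)) \<partial>U)) powr p"
      using p by (intro powr_mono2) auto
    also have "\<dots> = norm h powr p * (\<integral>s. norm (G (x + s *\<^sub>R h)) \<partial>U) powr p"
      by (rule powr_mult)
    also have "\<dots> \<le> norm h powr p * (\<integral>s. norm (G (x + s *\<^sub>R h)) powr p \<partial>U)"
      using p by (intro mult_left_mono U.expectation_powr_le intU continuous_on_powr' continuous_intros contl) auto
    finally show ?thesis .
  qed
  have sf: "sigma_finite_measure U" by unfold_locales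
  have "(\<lambda>s. s) \<in> U \<rightarrow>\<^sub>M borel"
    unfolding U_def by (rule measurable_restrict_space1) simp
  then have [measurable]: "(\<lambda>z. snd z) \<in> lborel \<Otimes>\<^sub>M U \<rightarrow>\<^sub>M borel"
    by (rule measurable_compose[OF measurable_snd])
  have "(\<integral>\<^sup>+x. ennreal (\<bar>F (x + h) - F x\<bar> powr p) \<partial>lborel)
      \<le> (\<integral>\<^sup>+x. norm h powr p * (\<integral>\<^sup>+s. norm (G (x + s *\<^sub>R h)) powr p \<partial>U) \<partial>lborel)"
  proof (rule nn_integral_mono)
    fix x
    have "(\<integral>\<^sup>+s. norm (G (x + s *\<^sub>R h)) powr p \<partial>U) = ennreal (\<integral>s. norm (G (x + s *\<^sub>R h)) powr p \<partial>U)"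
      using p by (intro nn_integral_eq_integral intU continuous_on_powr' continuous_intros contl) auto
    then show "ennreal (\<bar>F (x + h) - F x\<bar> powr p) \<le> norm h powr p * (\<integral>\<^sup>+s. norm (G (x + s *\<^sub>R h)) powr p \<partial>U)"
      using pw[of x] by (simp add: ennreal_mult'[symmetric] ennreal_leI)
  qed
  also have "\<dots> = norm h powr p * (\<integral>\<^sup>+x. (\<integral>\<^sup>+s. norm (G (x + s *\<^sub>R h)) powr p \<partial>U) \<partial>lborel)"
    by (intro nn_integral_cmult sigma_finite_measure.borel_measurable_nn_integral[OF sf]) simp
  also have "(\<integral>\<^sup>+x. (\<integral>\<^sup>+s. norm (G (x + s *\<^sub>R h)) powr p \<partial>U) \<partial>lborel)
      = (\<integral>\<^sup>+s. (\<integral>\<^sup>+x. norm (G (x + s *\<^sub>R h)) powr p \<partial>lborel) \<partial>U)"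
    by (rule pair_sigma_finite.Fubini'[symmetric])
       (auto simp: pair_sigma_finite_def sf sigma_finite_lborel)
  also have "\<dots> = (\<integral>\<^sup>+s. (\<integral>\<^sup>+x. norm (G x) powr p \<partial>lborel) \<partial>U)"
  proof (rule nn_integral_cong)
    fix s
    have "(\<integral>\<^sup>+x. norm (G x) powr p \<partial>lborel) = (\<integral>\<^sup>+x. norm (G x) powr p \<partial>distr lborel borel ((+) (s *\<^sub>R h)))"
      by (simp only: lborel_distr_plus)
    also have "\<dots> = (\<integral>\<^sup>+x. norm (G (s *\<^sub>R h + x)) powr p \<partial>lborel)"
      by (subst nn_integral_distr) auto
    finally show "(\<integral>\<^sup>+x. norm (G (x + s *\<^sub>R h)) powr p \<partial>lborel) = (\<integral>\<^sup>+x. norm (G x) powr p \<partial>lborel)"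
      by (simp add: add.commute)
  qed
  also have "\<dots> = (\<integral>\<^sup>+x. norm (G x) powr p \<partial>lborel)"
    by (simp add: U.emeasure_space_1)
  finally show ?thesis .
qed

text \<open>Let \<open>F\<close> be the truncation of |f| that is 1 on \<open>E (2 * t)\<close> and
  0 off \<open>E t\<close>. For \<open>x\<close> in \<open>E (2 * t)\<close>, at least half of the
  ball around \<open>x\<close> with twice the volume of \<open>E t\<close> lies outside
  \<open>E t\<close>, where \<open>F\<close> has dropped by 1. Integrating |F(x+h) - F(x)|^p over
  \<open>x\<close> and over \<open>h\<close> in this ball, the translation estimate bounds the
  result by the gradient; the p-th power of the radius becomes the power p/n of the measure of
  \<open>E t\<close>.\<close>

lemma level_set_estimate:
  fixes f :: "'a::euclidean_space \<Rightarrow> real" and g :: "'a \<Rightarrow> 'a"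
  assumes der: "\<And>x. (f has_derivative (\<lambda>h. g x \<bullet> h)) (at x)" and cont: "continuous_on UNIV g"
    and supp: "\<And>x. norm x > R \<Longrightarrow> f x = 0" and p: "1 < p" and t: "0 < t"
  defines "E \<equiv> \<lambda>t. {x. t \<le> \<bar>f x\<bar>}"
  shows "ennreal (measure lborel (E (2 * t)))
     \<le> ennreal (2 * 2 powr p * (2 / unit_ball_vol DIM('a)) powr (p / DIM('a)) * measure lborel (E t) powr (p / DIM('a)) * t powr (- p))
       * (\<integral>\<^sup>+x. indicator {x. t < \<bar>f x\<bar> \<and> \<bar>f x\<bar> < 2 * t} x * ennreal (norm (g x) powr p) \<partial>lborel)"
proof -
  have contf: "continuous_on UNIV f"
    by (intro continuous_at_imp_continuous_on ballI has_derivative_continuous[OF der])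
  have [measurable]: "f \<in> borel_measurable borel" "g \<in> borel_measurable borel"
    using cont contf by (auto intro: borel_measurable_continuous_onI)
  have Em [measurable]: "E s \<in> sets borel" for s unfolding E_def by measurable
  have Esub: "E s \<subseteq> cball 0 R" if "s > 0" for s
    using that supp unfolding E_def by (force simp: not_le[symmetric])
  have Efin: "emeasure lborel (E s) < \<infinity>" if "s > 0" for s
    using emeasure_mono[OF Esub[OF that], of lborel] emeasure_bounded_finite[of "cball (0::'a) R"]
    by (simp add: le_less_trans)
  have Eeq: "emeasure lborel (E s) = ennreal (measure lborel (E s))" if "s > 0" for s
    using Efin[OF that] by (simp add: emeasure_eq_ennreal_measure)
  define n where "n = real DIM('a)"
  have n: "n > 0" unfolding n_def by simp
  define w where "w = unit_ball_vol n"
  have w: "w > 0" unfolding w_def using n by simp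
  define a where "a = measure lborel (E t)"
  have a0: "a \<ge> 0" unfolding a_def by simp
  have E2: "E (2 * t) \<subseteq> E t" using t unfolding E_def by auto
  \<comment> \<open>The case \<open>a = 0\<close> is split off because the factor \<open>a\<close>
    is cancelled at the end.\<close>
  show ?thesis
  proof (cases "a = 0")
    case True
    have "measure lborel (E (2 * t)) \<le> a"
      unfolding a_def by (rule measure_mono_fmeasurable[OF E2]) (use Efin[OF t] in \<open>auto simp: fmeasurable_def\<close>)
    with True show ?thesis by (simp add: ennreal_neg)
  next
    case False
    then have a: "a > 0" using a0 by simp
    \<comment> \<open>Chosen so that the ball of radius \<open>r\<close> has volume
      \<open>2 * a\<close>.\<close>
    define r where "r = (2 * a / w) powr (1 / n)"
    have r: "r > 0" unfolding r_def using a w by simp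
    have Hvol: "emeasure lborel (ball (0::'a) r) = ennreal (2 * a)"
    proof -
      have "w * r ^ DIM('a) = 2 * a"
        using n w a by (simp add: powr_realpow[OF r, symmetric] n_def[symmetric]) (simp add: r_def powr_powr)
      then show ?thesis
        using emeasure_ball[of r "0::'a"] r by (simp add: w_def n_def)
    qed
    \<comment> \<open>Two one-sided steps in place of one step of |f|, so that the chain rule
      applies directly to \<open>f\<close>.\<close>
    define F where "F x = smoothstep (f x / t) + smoothstep (- (f x / t))" for x
    define G where "G x = ((smoothstep' (f x / t) - smoothstep' (- (f x / t))) / t) *\<^sub>R g x" for x
    have Fder: "(F has_derivative (\<lambda>h. G x \<bullet> h)) (at x)" for x
    proof -
      have 1: "((\<lambda>x. f x / t) has_derivative (\<lambda>h. (g x \<bullet> h) / t)) (at x)"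
        by (rule bounded_linear.has_derivative[OF bounded_linear_divide der])
      have 2: "((\<lambda>x. - (f x / t)) has_derivative (\<lambda>h. - ((g x \<bullet> h) / t))) (at x)"
        by (rule has_derivative_minus[OF 1])
      show ?thesis unfolding F_def[abs_def]
        by (rule has_derivative_eq_rhs[OF has_derivative_add[OF DERIV_compose_FDERIV[OF DERIV_smoothstep 1]
                DERIV_compose_FDERIV[OF DERIV_smoothstep 2]]])
           (auto simp: G_def fun_eq_iff algebra_simps diff_divide_distrib)
    qed
    have Gcont: "continuous_on UNIV G"
      unfolding G_def smoothstep'_def by (intro continuous_intros cont contf) (use t in auto)
    have [measurable]: "G \<in> borel_measurable borel" "F \<in> borel_measurable borel"
      using Gcont by (auto intro!: borel_measurable_continuous_onI continuous_at_imp_continuous_on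
        has_derivative_continuous[OF Fder])
    have F1: "F x = 1" if "x \<in> E (2 * t)" for x
    proof -
      have "f x / t \<ge> 2 \<or> - (f x / t) \<ge> 2" using that t by (auto simp: E_def field_simps abs_if split: if_splits)
      then show ?thesis unfolding F_def by (auto simp: smoothstep_eq)
    qed
    have F0: "F x = 0" if "x \<notin> E t" for x
    proof -
      have "f x / t \<le> 1" "- (f x / t) \<le> 1" using that t by (auto simp: E_def field_simps abs_if split: if_splits)
      then show ?thesis unfolding F_def by (auto simp: smoothstep_eq)
    qed
    have Gb: "ennreal (norm (G x) powr p) \<le> ennreal ((2 / t) powr p) * (indicator {x. t < \<bar>f x\<bar> \<and> \<bar>f x\<bar> < 2 * t} x * ennreal (norm (g x) powr p))" for x
    proof (cases "t < \<bar>f x\<bar> \<and> \<bar>f x\<bar> < 2 * t")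
      case True
      \<comment> \<open>At most one of the two steps is active at a point, so the slopes do not add
        up and the bound stays 2.\<close>
      have "f x / t \<le> 1 \<or> - (f x / t) \<le> 1" by linarith
      then have "\<bar>smoothstep' (f x / t) - smoothstep' (- (f x / t))\<bar> \<le> 2"
        using abs_smoothstep'_le[of "f x / t"] abs_smoothstep'_le[of "- (f x / t)"]
        by (auto simp: smoothstep'_eq_0)
      then have "norm (G x) \<le> (2 / t) * norm (g x)"
        using t by (auto simp: G_def intro!: divide_right_mono mult_right_mono)
      then have "norm (G x) powr p \<le> ((2 / t) * norm (g x)) powr p" using p by (intro powr_mono2) auto
      also have "\<dots> = (2 / t) powr p * norm (g x) powr p" by (rule powr_mult)
      finally show ?thesis using True by (simp add: ennreal_mult'[symmetric] ennreal_leI)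
    next
      case False
      then have "(f x / t \<le> 1 \<or> 2 \<le> f x / t) \<and> (- (f x / t) \<le> 1 \<or> 2 \<le> - (f x / t))"
        using t by (auto simp: field_simps abs_if split: if_splits)
      then have "G x = 0" by (auto simp: G_def smoothstep'_eq_0)
      then show ?thesis using p by simp
    qed
    define I where "I = (\<integral>\<^sup>+x. ennreal (norm (G x) powr p) \<partial>lborel)"
    define J where "J = (\<integral>\<^sup>+x. indicator {x. t < \<bar>f x\<bar> \<and> \<bar>f x\<bar> < 2 * t} x * ennreal (norm (g x) powr p) \<partial>lborel)"
    have "I \<le> (\<integral>\<^sup>+x. ennreal ((2 / t) powr p) * (indicator {x. t < \<bar>f x\<bar> \<and> \<bar>f x\<bar> < 2 * t} x * ennreal (norm (g x) powr p)) \<partial>lborel)"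
      unfolding I_def by (intro nn_integral_mono Gb)
    also have "\<dots> = ennreal ((2 / t) powr p) * J"
      unfolding J_def by (rule nn_integral_cmult) measurable
    finally have IJ: "I \<le> ennreal ((2 / t) powr p) * J" .
    have inner: "ennreal a \<le> (\<integral>\<^sup>+h. indicator (ball 0 r) h * ennreal (\<bar>F (x + h) - F x\<bar> powr p) \<partial>lborel)"
      if x: "x \<in> E (2 * t)" for x
    proof -
      define V where "V = {h. x + h \<in> E t}"
      have [measurable]: "V \<in> sets borel" unfolding V_def by measurable
      have "emeasure lborel (E t) = emeasure (distr lborel borel ((+) x)) (E t)"
        by (simp add: lborel_distr_plus)
      also have "\<dots> = emeasure lborel V"
        by (subst emeasure_distr) (auto simp: V_def vimage_def)
      finally have V: "emeasure lborel V = ennreal a" using Eeq[OF t] by (simp add: a_def)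
      have "ennreal (2 * a) \<le> emeasure lborel ((ball 0 r - V) \<union> V)"
        unfolding Hvol[symmetric] by (intro emeasure_mono) auto
      also have "\<dots> \<le> emeasure lborel (ball 0 r - V) + ennreal a"
        unfolding V[symmetric] by (intro emeasure_subadditive) auto
      finally have "ennreal a \<le> emeasure lborel (ball 0 r - V)"
        using a by (cases "emeasure lborel (ball 0 r - V)") (auto simp: ennreal_plus[symmetric] simp del: ennreal_plus)
      also have "\<dots> = (\<integral>\<^sup>+h. indicator (ball 0 r - V) h \<partial>lborel)" by simp
      also have "\<dots> \<le> (\<integral>\<^sup>+h. indicator (ball 0 r) h * ennreal (\<bar>F (x + h) - F x\<bar> powr p) \<partial>lborel)"
        by (intro nn_integral_mono) (auto simp: indicator_def V_def F0 F1[OF x])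
      finally show ?thesis .
    qed
    have [measurable]: "ball (0::'a) r \<in> sets borel" by simp
    have [measurable]: "(\<lambda>z. F (fst z + snd z)) \<in> borel_measurable (lborel \<Otimes>\<^sub>M lborel)"
      by (rule measurable_compose[of _ _ borel]) measurable
    have "ennreal a * emeasure lborel (E (2 * t)) = (\<integral>\<^sup>+x. ennreal a * indicator (E (2 * t)) x \<partial>lborel)"
      by (simp add: nn_integral_cmult)
    also have "\<dots> \<le> (\<integral>\<^sup>+x. (\<integral>\<^sup>+h. indicator (ball 0 r) h * ennreal (\<bar>F (x + h) - F x\<bar> powr p) \<partial>lborel) \<partial>lborel)"
      using inner by (intro nn_integral_mono) (auto simp: indicator_def)
    also have "\<dots> = (\<integral>\<^sup>+h. (\<integral>\<^sup>+x. indicator (ball 0 r) h * ennreal (\<bar>F (x + h) - F x\<bar> powr p) \<partial>lborel) \<partial>lborel)"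
      by (rule lborel_pair.Fubini'[symmetric]) (simp add: split_beta)
    also have "\<dots> \<le> (\<integral>\<^sup>+h. indicator (ball (0::'a) r) h * (ennreal (r powr p) * I) \<partial>lborel)"
    proof (rule nn_integral_mono)
      fix h :: 'a
      have "(\<integral>\<^sup>+x. indicator (ball 0 r) h * ennreal (\<bar>F (x + h) - F x\<bar> powr p) \<partial>lborel)
        = indicator (ball 0 r) h * (\<integral>\<^sup>+x. ennreal (\<bar>F (x + h) - F x\<bar> powr p) \<partial>lborel)"
        by (rule nn_integral_cmult) measurable
      also have "\<dots> \<le> indicator (ball 0 r) h * (ennreal (norm h powr p) * I)"
        unfolding I_def by (intro mult_left_mono integral_translate_difference_le[OF Fder Gcont p]) auto
      also have "\<dots> \<le> indicator (ball 0 r) h * (ennreal (r powr p) * I)"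
        using p by (auto simp: indicator_def intro!: mult_right_mono ennreal_leI powr_mono2)
      finally show "(\<integral>\<^sup>+x. indicator (ball 0 r) h * ennreal (\<bar>F (x + h) - F x\<bar> powr p) \<partial>lborel)
         \<le> indicator (ball 0 r) h * (ennreal (r powr p) * I)" .
    qed
    also have "\<dots> = ennreal (2 * a) * (ennreal (r powr p) * I)"
      by (subst nn_integral_multc) (auto simp: Hvol)
    also have "\<dots> = ennreal a * (2 * ennreal (r powr p) * I)"
      using a by (simp add: ennreal_mult' ac_simps)
    finally have "ennreal a * emeasure lborel (E (2 * t)) \<le> ennreal a * (2 * ennreal (r powr p) * I)" .
    then have "emeasure lborel (E (2 * t)) \<le> 2 * ennreal (r powr p) * I"
      using a by (subst (asm) ennreal_mult_le_mult_iff) auto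
    also have "\<dots> \<le> 2 * ennreal (r powr p) * (ennreal ((2 / t) powr p) * J)"
      by (intro mult_left_mono IJ) auto
    also have "\<dots> = ennreal (2 * r powr p * (2 / t) powr p) * J"
      by (simp add: ennreal_mult' ac_simps)
    also have "2 * r powr p * (2 / t) powr p = 2 * 2 powr p * (2 / w) powr (p / n) * a powr (p / n) * t powr (- p)"
    proof -
      have "r powr p = (2 / w) powr (p / n) * a powr (p / n)"
        using a w by (simp add: r_def powr_powr powr_mult[symmetric])
      moreover have "(2 / t) powr p = 2 powr p * t powr (- p)"
        using t by (simp add: powr_divide powr_minus_divide)
      ultimately show ?thesis by simp
    qed
    finally show ?thesis
      using t by (simp add: J_def w_def n_def a_def Eeq)
  qed
qed

section \<open>Dyadic summation over level sets\<close>

lemma dyadic_shell: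
  fixes y R :: real
  assumes "0 < y" "y < R"
  shows "\<exists>j. R / 2 ^ Suc j \<le> y \<and> y < R / 2 ^ j"
proof -
  define j where "j = (LEAST j. R / 2 ^ j \<le> y)"
  obtain i where "R / y < 2 ^ i" using real_arch_pow[of 2 "R / y"] by auto
  then have ex: "R / 2 ^ i \<le> y" using assms by (simp add: field_simps)
  have j: "R / 2 ^ j \<le> y" unfolding j_def using ex by (rule LeastI[where P="\<lambda>j. R / 2 ^ j \<le> y"])
  then have "j \<noteq> 0" using assms by (intro notI) simp
  then obtain k where k: "j = Suc k" by (cases j) auto
  have "\<not> R / 2 ^ k \<le> y" using not_less_Least[of k "\<lambda>j. R / 2 ^ j \<le> y"] k by (simp add: j_def)
  then show ?thesis using j k by (intro exI[of _ k]) auto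
qed

lemma dyadic_shells_disjoint:
  fixes f :: "'a \<Rightarrow> real"
  assumes "0 \<le> R"
  shows "disjoint_family (\<lambda>j. {x. R / 2 ^ Suc j \<le> f x \<and> f x < R / 2 ^ j})"
proof -
  have le: "R / 2 ^ j \<le> R / 2 ^ Suc i" if "i < j" for i j :: nat
    using that assms by (intro divide_left_mono power_increasing) auto
  show ?thesis
    unfolding disjoint_family_on_def
  proof (intro ballI impI)
    fix i j :: nat
    assume "i \<noteq> j"
    then consider "i < j" | "j < i" by linarith
    then show "{x. R / 2 ^ Suc i \<le> f x \<and> f x < R / 2 ^ i} \<inter> {x. R / 2 ^ Suc j \<le> f x \<and> f x < R / 2 ^ j} = {}"
      by cases (use le in fastforce)+
  qed
qed

lemma integrable_lborel_compact_support:
  fixes k :: "'a::euclidean_space \<Rightarrow> real"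
  assumes k: "continuous_on UNIV k" and 0: "\<And>x. norm x > R \<Longrightarrow> k x = 0"
  shows "integrable lborel k"
proof -
  have "integrable lborel (\<lambda>x. indicator (cball 0 R) x *\<^sub>R k x)"
    by (intro borel_integrable_compact) (auto intro: continuous_on_subset[OF k])
  also have "(\<lambda>x. indicator (cball 0 R) x *\<^sub>R k x) = k"
    using 0 by (force simp: indicator_def)
  finally show ?thesis .
qed

text \<open>The range of |f| is split at dyadic levels. The mass of |f|^q where 2t \<le> |f| < 4t is
  bounded through \<open>level_set_estimate\<close> by the gradient where t < |f| < 2t, and these
  bands are disjoint. The measure of the set t \<le> |f| is controlled by Chebyshev's inequality;
  since q p/n = q - p, all powers of t cancel and the factor is the same at every level. The
  integral of |f|^q remains on the right with the power p/n < 1.\<close>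

lemma gagliardo_nirenberg_sobolev_powr:
  fixes f :: "'a::euclidean_space \<Rightarrow> real" and g :: "'a \<Rightarrow> 'a" and p :: real
  assumes der: "\<And>x. (f has_derivative (\<lambda>h. g x \<bullet> h)) (at x)" and cont: "continuous_on UNIV g"
    and supp: "\<And>x. norm x > R \<Longrightarrow> f x = 0" "\<And>x. norm x > R \<Longrightarrow> g x = 0"
    and p: "1 < p" "p < DIM('a)"
  defines "q \<equiv> sobolev_exponent DIM('a) p"
  shows "(\<integral>x. \<bar>f x\<bar> powr q \<partial>lborel)
     \<le> 4 powr q * (2 * 2 powr p * (2 / unit_ball_vol DIM('a)) powr (p / DIM('a)))
       * (\<integral>x. \<bar>f x\<bar> powr q \<partial>lborel) powr (p / DIM('a)) * (\<integral>x. norm (g x) powr p \<partial>lborel)"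
proof -
  define n where "n = real DIM('a)"
  have np: "0 < n" "p < n" "1 < p" using p by (auto simp: n_def)
  have q: "q = p * n / (n - p)" by (simp add: q_def sobolev_exponent_def n_def)
  have q0: "q > 0" using np by (simp add: q)
  have qpn: "q * (p / n) = q - p" using np by (simp add: q field_simps)
  define C where "C = 2 * 2 powr p * (2 / unit_ball_vol n) powr (p / n)"
  have C0: "C \<ge> 0" unfolding C_def by simp
  define M where "M = (\<integral>x. \<bar>f x\<bar> powr q \<partial>lborel)"
  define P where "P = (\<integral>x. norm (g x) powr p \<partial>lborel)"
  have contf: "continuous_on UNIV f"
    by (intro continuous_at_imp_continuous_on ballI has_derivative_continuous[OF der])
  have [measurable]: "f \<in> borel_measurable borel" "g \<in> borel_measurable borel"
    using cont contf by (auto intro: borel_measurable_continuous_onI)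
  have intf: "integrable lborel (\<lambda>x. \<bar>f x\<bar> powr q)"
    using supp q0 by (intro integrable_lborel_compact_support continuous_on_powr' continuous_intros contf) auto
  have intg: "integrable lborel (\<lambda>x. norm (g x) powr p)"
    using supp np by (intro integrable_lborel_compact_support continuous_on_powr' continuous_intros cont) auto
  have M0: "M \<ge> 0" "P \<ge> 0" unfolding M_def P_def by auto
  have Mnn: "(\<integral>\<^sup>+x. ennreal (\<bar>f x\<bar> powr q) \<partial>lborel) = ennreal M"
    unfolding M_def by (rule nn_integral_eq_integral[OF intf]) auto
  have Pnn: "(\<integral>\<^sup>+x. ennreal (norm (g x) powr p) \<partial>lborel) = ennreal P"
    unfolding P_def by (rule nn_integral_eq_integral[OF intg]) auto
  obtain B where B: "\<And>x. \<bar>f x\<bar> < B"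
  proof -
    have "bounded (f ` cball 0 R)"
      by (intro compact_imp_bounded compact_continuous_image continuous_on_subset[OF contf]) auto
    then obtain b where b: "\<And>x. norm x \<le> R \<Longrightarrow> \<bar>f x\<bar> \<le> b"
      unfolding bounded_iff by force
    have "\<bar>f x\<bar> < max b 0 + 1" for x
      using b[of x] supp(1)[of x] by (cases "norm x \<le> R") auto
    then show ?thesis by (rule that)
  qed
  have B0: "B > 0" using B[of 0] by linarith
  define E where "E t = {x. t \<le> \<bar>f x\<bar>}" for t
  \<comment> \<open>With t = B / (4 2^j), \<open>D j\<close> is the set 2t \<le> |f| < 4t and
    \<open>D' j\<close> the set t < |f| < 2t. As |f| < \<open>B\<close>, the shells
    \<open>D j\<close> exhaust the points where \<open>f\<close> is nonzero.\<close>
  define D where "D j = {x. B / 2 ^ Suc j \<le> \<bar>f x\<bar> \<and> \<bar>f x\<bar> < B / 2 ^ j}" for j :: nat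
  define D' where "D' j = {x. (B / 4) / 2 ^ j < \<bar>f x\<bar> \<and> \<bar>f x\<bar> < 2 * ((B / 4) / 2 ^ j)}" for j :: nat
  have [measurable]: "E t \<in> sets borel" "D j \<in> sets borel" "D' j \<in> sets borel" for t j
    unfolding E_def D_def D'_def by measurable
  have disjD: "disjoint_family D"
    unfolding D_def using B0 by (intro dyadic_shells_disjoint) auto
  \<comment> \<open>The bands \<open>D' j\<close> lie in the dyadic shells that start at
    \<open>B / 2\<close>.\<close>
  have "disjoint_family (\<lambda>j. {x. (B / 2) / 2 ^ Suc j \<le> \<bar>f x\<bar> \<and> \<bar>f x\<bar> < (B / 2) / 2 ^ j})"
    using B0 by (intro dyadic_shells_disjoint) auto
  then have disjD': "disjoint_family D'"
    by (rule disjoint_family_on_bisimulation) (auto simp: D'_def disjoint_iff)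
  have step: "(\<integral>\<^sup>+x. indicator (D j) x * ennreal (\<bar>f x\<bar> powr q) \<partial>lborel)
      \<le> ennreal (4 powr q * C * M powr (p / n)) * (\<integral>\<^sup>+x. indicator (D' j) x * ennreal (norm (g x) powr p) \<partial>lborel)" for j
  proof -
    define t where "t = (B / 4) / 2 ^ j"
    have t: "t > 0" using B0 by (simp add: t_def)
    have B_eq: "B / (2 * 2 ^ j) = 2 * t" "B / 2 ^ j = 4 * t" by (simp_all add: t_def)
    have E_fin: "emeasure lborel (E s) = ennreal (measure lborel (E s))" if "s > 0" for s
    proof -
      have "E s \<subseteq> cball 0 R" using supp that by (force simp: E_def not_le[symmetric])
      then have "emeasure lborel (E s) < \<infinity>"
        using emeasure_mono[of "E s" "cball 0 R" lborel] emeasure_bounded_finite[of "cball (0::'a) R"]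
        by (simp add: le_less_trans)
      then show ?thesis by (simp add: emeasure_eq_ennreal_measure)
    qed
    define a where "a = measure lborel (E t)"
    have level: "ennreal (measure lborel (E (2 * t))) \<le> ennreal (C * a powr (p / n) * t powr (- p)) *
        (\<integral>\<^sup>+x. indicator (D' j) x * ennreal (norm (g x) powr p) \<partial>lborel)"
      using level_set_estimate[OF der cont supp(1) np(3) t]
      unfolding C_def a_def E_def D'_def t_def[symmetric] n_def .
    have "ennreal (t powr q * a) = (\<integral>\<^sup>+x. ennreal (t powr q) * indicator (E t) x \<partial>lborel)"
      using t by (simp add: nn_integral_cmult E_fin a_def ennreal_mult')
    also have "\<dots> \<le> (\<integral>\<^sup>+x. ennreal (\<bar>f x\<bar> powr q) \<partial>lborel)"
      using t q0 by (intro nn_integral_mono) (auto simp: indicator_def E_def intro!: ennreal_leI powr_mono2)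
    finally have cheb: "t powr q * a \<le> M" using M0 by (simp add: Mnn)
    have "(\<integral>\<^sup>+x. indicator (D j) x * ennreal (\<bar>f x\<bar> powr q) \<partial>lborel)
       \<le> (\<integral>\<^sup>+x. ennreal ((4 * t) powr q) * indicator (E (2 * t)) x \<partial>lborel)"
      using q0 by (intro nn_integral_mono)
        (use t in \<open>auto simp: indicator_def E_def D_def B_eq intro!: ennreal_leI powr_mono2\<close>)
    also have "\<dots> = ennreal ((4 * t) powr q) * ennreal (measure lborel (E (2 * t)))"
      using t by (simp add: nn_integral_cmult E_fin)
    also have "\<dots> \<le> ennreal ((4 * t) powr q) * (ennreal (C * a powr (p / n) * t powr (- p)) *
        (\<integral>\<^sup>+x. indicator (D' j) x * ennreal (norm (g x) powr p) \<partial>lborel))"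
      by (intro mult_left_mono level) auto
    also have "\<dots> = ennreal (4 powr q * C * (t powr q * a) powr (p / n)) * (\<integral>\<^sup>+x. indicator (D' j) x * ennreal (norm (g x) powr p) \<partial>lborel)"
    proof -
      have "(t powr q * a) powr (p / n) = t powr q * t powr (- p) * a powr (p / n)"
      proof -
        have "(t powr q) powr (p / n) = t powr (q + - p)" by (simp only: powr_powr qpn diff_conv_add_uminus)
        also have "\<dots> = t powr q * t powr (- p)" by (rule powr_add)
        finally show ?thesis by (simp only: powr_mult)
      qed
      then have e: "(4 * t) powr q * (C * a powr (p / n) * t powr (- p)) = 4 powr q * C * (t powr q * a) powr (p / n)"
        by (simp only: powr_mult[of 4 t]) (simp only: mult_ac)
      show ?thesis
        unfolding e[symmetric] using C0 by (simp only: ennreal_mult' powr_ge_zero mult.assoc)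
    qed
    also have "\<dots> \<le> ennreal (4 powr q * C * M powr (p / n)) * (\<integral>\<^sup>+x. indicator (D' j) x * ennreal (norm (g x) powr p) \<partial>lborel)"
      using cheb C0 t np by (intro mult_right_mono ennreal_leI mult_left_mono powr_mono2) (auto simp: a_def)
    finally show ?thesis .
  qed
  have "ennreal M = (\<integral>\<^sup>+x. (\<Sum>j. indicator (D j) x * ennreal (\<bar>f x\<bar> powr q)) \<partial>lborel)"
    unfolding Mnn[symmetric]
  proof (rule nn_integral_cong)
    fix x
    have "(\<Sum>j. indicator (D j) x * ennreal (\<bar>f x\<bar> powr q)) = indicator (\<Union>j. D j) x * ennreal (\<bar>f x\<bar> powr q)"
      by (simp add: suminf_indicator[OF disjD])
    moreover have "x \<in> (\<Union>j. D j)" if "f x \<noteq> 0"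
      using dyadic_shell[of "\<bar>f x\<bar>" B] B that by (auto simp: D_def)
    ultimately show "ennreal (\<bar>f x\<bar> powr q) = (\<Sum>j. indicator (D j) x * ennreal (\<bar>f x\<bar> powr q))"
      using q0 by (cases "f x = 0") auto
  qed
  also have "\<dots> = (\<Sum>j. \<integral>\<^sup>+x. indicator (D j) x * ennreal (\<bar>f x\<bar> powr q) \<partial>lborel)"
    by (rule nn_integral_suminf) measurable
  also have "\<dots> \<le> (\<Sum>j. ennreal (4 powr q * C * M powr (p / n)) * (\<integral>\<^sup>+x. indicator (D' j) x * ennreal (norm (g x) powr p) \<partial>lborel))"
    by (intro suminf_le step) auto
  also have "\<dots> = ennreal (4 powr q * C * M powr (p / n)) * (\<Sum>j. \<integral>\<^sup>+x. indicator (D' j) x * ennreal (norm (g x) powr p) \<partial>lborel)"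
    by simp
  also have "(\<Sum>j. \<integral>\<^sup>+x. indicator (D' j) x * ennreal (norm (g x) powr p) \<partial>lborel)
      = (\<integral>\<^sup>+x. (\<Sum>j. indicator (D' j) x * ennreal (norm (g x) powr p)) \<partial>lborel)"
    by (rule nn_integral_suminf[symmetric]) measurable
  also have "\<dots> \<le> (\<integral>\<^sup>+x. ennreal (norm (g x) powr p) \<partial>lborel)"
    by (intro nn_integral_mono) (simp add: suminf_indicator[OF disjD'], simp add: indicator_def)
  also have "\<dots> = ennreal P" by (rule Pnn)
  finally have "ennreal M \<le> ennreal (4 powr q * C * M powr (p / n) * P)"
    using M0 C0 by (simp add: ennreal_mult' mult_left_mono)
  then have "M \<le> 4 powr q * C * M powr (p / n) * P"
    using M0 C0 by (subst (asm) ennreal_le_iff) auto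
  then show ?thesis unfolding M_def P_def C_def n_def by simp
qed

section \<open>Gradients of test functions and the sharp Euclidean constant\<close>

lemma inner_grad:
  assumes "f differentiable (at x)"
  shows "grad f x \<bullet> h = frechet_derivative f (at x) h"
proof -
  interpret linear "frechet_derivative f (at x)"
    using linear_frechet_derivative[OF assms] .
  have "frechet_derivative f (at x) h = frechet_derivative f (at x) (\<Sum>b\<in>Basis. (h \<bullet> b) *\<^sub>R b)"
    by (simp add: euclidean_representation)
  then show ?thesis
    by (subst inner_commute) (simp add: grad_def inner_sum_right sum scale mult.commute)
qed

lemma grad_eqI:
  assumes "(f has_derivative D) (at x)"
  shows "grad f x \<bullet> h = D h"
  using assms inner_grad[of f x h] frechet_derivative_at[OF assms] by (auto simp: differentiable_def)

lemma test_function_grad: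
  assumes "\<phi> \<in> test_functions"
  shows "(\<phi> has_derivative (\<lambda>h. grad \<phi> x \<bullet> h)) (at x)"
    and "continuous_on UNIV (grad \<phi>)"
    and "\<exists>R. \<forall>x. norm x > R \<longrightarrow> \<phi> x = 0 \<and> grad \<phi> x = 0"
proof -
  have sm: "times_cont_diff k \<phi>" for k using assms by (auto simp: test_functions_def smooth_def)
  from sm[of 1] have d: "\<phi> differentiable (at x)" for x by simp
  have der: "(\<phi> has_derivative (\<lambda>h. grad \<phi> x \<bullet> h)) (at x)" for x
    using d[of x] by (simp add: inner_grad[OF d] frechet_derivative_works[symmetric])
  then show "(\<phi> has_derivative (\<lambda>h. grad \<phi> x \<bullet> h)) (at x)" .
  have "continuous_on UNIV (\<lambda>x. frechet_derivative \<phi> (at x) v)" for v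
    using times_cont_diff_SucD(2)[of 0, OF sm] by simp
  then show "continuous_on UNIV (grad \<phi>)"
    unfolding grad_def[abs_def] by (intro continuous_intros)
  have "bounded (closure {x. \<phi> x \<noteq> 0})" 
    using assms by (auto simp: test_functions_def intro: compact_imp_bounded)
  then obtain R where R: "\<And>x. x \<in> closure {x. \<phi> x \<noteq> 0} \<Longrightarrow> norm x \<le> R" by (auto simp: bounded_iff)
  have z: "\<phi> x = 0" if "norm x > R" for x
    using that R[of x] closure_subset[of "{x. \<phi> x \<noteq> 0}"] by force
  have "grad \<phi> x = 0" if x: "norm x > R" for x
  proof -
    have "open {y::'a. R < norm y}" by (intro open_Collect_less continuous_intros)
    then have "(\<phi> has_derivative (\<lambda>h. 0)) (at x)"
      by (rule has_derivative_transform_within_open[OF has_derivative_const[of 0]]) (use x z in auto)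
    from grad_eqI[OF this, of "grad \<phi> x"] show ?thesis by simp
  qed
  with z show "\<exists>R. \<forall>x. norm x > R \<longrightarrow> \<phi> x = 0 \<and> grad \<phi> x = 0" by blast
qed

text \<open>Only finiteness matters: \<open>K\<close> bounds the set whose supremum is the sharp
  constant. When the integral of |\<phi>|^q is positive, its power p/n is divided out, leaving the
  exponent 1 - p/n = p/q.\<close>

lemma gagliardo_nirenberg_sobolev:
  fixes p :: real
  assumes p: "1 < p" "p < DIM('a::euclidean_space)"
  shows "\<exists>K. \<forall>\<phi> \<in> (test_functions :: ('a \<Rightarrow> real) set).
    lp_norm lborel (sobolev_exponent DIM('a) p) \<phi> \<le> K * lp_norm lborel p (grad \<phi>)"
proof -
  define n where "n = real DIM('a)"
  define q where "q = sobolev_exponent DIM('a) p"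
  have np: "0 < n" "p < n" using p by (auto simp: n_def)
  have q: "q = p * n / (n - p)" by (simp add: q_def sobolev_exponent_def n_def)
  have q0: "q > 0" using np p by (simp add: q)
  have pn: "1 - p / n = p / q" using np p q0 by (simp add: q field_simps)
  define C where "C = 4 powr q * (2 * 2 powr p * (2 / unit_ball_vol DIM('a)) powr (p / DIM('a)))"
  have C0: "C \<ge> 0" unfolding C_def by simp
  have "lp_norm lborel q \<phi> \<le> C powr (1 / p) * lp_norm lborel p (grad \<phi>)"
    if \<phi>: "\<phi> \<in> (test_functions :: ('a \<Rightarrow> real) set)" for \<phi>
  proof -
    obtain R where R: "\<And>x. norm x > R \<Longrightarrow> \<phi> x = 0" "\<And>x. norm x > R \<Longrightarrow> grad \<phi> x = 0"
      using test_function_grad(3)[OF \<phi>] by blast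
    define M where "M = (\<integral>x. \<bar>\<phi> x\<bar> powr q \<partial>lborel)"
    define P where "P = (\<integral>x. norm (grad \<phi> x) powr p \<partial>lborel)"
    have M0: "M \<ge> 0" "P \<ge> 0" unfolding M_def P_def by auto
    have main: "M \<le> C * M powr (p / n) * P"
      using gagliardo_nirenberg_sobolev_powr[OF test_function_grad(1,2)[OF \<phi>] R p]
      unfolding M_def P_def C_def q_def n_def by simp
    have "M powr (1 / q) \<le> (C * P) powr (1 / p)"
    proof (cases "M = 0")
      case False
      then have "M > 0" using M0 by simp
      then have "M powr (p / q) = M / M powr (p / n)"
        unfolding pn[symmetric] powr_diff by simp
      also have "\<dots> \<le> C * P" using main \<open>M > 0\<close> by (simp add: divide_le_eq mult.commute mult.left_commute)
      finally have "(M powr (p / q)) powr (1 / p) \<le> (C * P) powr (1 / p)"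
        using p by (intro powr_mono2) auto
      then show ?thesis using p by (simp add: powr_powr)
    qed simp
    then show ?thesis
      by (simp add: lp_norm_def M_def P_def powr_mult)
  qed
  then show ?thesis unfolding q_def by blast
qed

lemma sobolev_inequality:
  fixes p :: real
  assumes p: "1 < p" "p < DIM('a::euclidean_space)"
    and \<phi>: "\<phi> \<in> (test_functions :: ('a \<Rightarrow> real) set)"
  shows "lp_norm lborel (sobolev_exponent DIM('a) p) \<phi> powr p
    \<le> sobolev_const TYPE('a) p powr p * lp_norm lborel p (grad \<phi>) powr p"
proof -
  define q where "q = sobolev_exponent DIM('a) p"
  have q0: "q > 0" unfolding q_def sobolev_exponent_def using p by simp
  have nn: "0 \<le> lp_norm lborel q \<psi>" "0 \<le> lp_norm lborel p (grad \<psi>)" for \<psi> :: "'a \<Rightarrow> real"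
    by (simp_all add: lp_norm_def)
  obtain K where K: "\<And>\<phi>. \<phi> \<in> (test_functions :: ('a \<Rightarrow> real) set) \<Longrightarrow> lp_norm lborel q \<phi> \<le> K * lp_norm lborel p (grad \<phi>)"
    using gagliardo_nirenberg_sobolev[OF p] unfolding q_def by blast
  show ?thesis
  proof (cases "\<phi> = (\<lambda>x. 0)")
    case True
    then show ?thesis using q0 p by (simp add: lp_norm_def q_def)
  next
    case False
    have bdd: "bdd_above ((\<lambda>\<phi>. lp_norm lborel q \<phi> / lp_norm lborel p (grad \<phi>)) ` ((test_functions :: ('a \<Rightarrow> real) set) - {\<lambda>x. 0}))"
    proof (rule bdd_aboveI2)
      fix \<psi> :: "'a \<Rightarrow> real" assume \<psi>: "\<psi> \<in> test_functions - {\<lambda>x. 0}"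
      show "lp_norm lborel q \<psi> / lp_norm lborel p (grad \<psi>) \<le> max K 0"
        using K[of \<psi>] \<psi> nn(2)[of \<psi>]
        by (cases "lp_norm lborel p (grad \<psi>) = 0") (auto simp: divide_le_eq max_def intro: order_trans mult_nonpos_nonneg)
    qed
    have S: "lp_norm lborel q \<phi> / lp_norm lborel p (grad \<phi>) \<le> sobolev_const TYPE('a) p"
      unfolding sobolev_const_def q_def[symmetric] by (rule cSUP_upper[OF _ bdd]) (use \<phi> False in auto)
    have "lp_norm lborel q \<phi> \<le> sobolev_const TYPE('a) p * lp_norm lborel p (grad \<phi>)"
    proof (cases "lp_norm lborel p (grad \<phi>) = 0")
      \<comment> \<open>A quotient with denominator 0 is 0, so the supremum says nothing here; the
        bound with \<open>K\<close> shows that the left side is at most 0.\<close>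
      case True
      then show ?thesis using K[OF \<phi>] by simp
    next
      case False
      then show ?thesis using S nn(2)[of \<phi>] by (simp add: divide_le_eq)
    qed
    then have "lp_norm lborel q \<phi> powr p \<le> (sobolev_const TYPE('a) p * lp_norm lborel p (grad \<phi>)) powr p"
      using nn p by (intro powr_mono2) auto
    then show ?thesis by (simp add: powr_mult q_def)
  qed
qed

section \<open>The surface measure\<close>

abbreviation \<mu> :: "'a::euclidean_space measure" where "\<mu> \<equiv> sphere_measure"

lemma space_sphere_measure [simp]: "space \<mu> = sphere 0 1"
  and sets_sphere_measure: "sets \<mu> = sets (restrict_space borel (sphere 0 1))"
  by (simp_all add: sphere_measure_def space_scale_measure space_restrict_space)

lemma borel_measurable_sphere_measure:
  "f \<in> borel_measurable borel \<Longrightarrow> f \<in> borel_measurable \<mu>"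
  by (subst measurable_cong_sets[OF sets_sphere_measure refl]) (rule measurable_restrict_space1)

lemma measurable_radial_projection:
  "(\<lambda>x::'a::euclidean_space. x /\<^sub>R norm x) \<in> restrict_space lborel (cball 0 1 - {0}) \<rightarrow>\<^sub>M restrict_space borel (sphere 0 1)"
  by (rule measurable_restrict_space2) (auto simp: space_restrict_space intro!: measurable_restrict_space1)

lemma borel_measurable_radial_projection:
  "(\<lambda>x::'a::euclidean_space. x /\<^sub>R norm x) \<in> borel_measurable borel"
  by (intro borel_measurable_scaleR borel_measurable_inverse borel_measurable_norm) simp_all

lemma nn_integral_sphere_measure:
  fixes F :: "'a::euclidean_space \<Rightarrow> ennreal"
  assumes F: "F \<in> borel_measurable borel"
  shows "(\<integral>\<^sup>+x. F x \<partial>\<mu>) = of_nat DIM('a) * (\<integral>\<^sup>+x. F (x /\<^sub>R norm x) * indicator (cball 0 1 - {0}) x \<partial>lborel)"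
proof -
  have F': "F \<in> borel_measurable (restrict_space borel (sphere 0 1))"
    by (rule measurable_restrict_space1[OF F])
  show ?thesis
    unfolding sphere_measure_def
    using F' by (simp add: nn_integral_scale_measure nn_integral_distr[OF measurable_radial_projection] nn_integral_restrict_space)
qed

lemma finite_sphere_measure: "finite_measure (\<mu> :: 'a::euclidean_space measure)"
proof (rule finite_measureI)
  have "emeasure lborel (cball (0::'a) 1 - {0}) \<le> emeasure lborel (cball (0::'a) 1)"
    by (intro emeasure_mono) auto
  also have "\<dots> < \<infinity>" by (rule emeasure_bounded_finite) auto
  finally have "(\<integral>\<^sup>+x. 1 \<partial>(\<mu> :: 'a measure)) < \<infinity>"
    by (subst nn_integral_sphere_measure) (auto simp: ennreal_mult_less_top of_nat_less_top)
  then show "emeasure \<mu> (space (\<mu>::'a measure)) \<noteq> \<infinity>" by simp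
qed

section \<open>Rotation invariance of Lebesgue and surface measure\<close>

lemma orthogonal_transformation_borel:
  fixes T :: "'a::euclidean_space \<Rightarrow> 'a"
  assumes "orthogonal_transformation T" shows "T \<in> borel_measurable borel"
  using assms by (intro borel_measurable_continuous_onI linear_continuous_on
      linear_conv_bounded_linear[THEN iffD1] orthogonal_transformation_linear)

text \<open>Uniqueness of Haar measure in the only case needed: the two convolution-type double integrals of
  \<open>f\<close> against the indicator of a ball agree, and the ball is invariant.\<close>

lemma lborel_distr_orthogonal:
  fixes T :: "'a::euclidean_space \<Rightarrow> 'a"
  assumes T: "orthogonal_transformation T"
  shows "distr lborel borel T = lborel"
proof (rule measure_eqI)
  have lin: "linear T" using T by (rule orthogonal_transformation_linear)
  have nT: "norm (T x) = norm x" for x using T by (rule orthogonal_transformation_norm)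
  have [measurable]: "T \<in> borel_measurable borel" by (rule orthogonal_transformation_borel[OF T])
  have Tsurj: "\<exists>w. T w = y" for y
    using orthogonal_transformation_surj[OF T] by (metis surjD)
  have tr: "(\<integral>\<^sup>+x. f (x + y) \<partial>lborel) = (\<integral>\<^sup>+x. f x \<partial>lborel)"
    if [measurable]: "f \<in> borel_measurable borel" for f :: "'a \<Rightarrow> ennreal" and y
  proof -
    have "(\<integral>\<^sup>+x. f x \<partial>lborel) = (\<integral>\<^sup>+x. f x \<partial>distr lborel borel ((+) y))" by (simp only: lborel_distr_plus)
    also have "\<dots> = (\<integral>\<^sup>+x. f (y + x) \<partial>lborel)" by (subst nn_integral_distr) auto
    finally show ?thesis by (simp add: add.commute)
  qed
  have trT: "(\<integral>\<^sup>+x. f (T x + y) \<partial>lborel) = (\<integral>\<^sup>+x. f (T x) \<partial>lborel)"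
    if [measurable]: "f \<in> borel_measurable borel" for f :: "'a \<Rightarrow> ennreal" and y
  proof -
    obtain w where w: "y = T w" using Tsurj by metis
    have "(\<integral>\<^sup>+x. f (T x + y) \<partial>lborel) = (\<integral>\<^sup>+x. f (T (x + w)) \<partial>lborel)" by (simp add: w linear_add[OF lin])
    also have "\<dots> = (\<integral>\<^sup>+x. f (T x) \<partial>lborel)" by (rule tr[of "\<lambda>x. f (T x)"]) measurable
    finally show ?thesis .
  qed
  define B where "B = ball (0::'a) 1"
  have [measurable]: "B \<in> sets borel" by (simp add: B_def)
  have B: "emeasure lborel B \<noteq> 0" "emeasure lborel B \<noteq> \<infinity>"
    using emeasure_bounded_finite[of B] by (auto simp: B_def emeasure_ball unit_ball_vol_pos less_imp_neq[symmetric])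
  fix A assume "A \<in> sets (distr lborel borel T)"
  then have [measurable]: "A \<in> sets borel" by simp
  let ?f = "indicator A :: 'a \<Rightarrow> ennreal" and ?g = "indicator B :: 'a \<Rightarrow> ennreal"
  \<comment> \<open>The double integral of \<open>?f (T x + y) * ?g y\<close> is evaluated twice.
    Integrating in \<open>x\<close> first, \<open>trT\<close> removes the shift. Substituting in
    \<open>y\<close> first moves the shift to \<open>?g (y - T x)\<close>, whose integral in
    \<open>x\<close> is the volume of \<open>B\<close>, as \<open>B\<close> is invariant under
    \<open>T\<close> and under negation.\<close>
  have "emeasure lborel B * (\<integral>\<^sup>+x. ?f (T x) \<partial>lborel) = (\<integral>\<^sup>+y. (\<integral>\<^sup>+x. ?f (T x) \<partial>lborel) * ?g y \<partial>lborel)"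
    by (subst nn_integral_cmult) (auto simp: mult.commute)
  also have "\<dots> = (\<integral>\<^sup>+y. (\<integral>\<^sup>+x. ?f (T x + y) * ?g y \<partial>lborel) \<partial>lborel)"
    by (simp add: nn_integral_multc trT)
  also have "\<dots> = (\<integral>\<^sup>+x. (\<integral>\<^sup>+y. ?f (T x + y) * ?g y \<partial>lborel) \<partial>lborel)"
    by (rule lborel_pair.Fubini') (simp add: split_beta)
  also have "\<dots> = (\<integral>\<^sup>+x. (\<integral>\<^sup>+y. ?f y * ?g (y - T x) \<partial>lborel) \<partial>lborel)"
  proof (rule nn_integral_cong)
    fix x
    show "(\<integral>\<^sup>+y. ?f (T x + y) * ?g y \<partial>lborel) = (\<integral>\<^sup>+y. ?f y * ?g (y - T x) \<partial>lborel)"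
      using tr[of "\<lambda>y. ?f y * ?g (y - T x)" "T x"] by (simp add: add.commute)
  qed
  also have "\<dots> = (\<integral>\<^sup>+y. (\<integral>\<^sup>+x. ?f y * ?g (y - T x) \<partial>lborel) \<partial>lborel)"
    by (rule lborel_pair.Fubini') (simp add: split_beta)
  also have "\<dots> = (\<integral>\<^sup>+y. emeasure lborel B * ?f y \<partial>lborel)"
  proof (rule nn_integral_cong)
    fix y
    have "(\<integral>\<^sup>+x. ?g (y - T x) \<partial>lborel) = (\<integral>\<^sup>+x. ?g (- T x) \<partial>lborel)"
      using trT[of "\<lambda>x. ?g (- x)" "- y"] by simp
    also have "\<dots> = (\<integral>\<^sup>+x. ?g x \<partial>lborel)" by (simp add: B_def indicator_def nT)
    finally show "(\<integral>\<^sup>+x. ?f y * ?g (y - T x) \<partial>lborel) = emeasure lborel B * ?f y"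
      by (simp add: nn_integral_cmult mult.commute)
  qed
  also have "\<dots> = emeasure lborel B * emeasure lborel A"
    by (simp add: nn_integral_cmult)
  finally have "(\<integral>\<^sup>+x. ?f (T x) \<partial>lborel) = emeasure lborel A"
    using B by (simp add: ennreal_mult_cancel_left)
  moreover have "(\<integral>\<^sup>+x. ?f (T x) \<partial>lborel) = emeasure (distr lborel borel T) A"
    using nn_integral_distr[of T lborel borel ?f] by simp
  ultimately show "emeasure (distr lborel borel T) A = emeasure lborel A" by simp
qed simp

text \<open>\<open>T\<close> commutes with the radial projection and preserves the punctured ball,
  so the invariance of Lebesgue measure passes to the cone measure.\<close>

lemma sphere_measure_distr_orthogonal:
  fixes T :: "real^'m \<Rightarrow> real^'m"
  assumes T: "orthogonal_transformation T"
  shows "T \<in> \<mu> \<rightarrow>\<^sub>M \<mu>" "distr \<mu> \<mu> T = \<mu>"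
proof -
  have [measurable]: "T \<in> borel_measurable borel" by (rule orthogonal_transformation_borel[OF T])
  have nT: "norm (T x) = norm x" for x
    using T by (rule orthogonal_transformation_norm)
  have lin: "linear T" using T by (rule orthogonal_transformation_linear)
  have "T \<in> restrict_space borel (sphere 0 1) \<rightarrow>\<^sub>M restrict_space borel (sphere 0 1)"
    by (rule measurable_restrict_space2) (auto simp: space_restrict_space nT intro!: measurable_restrict_space1)
  then show T': "T \<in> \<mu> \<rightarrow>\<^sub>M \<mu>"
    by (subst measurable_cong_sets[OF sets_sphere_measure sets_sphere_measure])
  show "distr \<mu> \<mu> T = \<mu>"
  proof (rule measure_eqI)
    fix A assume "A \<in> sets (distr \<mu> \<mu> T)"
    then have A: "A \<in> sets \<mu>" by simp
    then have Ab [measurable]: "A \<in> sets borel" and Asub: "A \<subseteq> sphere 0 1"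
      by (auto simp: sets_sphere_measure sets_restrict_space)
    define G :: "real^'m \<Rightarrow> ennreal" where "G x = indicator A (x /\<^sub>R norm x) * indicator (cball 0 1 - {0}) x" for x
    have "(\<lambda>x. indicator A (x /\<^sub>R norm x) :: ennreal) \<in> borel_measurable borel"
      using measurable_compose[OF borel_measurable_radial_projection borel_measurable_indicator[OF Ab]] .
    then have [measurable]: "G \<in> borel_measurable borel"
      unfolding G_def by (intro borel_measurable_times_ennreal borel_measurable_indicator) auto
    have "emeasure (distr \<mu> \<mu> T) A = (\<integral>\<^sup>+x. indicator A (T x) \<partial>\<mu>)"
      using nn_integral_distr[OF T', of "indicator A"] A by simp
    also have "\<dots> = of_nat CARD('m) * (\<integral>\<^sup>+x. indicator A (T (x /\<^sub>R norm x)) * indicator (cball 0 1 - {0}) x \<partial>lborel)"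
      by (subst nn_integral_sphere_measure) auto
    also have "(\<integral>\<^sup>+x. indicator A (T (x /\<^sub>R norm x)) * indicator (cball 0 1 - {0}) x \<partial>lborel) = (\<integral>\<^sup>+x. G (T x) \<partial>lborel)"
    proof (rule nn_integral_cong)
      fix x
      have "T (x /\<^sub>R norm x) = T x /\<^sub>R norm (T x)" by (simp add: linear_cmul[OF lin] nT)
      moreover have "T x = 0 \<longleftrightarrow> x = 0" using nT[of x] by (metis norm_eq_zero)
      then have "indicator (cball 0 1 - {0}) x = (indicator (cball 0 1 - {0}) (T x) :: ennreal)"
        by (simp add: indicator_def nT)
      ultimately show "indicator A (T (x /\<^sub>R norm x)) * indicator (cball 0 1 - {0}) x
        = G (T x)"
        unfolding G_def by simp
    qed
    also have "\<dots> = (\<integral>\<^sup>+x. G x \<partial>distr lborel borel T)"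
      by (rule nn_integral_distr[symmetric]) measurable
    also have "\<dots> = (\<integral>\<^sup>+x. G x \<partial>lborel)"
      by (simp only: lborel_distr_orthogonal[OF T])
    also have "of_nat CARD('m) * \<dots> = (\<integral>\<^sup>+x. indicator A x \<partial>\<mu>)"
      unfolding G_def by (subst nn_integral_sphere_measure) auto
    also have "\<dots> = emeasure \<mu> A" using A by simp
    finally show "emeasure (distr \<mu> \<mu> T) A = emeasure \<mu> A" .
  qed simp
qed

lemma integral_sphere_orthogonal:
  fixes T :: "real^'m \<Rightarrow> real^'m" and f :: "real^'m \<Rightarrow> real"
  assumes "orthogonal_transformation T" "f \<in> borel_measurable \<mu>"
  shows "(\<integral>x. f (T x) \<partial>\<mu>) = (\<integral>x. f x \<partial>\<mu>)"
  using integral_distr[OF sphere_measure_distr_orthogonal(1)[OF assms(1)] assms(2)]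
    sphere_measure_distr_orthogonal(2)[OF assms(1)] by simp

text \<open>A rotation taking \<open>x\<close> to \<open>x'\<close> identifies the two integrals.
  The normalising constant of a zonal kernel is thereby independent of its centre.\<close>

lemma integral_zonal_eq:
  fixes x x' :: "real^'m" and f :: "real \<Rightarrow> real"
  assumes "norm x = norm x'" and [measurable]: "f \<in> borel_measurable borel"
  shows "(\<integral>y. f (x \<bullet> y) \<partial>\<mu>) = (\<integral>y. f (x' \<bullet> y) \<partial>\<mu>)"
proof -
  obtain T where T: "orthogonal_transformation T" "T x = x'"
    using orthogonal_transformation_exists[OF assms(1)] by blast
  have "(\<integral>y. f (x' \<bullet> T y) \<partial>\<mu>) = (\<integral>y. f (x' \<bullet> y) \<partial>\<mu>)"
    by (rule integral_sphere_orthogonal[OF T(1)]) (auto intro!: borel_measurable_sphere_measure)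
  moreover have "x' \<bullet> T y = x \<bullet> y" for y
    using T by (auto simp: orthogonal_transformation_def)
  ultimately show ?thesis by simp
qed

lemma integrable_sphere_continuous:
  fixes f :: "'a::euclidean_space \<Rightarrow> real"
  assumes "continuous_on (sphere 0 1) f"
  shows "integrable \<mu> f"
proof -
  interpret finite_measure "\<mu> :: 'a measure" by (rule finite_sphere_measure)
  have m: "f \<in> borel_measurable \<mu>"
    using borel_measurable_continuous_on_restrict[OF assms]
    by (subst measurable_cong_sets[OF sets_sphere_measure refl])
  have "bounded (f ` sphere 0 1)" by (intro compact_imp_bounded compact_continuous_image assms) auto
  then obtain B where "\<forall>x\<in>sphere 0 1. norm (f x) \<le> B" by (auto simp: bounded_iff)
  then show ?thesis
    by (intro integrable_const_bound[OF _ m, of B]) auto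
qed

section \<open>First and second moments of the sphere\<close>

lemma integral_sphere_inner:
  fixes z :: "real^'m"
  shows "(\<integral>x. x \<bullet> z \<partial>\<mu>) = 0"
proof -
  have "(\<integral>x. (- x) \<bullet> z \<partial>\<mu>) = (\<integral>x. x \<bullet> z \<partial>\<mu>)"
    by (rule integral_sphere_orthogonal[of uminus "\<lambda>x. x \<bullet> z"])
       (auto simp: orthogonal_transformation_def intro!: borel_measurable_sphere_measure linearI)
  then show ?thesis by simp
qed

text \<open>By rotation invariance all directions have the same second moment, and over an
  orthonormal basis the moments add up to the total mass because |x| = 1. This is the source of the
  summand 1/(n+1) in the cap estimate.\<close>

lemma integral_sphere_inner_square:
  fixes z :: "real^'m"
  assumes z: "norm z = 1"
  shows "(\<integral>x. (x \<bullet> z)\<^sup>2 \<partial>\<mu>) = measure \<mu> (sphere (0::real^'m) 1) / CARD('m)"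
proof -
  have eq: "(\<integral>x. (x \<bullet> b)\<^sup>2 \<partial>\<mu>) = (\<integral>x. (x \<bullet> z)\<^sup>2 \<partial>\<mu>)" if "b \<in> Basis" for b :: "real^'m"
    using integral_zonal_eq[of b z "\<lambda>t. t\<^sup>2"] that z by (simp add: inner_commute)
  have "CARD('m) * (\<integral>x. (x \<bullet> z)\<^sup>2 \<partial>\<mu>) = (\<Sum>b\<in>(Basis::(real^'m) set). \<integral>x. (x \<bullet> b)\<^sup>2 \<partial>\<mu>)"
    by (simp add: eq)
  also have "\<dots> = (\<integral>x. (\<Sum>b\<in>(Basis::(real^'m) set). (x \<bullet> b)\<^sup>2) \<partial>\<mu>)"
    by (rule Bochner_Integration.integral_sum[symmetric]) (intro integrable_sphere_continuous continuous_intros)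
  also have "\<dots> = (\<integral>x. 1 \<partial>(\<mu> :: (real^'m) measure))"
  proof (rule Bochner_Integration.integral_cong)
    fix x :: "real^'m" assume "x \<in> space \<mu>"
    then have "x \<bullet> x = 1" by (simp add: norm_eq_1)
    then show "(\<Sum>b\<in>Basis. (x \<bullet> b)\<^sup>2) = 1"
      by (subst (asm) euclidean_inner) (simp add: power2_eq_square)
  qed simp
  finally show ?thesis by (simp add: field_simps)
qed

section \<open>The gnomonic chart\<close>

lemma prod_Basis_cart: "(\<Prod>b\<in>(Basis::(real^'n) set). f b) = (\<Prod>i\<in>UNIV. f (axis i 1))"
proof -
  have B: "(Basis::(real^'n) set) = range (\<lambda>i. axis i 1)" by (auto simp: Basis_vec_def)
  show ?thesis unfolding B by (subst prod.reindex) (auto simp: inj_on_def axis_eq_axis)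
qed

text \<open>When \<open>z\<close> is an axis vector, splitting off its coordinate turns boxes into
  products of boxes, and boxes determine Lebesgue measure; a rotation then carries the axis to
  \<open>z\<close>. \<open>L\<close> is an isometry onto the hyperplane orthogonal to
  \<open>z\<close>.\<close>

lemma orthogonal_coordinates:
  fixes z :: "real^'m"
  assumes card: "CARD('m) = CARD('n) + 1" and z: "norm z = 1"
  obtains L :: "real^'n \<Rightarrow> real^'m" where "linear L" "\<And>y. norm (L y) = norm y" "\<And>y. L y \<bullet> z = 0"
    "distr (lborel \<Otimes>\<^sub>M lborel) borel (\<lambda>(t, y). t *\<^sub>R z + L y) = lborel"
proof -
  define m0 where "m0 = (undefined :: 'm)"
  have "card (UNIV - {m0}) = CARD('n)" using card by simp
  then obtain e :: "'n \<Rightarrow> 'm" where e: "bij_betw e UNIV (UNIV - {m0})"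
    using finite_same_card_bij[of "UNIV :: 'n set" "UNIV - {m0}"] by auto
  have inje: "inj e" using e by (simp add: bij_betw_def)
  have rng: "range e = UNIV - {m0}" using e by (simp add: bij_betw_def)
  have e0: "e j \<noteq> m0" for j using rng by blast
  have all: "(\<forall>i. P i) \<longleftrightarrow> P m0 \<and> (\<forall>j. P (e j))" for P
    using rng by (metis DiffI UNIV_I empty_iff imageE insert_iff)
  define L0 :: "real^'n \<Rightarrow> real^'m" where "L0 y = (\<chi> i. if i = m0 then 0 else y $ inv e i)" for y
  define z0 :: "real^'m" where "z0 = axis m0 1"
  have L0e: "L0 y $ e j = y $ j" and L00: "L0 y $ m0 = 0" for y j
    using inje by (auto simp: L0_def e0)
  have z0e: "z0 $ e j = 0" and z00: "z0 $ m0 = 1" for j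
    using e0[of j] by (auto simp: z0_def axis_def)
  have sum_split: "(\<Sum>i\<in>UNIV. f i) = f m0 + (\<Sum>j\<in>UNIV. f (e j))" for f :: "'m \<Rightarrow> real"
    using sum.remove[of UNIV m0 f] sum.reindex[OF inje, of f] by (simp add: rng)
  have prod_split: "(\<Prod>i\<in>UNIV. f i) = f m0 * (\<Prod>j\<in>UNIV. f (e j))" for f :: "'m \<Rightarrow> real"
    using prod.remove[of UNIV m0 f] prod.reindex[OF inje, of f] by (simp add: rng)
  have linL0: "linear L0"
    by (rule linearI) (auto simp: L0_def vec_eq_iff)
  have normL0: "norm (L0 y) = norm y" for y
    unfolding norm_eq_sqrt_inner by (simp add: inner_vec_def sum_split L0e L00)
  have orthL0: "L0 y \<bullet> z0 = 0" for y
    by (simp add: inner_vec_def sum_split L0e L00 z0e)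
  define J0 where "J0 = (\<lambda>(t, y). t *\<^sub>R z0 + L0 y)"
  have contL0: "continuous_on UNIV L0"
    using linL0 by (intro linear_continuous_on linear_conv_bounded_linear[THEN iffD1])
  have [measurable]: "L0 \<in> borel_measurable borel"
    by (rule borel_measurable_continuous_onI[OF contL0])
  have J0m [measurable]: "J0 \<in> lborel \<Otimes>\<^sub>M lborel \<rightarrow>\<^sub>M borel"
    unfolding J0_def by measurable
  have J0lb: "distr (lborel \<Otimes>\<^sub>M lborel) borel J0 = lborel"
  proof (rule lborel_eqI[symmetric])
    fix l u :: "real^'m" assume lu: "\<And>b. b \<in> Basis \<Longrightarrow> l \<bullet> b \<le> u \<bullet> b"
    define l' u' :: "real^'n" where "l' = (\<chi> j. l $ e j)" and "u' = (\<chi> j. u $ e j)"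
    have lui: "l $ i \<le> u $ i" for i using lu[of "axis i 1"] by (simp add: cart_eq_inner_axis axis_in_Basis_iff)
    have mb: "t *\<^sub>R z0 + L0 y \<in> box l u \<longleftrightarrow> l $ m0 < t \<and> t < u $ m0 \<and> y \<in> box l' u'" for t y
    proof -
      define v where "v = t *\<^sub>R z0 + L0 y"
      have v: "v $ m0 = t" "v $ e j = y $ j" for j
        by (simp_all add: v_def L0e L00 z0e z00)
      have "v \<in> box l u \<longleftrightarrow> (\<forall>i. l $ i < v $ i \<and> v $ i < u $ i)" by (rule mem_box_cart)
      also have "\<dots> \<longleftrightarrow> (l $ m0 < v $ m0 \<and> v $ m0 < u $ m0) \<and> (\<forall>j. l $ e j < v $ e j \<and> v $ e j < u $ e j)"
        by (rule all[of "\<lambda>i. l $ i < v $ i \<and> v $ i < u $ i"])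
      finally show ?thesis by (simp add: v mem_box_cart l'_def u'_def flip: v_def)
    qed
    have "J0 -` box l u \<inter> space (lborel \<Otimes>\<^sub>M lborel) = {l $ m0<..<u $ m0} \<times> box l' u'"
      using mb by (auto simp: J0_def space_pair_measure)
    then have "emeasure (distr (lborel \<Otimes>\<^sub>M lborel) borel J0) (box l u)
        = emeasure (lborel \<Otimes>\<^sub>M lborel) ({l $ m0<..<u $ m0} \<times> box l' u')"
      by (subst emeasure_distr[OF J0m]) auto
    also have "\<dots> = emeasure lborel {l $ m0<..<u $ m0} * emeasure lborel (box l' u')"
      by (rule lborel.emeasure_pair_measure_Times) auto
    also have "\<dots> = ennreal ((u $ m0 - l $ m0) * (\<Prod>j\<in>UNIV. u $ e j - l $ e j))"
    proof -
      have "(\<Prod>b\<in>(Basis::(real^'n) set). (u' - l') \<bullet> b) = (\<Prod>j\<in>UNIV. u $ e j - l $ e j)"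
        unfolding prod_Basis_cart by (simp add: cart_eq_inner_axis[symmetric] u'_def l'_def)
      moreover have "emeasure lborel (box l' u') = ennreal (\<Prod>b\<in>Basis. (u' - l') \<bullet> b)"
        by (rule emeasure_lborel_box) (auto simp: Basis_vec_def cart_eq_inner_axis[symmetric] l'_def u'_def lui)
      ultimately show ?thesis using lui by (simp add: ennreal_mult' prod_nonneg)
    qed
    also have "(u $ m0 - l $ m0) * (\<Prod>j\<in>UNIV. u $ e j - l $ e j) = prod ((\<bullet>) (u - l)) Basis"
      unfolding prod_Basis_cart by (simp add: cart_eq_inner_axis[symmetric] prod_split)
    finally show "emeasure (distr (lborel \<Otimes>\<^sub>M lborel) borel J0) (box l u) = ennreal (prod ((\<bullet>) (u - l)) Basis)" .
  qed simp
  have "norm z0 = norm z" by (simp add: z0_def z)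
  then obtain T where T: "orthogonal_transformation T" "T z0 = z"
    using orthogonal_transformation_exists by blast
  have [measurable]: "T \<in> borel_measurable borel" by (rule orthogonal_transformation_borel[OF T(1)])
  have linT: "linear T" using T(1) by (rule orthogonal_transformation_linear)
  show ?thesis
  proof (rule that[of "T \<circ> L0"])
    show "linear (T \<circ> L0)" by (rule linear_compose[OF linL0 linT])
    show "norm ((T \<circ> L0) y) = norm y" for y
      by (simp add: orthogonal_transformation_norm[OF T(1)] normL0)
    have "T (L0 y) \<bullet> T z0 = 0" for y using T(1) orthL0 by (simp add: orthogonal_transformation_def)
    then show "(T \<circ> L0) y \<bullet> z = 0" for y by (simp add: T(2))
    have "(\<lambda>(t, y). t *\<^sub>R z + (T \<circ> L0) y) = T \<circ> J0"
      by (auto simp: J0_def linear_add[OF linT] linear_cmul[OF linT] T(2))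
    then have "distr (lborel \<Otimes>\<^sub>M lborel) borel (\<lambda>(t, y). t *\<^sub>R z + (T \<circ> L0) y) = distr (distr (lborel \<Otimes>\<^sub>M lborel) borel J0) borel T"
      by (subst distr_distr) auto
    then show "distr (lborel \<Otimes>\<^sub>M lborel) borel (\<lambda>(t, y). t *\<^sub>R z + (T \<circ> L0) y) = lborel"
      by (simp add: J0lb lborel_distr_orthogonal[OF T(1)])
  qed
qed

text \<open>For an isometry \<open>L\<close> into the hyperplane orthogonal to the unit vector
  \<open>z\<close> this is 1 / |z + L y|: the factor of the central projection from the tangent
  plane at \<open>z\<close> to the sphere, and also the height of the projected point along
  \<open>z\<close>.\<close>

definition gnomonic_scale :: "'a::euclidean_space \<Rightarrow> real" where
  "gnomonic_scale y = (1 + y \<bullet> y) powr (- 1 / 2)"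

lemma gnomonic_scale_pos: "0 < gnomonic_scale y"
  and gnomonic_scale_le_1: "gnomonic_scale y \<le> 1"
  and gnomonic_scale_square: "(gnomonic_scale y)\<^sup>2 * (1 + y \<bullet> y) = 1"
proof -
  have 1: "1 + y \<bullet> y \<ge> 1" by simp
  show "0 < gnomonic_scale y" unfolding gnomonic_scale_def using 1 by (smt (verit) powr_gt_zero)
  have "(1 + y \<bullet> y) powr (- 1 / 2) \<le> (1 + y \<bullet> y) powr 0" by (intro powr_mono 1) auto
  then show "gnomonic_scale y \<le> 1" using 1 by (simp add: gnomonic_scale_def)
  have "(gnomonic_scale y)\<^sup>2 = (1 + y \<bullet> y) powr (- 1)"
    by (simp add: gnomonic_scale_def power2_eq_square powr_add[symmetric])
  also have "\<dots> = 1 / (1 + y \<bullet> y)" using 1 by (simp only: powr_minus_divide powr_one)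
  finally have e: "(gnomonic_scale y)\<^sup>2 = 1 / (1 + y \<bullet> y)" .
  have "1 + y \<bullet> y \<noteq> 0" using 1 by linarith
  from e[unfolded nonzero_eq_divide_eq[OF this]] show "(gnomonic_scale y)\<^sup>2 * (1 + y \<bullet> y) = 1" .
qed

lemma nn_integral_lborel_scaleR:
  fixes h :: "'a::euclidean_space \<Rightarrow> ennreal"
  assumes [measurable]: "h \<in> borel_measurable borel" and "c > 0"
  shows "(\<integral>\<^sup>+y. h y \<partial>lborel) = ennreal (c ^ DIM('a)) * (\<integral>\<^sup>+y. h (c *\<^sub>R y) \<partial>lborel)"
  by (subst lborel_affine[of c 0])
     (use assms(2) in \<open>simp_all add: nn_integral_density nn_integral_distr nn_integral_cmult\<close>)

lemma nn_integral_power_Ioc: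
  fixes s :: real
  assumes "0 < s"
  shows "(\<integral>\<^sup>+t. ennreal (t ^ k) * indicator {0<..s} t \<partial>lborel) = ennreal (s ^ Suc k / Suc k)"
proof -
  have "(\<integral>\<^sup>+t. ennreal (t ^ k) * indicator {0<..s} t \<partial>lborel) = (\<integral>\<^sup>+t. ennreal (t ^ k) * indicator {0..s} t \<partial>lborel)"
    by (rule nn_integral_cong_AE) (use AE_lborel_singleton[of "0::real"] in eventually_elim, auto simp: indicator_def)
  also have "\<dots> = ennreal (s ^ Suc k / Suc k - 0 ^ Suc k / Suc k)"
    using assms by (intro nn_integral_FTC_Icc) (auto intro!: derivative_eq_intros simp del: power_Suc)
  finally show ?thesis by simp
qed

text \<open>The density is read off the cone that defines the surface measure. In the coordinates t
  (z + L y) Lebesgue measure is t^n dt dy, and the ray over \<open>y\<close> stays in the unit ball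
  exactly for t \<le> s(y). The radial integral is therefore s^(n+1) / (n+1), and n+1 cancels
  against the dimension factor of the surface measure.\<close>

lemma nn_integral_gnomonic:
  fixes z :: "real^'m" and L :: "real^'n \<Rightarrow> real^'m" and F :: "real^'m \<Rightarrow> ennreal"
  assumes card: "CARD('m) = CARD('n) + 1" and z: "norm z = 1"
    and L: "linear L" "\<And>y. norm (L y) = norm y" "\<And>y. L y \<bullet> z = 0"
    and J: "distr (lborel \<Otimes>\<^sub>M lborel) borel (\<lambda>(t, y). t *\<^sub>R z + L y) = lborel"
    and F [measurable]: "F \<in> borel_measurable borel"
  shows "(\<integral>\<^sup>+x. F x * indicator {x. 0 < x \<bullet> z} x \<partial>\<mu>)
    = (\<integral>\<^sup>+y. F (gnomonic_scale y *\<^sub>R (z + L y)) * ennreal (gnomonic_scale y ^ CARD('m)) \<partial>lborel)"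
proof -
  have zz: "z \<bullet> z = 1" using z by (simp add: norm_eq_1)
  have contL: "continuous_on UNIV L"
    using L(1) by (intro linear_continuous_on linear_conv_bounded_linear[THEN iffD1])
  have [measurable]: "L \<in> borel_measurable borel"
    by (rule borel_measurable_continuous_onI[OF contL])
  have nsq: "(norm (t *\<^sub>R z + L y))\<^sup>2 = t\<^sup>2 + y \<bullet> y" for t y
  proof -
    have a: "L y \<bullet> L y = y \<bullet> y" using L(2)[of y] by (simp add: norm_eq)
    have b: "z \<bullet> L y = 0" using L(3)[of y] by (simp add: inner_commute)
    show ?thesis
      unfolding power2_norm_eq_inner inner_add_left inner_add_right inner_scaleR_left inner_scaleR_right zz L(3) a b
      by (simp add: power2_eq_square)
  qed
  define s where "s = (gnomonic_scale :: real^'n \<Rightarrow> real)"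
  have s: "0 < s y" "s y \<le> 1" "(s y)\<^sup>2 * (1 + y \<bullet> y) = 1" for y
    unfolding s_def by (rule gnomonic_scale_pos gnomonic_scale_le_1 gnomonic_scale_square)+
  have [measurable]: "s \<in> borel_measurable borel"
    unfolding s_def gnomonic_scale_def[abs_def] by measurable
  \<comment> \<open>The integrand on the cone: \<open>F\<close>, cut off to the half space around
    \<open>z\<close>, made constant along rays.\<close>
  define K where "K x = F (x /\<^sub>R norm x) * indicator {x. 0 < x \<bullet> z} (x /\<^sub>R norm x) * indicator (cball 0 1 - {0}) x" for x
  have "(\<lambda>x. F x * indicator {x. 0 < x \<bullet> z} x) \<in> borel_measurable borel" by measurable
  from measurable_compose[OF borel_measurable_radial_projection this]
  have [measurable]: "K \<in> borel_measurable borel"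
    unfolding K_def by (intro borel_measurable_times_ennreal[OF _ borel_measurable_indicator]) auto
  have Kt: "K (t *\<^sub>R z + L (t *\<^sub>R y)) = F (s y *\<^sub>R (z + L y)) * indicator {0<..s y} t" if t: "t > 0" for t y
  proof -
    have eq: "t *\<^sub>R z + L (t *\<^sub>R y) = t *\<^sub>R (z + L y)"
      by (simp add: linear_cmul[OF L(1)] scaleR_add_right)
    have "(norm (z + L y))\<^sup>2 = 1 + y \<bullet> y" using nsq[of 1 y] by simp
    then have "(s y * norm (z + L y))\<^sup>2 = 1" using s(3)[of y] by (simp add: power_mult_distrib)
    then have n1: "s y * norm (z + L y) = 1" using s(1)[of y]
      by (smt (verit) mult_nonneg_nonneg norm_ge_zero power2_eq_1_iff)
    then have nn: "norm (z + L y) = 1 / s y" using s(1)[of y] by (simp add: field_simps)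
    then have nz: "norm (z + L y) > 0" using s(1)[of y] by simp
    have a: "(t *\<^sub>R (z + L y)) /\<^sub>R norm (t *\<^sub>R (z + L y)) = s y *\<^sub>R (z + L y)"
    proof -
      have "inverse (norm (t *\<^sub>R (z + L y))) * t = s y"
        unfolding norm_scaleR nn using t s(1)[of y] by simp
      then show ?thesis by (simp only: scaleR_scaleR)
    qed
    have b: "0 < (s y *\<^sub>R (z + L y)) \<bullet> z" using s(1)[of y] by (simp add: inner_add_left zz L(3))
    have "norm (t *\<^sub>R (z + L y)) = t / s y" unfolding norm_scaleR nn using t by simp
    moreover have "t *\<^sub>R (z + L y) \<noteq> 0" using t nz by auto
    ultimately have c: "t *\<^sub>R (z + L y) \<in> cball 0 1 - {0} \<longleftrightarrow> t \<in> {0<..s y}"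
      using t s(1)[of y] by (simp add: divide_le_eq)
    show ?thesis unfolding K_def eq a using b c by (auto simp: indicator_def)
  qed
  have K0: "K (t *\<^sub>R z + L y) = 0" if "t \<le> 0" for t y
  proof -
    have "((t *\<^sub>R z + L y) /\<^sub>R norm (t *\<^sub>R z + L y)) \<bullet> z \<le> 0"
      unfolding inner_scaleR_left inner_add_left zz L(3) using that by (simp add: mult_nonneg_nonpos)
    then show ?thesis by (auto simp: K_def indicator_def)
  qed
  have "(\<integral>\<^sup>+x. F x * indicator {x. 0 < x \<bullet> z} x \<partial>\<mu>) = of_nat CARD('m) * (\<integral>\<^sup>+x. K x \<partial>lborel)"
    unfolding K_def by (subst nn_integral_sphere_measure) auto
  also have "(\<integral>\<^sup>+x. K x \<partial>lborel) = (\<integral>\<^sup>+x. K x \<partial>distr (lborel \<Otimes>\<^sub>M lborel) borel (\<lambda>(t, y). t *\<^sub>R z + L y))"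
    by (simp only: J)
  also have "\<dots> = (\<integral>\<^sup>+x. K (fst x *\<^sub>R z + L (snd x)) \<partial>(lborel \<Otimes>\<^sub>M lborel))"
    by (subst nn_integral_distr) (simp_all add: split_beta')
  also have "\<dots> = (\<integral>\<^sup>+t. \<integral>\<^sup>+y. K (t *\<^sub>R z + L y) \<partial>lborel \<partial>lborel)"
    using lborel.nn_integral_fst[of "\<lambda>x. K (fst x *\<^sub>R z + L (snd x))" lborel] by simp
  also have "\<dots> = (\<integral>\<^sup>+t. \<integral>\<^sup>+y. F (s y *\<^sub>R (z + L y)) * (ennreal (t ^ CARD('n)) * indicator {0<..s y} t) \<partial>lborel \<partial>lborel)"
  proof (rule nn_integral_cong)
    fix t :: real
    show "(\<integral>\<^sup>+y. K (t *\<^sub>R z + L y) \<partial>lborel) = (\<integral>\<^sup>+y. F (s y *\<^sub>R (z + L y)) * (ennreal (t ^ CARD('n)) * indicator {0<..s y} t) \<partial>lborel)"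
    proof (cases "t > 0")
      case True
      have "(\<integral>\<^sup>+y. K (t *\<^sub>R z + L y) \<partial>lborel) = ennreal (t ^ CARD('n)) * (\<integral>\<^sup>+y. K (t *\<^sub>R z + L (t *\<^sub>R y)) \<partial>lborel)"
        using nn_integral_lborel_scaleR[of "\<lambda>y. K (t *\<^sub>R z + L y)" t] True by simp
      also have "\<dots> = (\<integral>\<^sup>+y. ennreal (t ^ CARD('n)) * (F (s y *\<^sub>R (z + L y)) * indicator {0<..s y} t) \<partial>lborel)"
        unfolding Kt[OF True] by (rule nn_integral_cmult[symmetric]) (auto simp: indicator_def)
      finally show ?thesis by (simp add: ac_simps)
    next
      case False
      then show ?thesis by (simp add: K0)
    qed
  qed
  also have "\<dots> = (\<integral>\<^sup>+y. \<integral>\<^sup>+t. F (s y *\<^sub>R (z + L y)) * (ennreal (t ^ CARD('n)) * indicator {0<..s y} t) \<partial>lborel \<partial>lborel)"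
    by (rule lborel_pair.Fubini') (auto simp: split_beta indicator_def)
  also have "\<dots> = (\<integral>\<^sup>+y. F (s y *\<^sub>R (z + L y)) * ennreal (s y ^ CARD('m) / CARD('m)) \<partial>lborel)"
    using nn_integral_power_Ioc[OF s(1), where k="CARD('n)"] 
    by (intro nn_integral_cong) (simp add: nn_integral_cmult card)
  also have "of_nat CARD('m) * \<dots> = (\<integral>\<^sup>+y. of_nat CARD('m) * (F (s y *\<^sub>R (z + L y)) * ennreal (s y ^ CARD('m) / CARD('m))) \<partial>lborel)"
    by (rule nn_integral_cmult[symmetric]) auto
  also have "\<dots> = (\<integral>\<^sup>+y. F (s y *\<^sub>R (z + L y)) * ennreal (s y ^ CARD('m)) \<partial>lborel)"
  proof (rule nn_integral_cong)
    fix y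
    have "of_nat CARD('m) * ennreal (s y ^ CARD('m) / CARD('m)) = ennreal (s y ^ CARD('m))"
      using s(1)[of y] by (simp add: ennreal_of_nat_eq_real_of_nat ennreal_mult'[symmetric])
    then show "of_nat CARD('m) * (F (s y *\<^sub>R (z + L y)) * ennreal (s y ^ CARD('m) / CARD('m))) = F (s y *\<^sub>R (z + L y)) * ennreal (s y ^ CARD('m))"
      by (subst mult.left_commute) (simp only:)
  qed
  finally show ?thesis unfolding s_def .
qed

section \<open>Zonal convolution\<close>

lemma integrable_sphere_mult:
  fixes k u :: "'a::euclidean_space \<Rightarrow> real"
  assumes k: "continuous_on (sphere 0 1) k" and u: "integrable \<mu> u"
  shows "integrable \<mu> (\<lambda>y. k y * u y)"
proof -
  have "bounded (k ` sphere 0 1)" by (intro compact_imp_bounded compact_continuous_image k) auto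
  then obtain B where B: "\<forall>x\<in>sphere 0 1. norm (k x) \<le> B" by (auto simp: bounded_iff)
  have [measurable]: "k \<in> borel_measurable \<mu>"
    using integrable_sphere_continuous[OF k] by (rule borel_measurable_integrable)
  have [measurable]: "u \<in> borel_measurable \<mu>"
    using u by (rule borel_measurable_integrable)
  show ?thesis
  proof (rule Bochner_Integration.integrable_bound)
    show "integrable \<mu> (\<lambda>y. B * u y)" using u by simp
    show "AE y in \<mu>. norm (k y * u y) \<le> norm (B * u y)"
      using B by (intro AE_I2) (auto simp: abs_mult intro!: mult_right_mono intro: order_trans[OF _ abs_ge_self])
  qed measurable
qed

text \<open>The kernel is polynomial in \<open>x\<close>, so the convolution is defined and smooth
  on the whole ambient space and can be differentiated there. On the sphere the kernel is
  nonnegative and, for large \<open>d\<close>, concentrates at y = x.\<close>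

definition zonal :: "nat \<Rightarrow> ('a::euclidean_space \<Rightarrow> real) \<Rightarrow> 'a \<Rightarrow> real" where
  "zonal d u x = (\<integral>y. (1 + x \<bullet> y) ^ d * u y \<partial>\<mu>)"

lemma integrable_zonal:
  "integrable \<mu> u \<Longrightarrow> integrable \<mu> (\<lambda>y. (1 + x \<bullet> y) ^ d * u y)"
  by (intro integrable_sphere_mult continuous_intros)

lemma integrable_inner_mult:
  "integrable \<mu> u \<Longrightarrow> integrable \<mu> (\<lambda>y. (b \<bullet> y) * u y)"
  by (intro integrable_sphere_mult continuous_intros)

lemma zonal_inner:
  assumes u: "integrable \<mu> u"
  shows "zonal d (\<lambda>y. (h \<bullet> y) * u y) x = (\<Sum>b\<in>Basis. (h \<bullet> b) * zonal d (\<lambda>y. (b \<bullet> y) * u y) x)"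
proof -
  have "(\<Sum>b\<in>Basis. (h \<bullet> b) * zonal d (\<lambda>y. (b \<bullet> y) * u y) x)
     = (\<integral>y. (\<Sum>b\<in>Basis. (h \<bullet> b) * ((1 + x \<bullet> y) ^ d * ((b \<bullet> y) * u y))) \<partial>\<mu>)"
    unfolding zonal_def
    by (subst Bochner_Integration.integral_sum) (auto intro!: integrable_zonal integrable_inner_mult u)
  also have "\<dots> = zonal d (\<lambda>y. (h \<bullet> y) * u y) x"
    unfolding zonal_def
  proof (rule Bochner_Integration.integral_cong[OF refl])
    fix y
    have "h \<bullet> y = (\<Sum>b\<in>Basis. (h \<bullet> b) * (b \<bullet> y))"
      by (subst euclidean_inner) (simp add: inner_commute)
    then show "(\<Sum>b\<in>Basis. (h \<bullet> b) * ((1 + x \<bullet> y) ^ d * ((b \<bullet> y) * u y))) = (1 + x \<bullet> y) ^ d * ((h \<bullet> y) * u y)"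
      by (simp add: sum_distrib_left sum_distrib_right mult_ac)
  qed
  finally show ?thesis by simp
qed

text \<open>One factor 1 + x.y is split off, leaving zonal integrals of degree \<open>d\<close>
  against \<open>u\<close> and its products with coordinates. Smoothness, the derivative and
  self-adjointness then follow by induction on \<open>d\<close> with \<open>u\<close> arbitrary,
  without differentiation under the integral sign.\<close>

lemma zonal_Suc:
  assumes u: "integrable \<mu> u"
  shows "zonal (Suc d) u x = zonal d u x + (\<Sum>b\<in>Basis. (x \<bullet> b) * zonal d (\<lambda>y. (b \<bullet> y) * u y) x)"
proof -
  have "zonal (Suc d) u x = (\<integral>y. (1 + x \<bullet> y) ^ d * u y + (1 + x \<bullet> y) ^ d * ((x \<bullet> y) * u y) \<partial>\<mu>)"
    unfolding zonal_def by (simp add: algebra_simps)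
  also have "\<dots> = zonal d u x + zonal d (\<lambda>y. (x \<bullet> y) * u y) x"
    unfolding zonal_def
    by (intro Bochner_Integration.integral_add integrable_zonal integrable_inner_mult u)
  finally show ?thesis using zonal_inner[OF u, where h=x and x=x and d=d] by simp
qed

lemma zonal_0: "zonal 0 u x = (\<integral>y. u y \<partial>\<mu>)"
  by (simp add: zonal_def)

text \<open>Stated for the composition with a map given by its coordinates, since smoothness is
  wanted for the convolution read in a chart.\<close>

lemma times_cont_diff_zonal:
  fixes \<psi> :: "'b::euclidean_space \<Rightarrow> 'a::euclidean_space"
  assumes \<psi>: "\<And>b. b \<in> Basis \<Longrightarrow> times_cont_diff k (\<lambda>y. \<psi> y \<bullet> b)"
  shows "integrable \<mu> u \<Longrightarrow> times_cont_diff k (\<lambda>y. zonal d u (\<psi> y))"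
proof (induction d arbitrary: u)
  case 0
  then show ?case by (simp add: zonal_0 times_cont_diff_const)
next
  case (Suc d)
  show ?case unfolding zonal_Suc[OF Suc.prems]
    by (intro times_cont_diff_add times_cont_diff_sum times_cont_diff_mult \<psi> Suc.IH integrable_inner_mult Suc.prems)
qed

lemma has_derivative_zonal:
  "integrable \<mu> u \<Longrightarrow>
    (zonal d u has_derivative (\<lambda>h. real d * zonal (d - 1) (\<lambda>y. (h \<bullet> y) * u y) x)) (at x)"
proof (induction d arbitrary: u)
  case 0
  then show ?case by (simp add: zonal_0[abs_def])
next
  case (Suc d)
  note u = Suc.prems
  have e: "zonal (Suc d) u = (\<lambda>x. zonal d u x + (\<Sum>b\<in>Basis. (x \<bullet> b) * zonal d (\<lambda>y. (b \<bullet> y) * u y) x))"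
    by (rule ext) (rule zonal_Suc[OF u])
  have "(zonal (Suc d) u has_derivative (\<lambda>h. real d * zonal (d - 1) (\<lambda>y. (h \<bullet> y) * u y) x +
     (\<Sum>b\<in>Basis. (x \<bullet> b) * (real d * zonal (d - 1) (\<lambda>y. (h \<bullet> y) * ((b \<bullet> y) * u y)) x)
        + (h \<bullet> b) * zonal d (\<lambda>y. (b \<bullet> y) * u y) x))) (at x)"
    unfolding e
    by (intro has_derivative_add has_derivative_sum has_derivative_mult Suc.IH integrable_inner_mult u
        has_derivative_inner_left has_derivative_ident)
  moreover have "real d * zonal (d - 1) (\<lambda>y. (h \<bullet> y) * u y) x +
     (\<Sum>b\<in>Basis. (x \<bullet> b) * (real d * zonal (d - 1) (\<lambda>y. (h \<bullet> y) * ((b \<bullet> y) * u y)) x)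
        + (h \<bullet> b) * zonal d (\<lambda>y. (b \<bullet> y) * u y) x)
     = real (Suc d) * zonal (Suc d - 1) (\<lambda>y. (h \<bullet> y) * u y) x" for h
  proof -
    have "real d * zonal (d - 1) (\<lambda>y. (h \<bullet> y) * u y) x +
       (\<Sum>b\<in>Basis. (x \<bullet> b) * (real d * zonal (d - 1) (\<lambda>y. (h \<bullet> y) * ((b \<bullet> y) * u y)) x))
       = real d * zonal d (\<lambda>y. (h \<bullet> y) * u y) x"
    proof (cases d)
      case (Suc e)
      show ?thesis unfolding Suc zonal_Suc[OF integrable_inner_mult[OF u]]
        by (simp add: distrib_left sum_distrib_left mult_ac)
    qed simp
    moreover have "real (Suc d) * zonal (Suc d - 1) (\<lambda>y. (h \<bullet> y) * u y) x
       = real d * zonal d (\<lambda>y. (h \<bullet> y) * u y) x + zonal d (\<lambda>y. (h \<bullet> y) * u y) x"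
      by (simp add: distrib_right)
    ultimately show ?thesis
      unfolding sum.distrib zonal_inner[OF u, symmetric] by linarith
  qed
  ultimately show ?case by (rule has_derivative_eq_rhs[OF _ ext])
qed

lemma continuous_on_zonal:
  "integrable \<mu> u \<Longrightarrow> continuous_on S (zonal d u)"
  by (intro continuous_at_imp_continuous_on ballI has_derivative_continuous[OF has_derivative_zonal])

text \<open>Induction on \<open>d\<close> through \<open>zonal_Suc\<close> avoids Fubini's theorem.\<close>

lemma zonal_symmetric:
  fixes f g :: "'a::euclidean_space \<Rightarrow> real"
  shows "integrable \<mu> f \<Longrightarrow> integrable \<mu> g \<Longrightarrow>
    (\<integral>x. zonal d f x * g x \<partial>\<mu>) = (\<integral>y. f y * zonal d g y \<partial>\<mu>)"
proof (induction d arbitrary: f g)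
  case 0
  then show ?case by (simp add: zonal_0)
next
  case (Suc d)
  note f = Suc.prems(1) and g = Suc.prems(2)
  have i1: "integrable \<mu> (\<lambda>x. zonal d u x * v x)" if "integrable \<mu> u" "integrable \<mu> v" for u v :: "'a \<Rightarrow> real"
    using that by (intro integrable_sphere_mult continuous_on_zonal)
  have i2: "integrable \<mu> (\<lambda>x. u x * zonal d v x)" if "integrable \<mu> u" "integrable \<mu> v" for u v :: "'a \<Rightarrow> real"
    using i1[OF that(2,1)] by (simp add: mult.commute)
  have "(\<integral>x. zonal (Suc d) f x * g x \<partial>\<mu>)
     = (\<integral>x. zonal d f x * g x + (\<Sum>b\<in>Basis. zonal d (\<lambda>y. (b \<bullet> y) * f y) x * ((b \<bullet> x) * g x)) \<partial>\<mu>)"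
    by (simp only: zonal_Suc[OF f] distrib_right sum_distrib_right) (simp add: mult_ac inner_commute)
  also have "\<dots> = (\<integral>x. zonal d f x * g x \<partial>\<mu>) + (\<Sum>b\<in>Basis. (\<integral>x. zonal d (\<lambda>y. (b \<bullet> y) * f y) x * ((b \<bullet> x) * g x) \<partial>\<mu>))"
    by (subst Bochner_Integration.integral_add)
       (auto intro!: Bochner_Integration.integrable_sum Bochner_Integration.integral_sum i1 f g integrable_inner_mult)
  also have "\<dots> = (\<integral>x. f x * zonal d g x \<partial>\<mu>) + (\<Sum>b\<in>Basis. (\<integral>x. ((b \<bullet> x) * f x) * zonal d (\<lambda>y. (b \<bullet> y) * g y) x \<partial>\<mu>))"
    by (simp add: Suc.IH f g integrable_inner_mult)
  also have "\<dots> = (\<integral>x. f x * zonal d g x + (\<Sum>b\<in>Basis. ((b \<bullet> x) * f x) * zonal d (\<lambda>y. (b \<bullet> y) * g y) x) \<partial>\<mu>)"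
    by (subst Bochner_Integration.integral_add)
       (auto intro!: Bochner_Integration.integrable_sum Bochner_Integration.integral_sum[symmetric] i2 f g integrable_inner_mult)
  also have "\<dots> = (\<integral>x. f x * zonal (Suc d) g x \<partial>\<mu>)"
    by (simp only: zonal_Suc[OF g] distrib_left sum_distrib_left) (simp add: mult_ac inner_commute)
  finally show ?case .
qed

section \<open>The gradient of a zonal convolution\<close>

lemma times_cont_diff_power:
  fixes f :: "'a::euclidean_space \<Rightarrow> real"
  shows "times_cont_diff k f \<Longrightarrow> times_cont_diff k (\<lambda>x. f x ^ d)"
  by (induction d) (auto intro: times_cont_diff_const times_cont_diff_mult)

text \<open>The test field is the zonal kernel times a Killing field, so its divergence involves only the
  derivative of the kernel.\<close>

lemma zonal_derivative_weak_gradient: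
  fixes u :: "'a::euclidean_space \<Rightarrow> real"
  assumes G: "sphere_weak_gradient p u G" and x: "norm x = 1" and h: "h \<bullet> x = 0"
  shows "real (Suc d) * zonal d (\<lambda>y. (h \<bullet> y) * u y) x
    = (\<integral>y. (1 + x \<bullet> y) ^ Suc d * ((x \<bullet> y) * (h \<bullet> G y) - (h \<bullet> y) * (x \<bullet> G y)) \<partial>\<mu>)"
proof -
  \<comment> \<open>The infinitesimal rotation in the plane of \<open>x\<close> and
    \<open>h\<close>: it is skew, and its value at \<open>x\<close> is \<open>h\<close>.\<close>
  define A where "A y = (x \<bullet> y) *\<^sub>R h - (h \<bullet> y) *\<^sub>R x" for y
  define X where "X y = ((1 + x \<bullet> y) ^ Suc d) *\<^sub>R A y" for y
  have xx: "x \<bullet> x = 1" using x by (simp add: norm_eq_1)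
  have blA: "bounded_linear A"
    unfolding A_def[abs_def] by (intro bounded_linear_sub bounded_linear_compose[OF bounded_linear_scaleR_left] bounded_linear_inner_right)
  have Xder: "(X has_derivative (\<lambda>v. ((1 + x \<bullet> y) ^ Suc d) *\<^sub>R A v + (real (Suc d) * (1 + x \<bullet> y) ^ d * (x \<bullet> v)) *\<^sub>R A y)) (at y)" for y
    unfolding X_def[abs_def]
    by (rule has_derivative_eq_rhs[OF has_derivative_scaleR[OF has_derivative_power bounded_linear_imp_has_derivative[OF blA]]])
       (auto intro!: derivative_eq_intros simp: fun_eq_iff)
  have "smooth X"
    unfolding smooth_def X_def[abs_def]
    by (intro allI times_cont_diff_scaleR times_cont_diff_power times_cont_diff_add times_cont_diff_const
        times_cont_diff_bounded_linear blA bounded_linear_inner_right)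
  moreover have Ay: "A y \<bullet> y = 0" for y by (simp add: A_def inner_diff_left)
  ultimately have X: "X \<in> smooth_tangent_fields"
    by (simp add: smooth_tangent_fields_def X_def)
  have div: "sphere_div X y = - (real (Suc d) * (1 + x \<bullet> y) ^ d * (h \<bullet> y))" if y: "norm y = 1" for y
  proof -
    have yy: "y \<bullet> y = 1" using y by (simp add: norm_eq_1)
    let ?P = "tangent_proj y"
    have Psym: "v \<bullet> ?P b = ?P v \<bullet> b" for v b
      by (simp add: tangent_proj_def inner_diff_left inner_diff_right inner_commute mult.commute)
    have Askew: "A v \<bullet> v = 0" for v by (rule Ay)
    have fd: "frechet_derivative X (at y) v = ((1 + x \<bullet> y) ^ Suc d) *\<^sub>R A v + (real (Suc d) * (1 + x \<bullet> y) ^ d * (x \<bullet> v)) *\<^sub>R A y" for v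
      by (subst frechet_derivative_at[OF Xder[of y], symmetric]) (rule refl)
    \<comment> \<open>Skewness removes the part in which \<open>A\<close> is differentiated; what
      remains is the derivative of the kernel along \<open>A y\<close>.\<close>
    have "sphere_div X y = (\<Sum>b\<in>Basis. (real (Suc d) * (1 + x \<bullet> y) ^ d) * ((?P x \<bullet> b) * (?P (A y) \<bullet> b)))"
      unfolding sphere_div_def fd inner_add_left inner_scaleR_left Askew Psym[of x] Psym[of "A y"]
      by (simp add: mult.assoc)
    also have "\<dots> = (real (Suc d) * (1 + x \<bullet> y) ^ d) * (?P x \<bullet> ?P (A y))"
      by (simp add: sum_distrib_left[symmetric] euclidean_inner[of "?P x" "?P (A y)"])
    also have "?P (A y) = A y" by (simp add: tangent_proj_def Ay)
    also have "?P x \<bullet> A y = - (h \<bullet> y)"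
      by (simp add: tangent_proj_def inner_diff_left A_def inner_diff_right xx h yy inner_commute algebra_simps)
    finally show ?thesis by simp
  qed
  have "(\<integral>y. G y \<bullet> X y \<partial>\<mu>) = - (\<integral>y. u y * sphere_div X y \<partial>\<mu>)"
    using G X by (simp add: sphere_weak_gradient_def)
  also have "(\<integral>y. u y * sphere_div X y \<partial>\<mu>) = (\<integral>y. - (real (Suc d) * ((1 + x \<bullet> y) ^ d * ((h \<bullet> y) * u y))) \<partial>\<mu>)"
    by (rule Bochner_Integration.integral_cong[OF refl]) (simp add: div)
  also have "\<dots> = - (real (Suc d) * zonal d (\<lambda>y. (h \<bullet> y) * u y) x)"
    by (simp add: zonal_def)
  finally have "real (Suc d) * zonal d (\<lambda>y. (h \<bullet> y) * u y) x = (\<integral>y. G y \<bullet> X y \<partial>\<mu>)" by simp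
  also have "\<dots> = (\<integral>y. (1 + x \<bullet> y) ^ Suc d * ((x \<bullet> y) * (h \<bullet> G y) - (h \<bullet> y) * (x \<bullet> G y)) \<partial>\<mu>)"
    by (rule Bochner_Integration.integral_cong[OF refl])
       (simp add: X_def A_def inner_diff_right inner_commute)
  finally show ?thesis .
qed

text \<open>The quantity on the left is the derivative of \<open>zonal (Suc d) u\<close> in the
  tangential direction \<open>h\<close>. By Bessel's inequality for the orthogonal pair
  \<open>x\<close>, \<open>h\<close>, the rotation field has length at most |h| on the sphere, so
  the bound holds with the factor 1 and with an unchanged kernel.\<close>

lemma zonal_gradient_bound:
  fixes u :: "'a::euclidean_space \<Rightarrow> real"
  assumes G: "sphere_weak_gradient p u G" and Gint: "integrable \<mu> (\<lambda>y. norm (G y))"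
    and x: "norm x = 1" and h: "h \<bullet> x = 0"
  shows "\<bar>real (Suc d) * zonal d (\<lambda>y. (h \<bullet> y) * u y) x\<bar> \<le> norm h * zonal (Suc d) (\<lambda>y. norm (G y)) x"
proof -
  have xx: "x \<bullet> x = 1" using x by (simp add: norm_eq_1)
  have bnd: "\<bar>(x \<bullet> y) * (h \<bullet> G y) - (h \<bullet> y) * (x \<bullet> G y)\<bar> \<le> norm h * norm (G y)" if y: "norm y = 1" for y
  proof -
    define a where "a = (x \<bullet> y) *\<^sub>R h - (h \<bullet> y) *\<^sub>R x"
    have "a \<bullet> a = (x \<bullet> y)\<^sup>2 * (h \<bullet> h) + (h \<bullet> y)\<^sup>2"
      using h by (simp add: a_def inner_diff_left inner_diff_right xx inner_commute power2_eq_square algebra_simps)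
    moreover have "(x \<bullet> y)\<^sup>2 * (h \<bullet> h) + (h \<bullet> y)\<^sup>2 \<le> h \<bullet> h"
    proof (cases "h = 0")
      case False
      \<comment> \<open>The orthogonal projection of \<open>y\<close> onto the plane of
        \<open>x\<close> and \<open>h\<close>.\<close>
      define b where "b = (x \<bullet> y) *\<^sub>R x + ((h \<bullet> y) / (h \<bullet> h)) *\<^sub>R h"
      have hh: "h \<bullet> h > 0" using False by simp
      have "0 \<le> (y - b) \<bullet> (y - b)" by simp
      also have "\<dots> = y \<bullet> y - (x \<bullet> y)\<^sup>2 - (h \<bullet> y)\<^sup>2 / (h \<bullet> h)"
        using hh h by (simp add: b_def inner_diff_left inner_diff_right inner_add_left inner_add_right xx inner_commute power2_eq_square)
      finally have "(x \<bullet> y)\<^sup>2 + (h \<bullet> y)\<^sup>2 / (h \<bullet> h) \<le> 1" using y by (simp add: norm_eq_1)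
      then have "((x \<bullet> y)\<^sup>2 + (h \<bullet> y)\<^sup>2 / (h \<bullet> h)) * (h \<bullet> h) \<le> 1 * (h \<bullet> h)"
        using hh by (intro mult_right_mono) auto
      then show ?thesis using hh by (simp add: distrib_right)
    qed simp
    ultimately have "norm a \<le> norm h" by (simp add: norm_le)
    have "(x \<bullet> y) * (h \<bullet> G y) - (h \<bullet> y) * (x \<bullet> G y) = a \<bullet> G y" by (simp add: a_def inner_diff_left)
    then show ?thesis
      using Cauchy_Schwarz_ineq2[of a "G y"] mult_right_mono[OF \<open>norm a \<le> norm h\<close>, of "norm (G y)"] by simp
  qed
  have "\<bar>real (Suc d) * zonal d (\<lambda>y. (h \<bullet> y) * u y) x\<bar>
     \<le> (\<integral>y. \<bar>(1 + x \<bullet> y) ^ Suc d * ((x \<bullet> y) * (h \<bullet> G y) - (h \<bullet> y) * (x \<bullet> G y))\<bar> \<partial>\<mu>)"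
    unfolding zonal_derivative_weak_gradient[OF G x h] by (rule integral_abs_bound)
  also have "\<dots> \<le> (\<integral>y. norm h * ((1 + x \<bullet> y) ^ Suc d * norm (G y)) \<partial>\<mu>)"
  proof (rule integral_mono_AE')
    show "integrable \<mu> (\<lambda>y. norm h * ((1 + x \<bullet> y) ^ Suc d * norm (G y)))"
      by (intro integrable_mult_right integrable_zonal Gint)
    show "AE y in \<mu>. \<bar>(1 + x \<bullet> y) ^ Suc d * ((x \<bullet> y) * (h \<bullet> G y) - (h \<bullet> y) * (x \<bullet> G y))\<bar>
       \<le> norm h * ((1 + x \<bullet> y) ^ Suc d * norm (G y))"
    proof (rule AE_I2)
      fix y :: 'a assume "y \<in> space \<mu>"
      then have y: "norm y = 1" by simp
      have "0 \<le> 1 + x \<bullet> y" using Cauchy_Schwarz_ineq2[of x y] x y by simp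
      then show "\<bar>(1 + x \<bullet> y) ^ Suc d * ((x \<bullet> y) * (h \<bullet> G y) - (h \<bullet> y) * (x \<bullet> G y))\<bar>
         \<le> norm h * ((1 + x \<bullet> y) ^ Suc d * norm (G y))"
        using mult_left_mono[OF bnd[OF y], of "(1 + x \<bullet> y) ^ Suc d"] by (simp add: abs_mult mult_ac)
    qed
    show "AE y in \<mu>. 0 \<le> norm h * ((1 + x \<bullet> y) ^ Suc d * norm (G y))"
    proof (rule AE_I2)
      fix y :: 'a assume "y \<in> space \<mu>"
      then have "0 \<le> 1 + x \<bullet> y" using Cauchy_Schwarz_ineq2[of x y] x by simp
      then show "0 \<le> norm h * ((1 + x \<bullet> y) ^ Suc d * norm (G y))" by simp
    qed
  qed
  also have "\<dots> = norm h * zonal (Suc d) (\<lambda>y. norm (G y)) x" by (simp add: zonal_def)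
  finally show ?thesis .
qed

text \<open>Density of continuous functions in L^1. Indicators are approximated from inside by
  compact sets, and these by functions of the distance; sums and dominated limits preserve the
  property.\<close>

lemma integrable_approx_continuous:
  fixes u :: "'a::euclidean_space \<Rightarrow> real"
  assumes "integrable \<mu> u"
  shows "\<forall>e>0. \<exists>g. continuous_on UNIV g \<and> (\<integral>x. \<bar>u x - g x\<bar> \<partial>\<mu>) < e"
  using assms
proof (induct rule: integrable_induct)
  case (base A c)
  interpret S: finite_measure "\<mu> :: 'a measure" by (rule finite_sphere_measure)
  \<comment> \<open>The image measure lives on all Borel sets of the ambient space, where inner
    regularity by compact sets is available.\<close>
  define N where "N = distr (\<mu> :: 'a measure) borel (\<lambda>x. x)"
  have id: "(\<lambda>x. x) \<in> (\<mu> :: 'a measure) \<rightarrow>\<^sub>M borel"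
    by (intro borel_measurable_sphere_measure) simp
  interpret N: finite_measure N unfolding N_def by (rule S.finite_measure_distr[OF id])
  have sN: "sets N = sets borel" by (simp add: N_def)
  have A: "A \<in> sets borel" using base by (auto simp: sets_sphere_measure sets_restrict_space)
  have gen: "integrable \<mu> (f :: 'a \<Rightarrow> real) \<longleftrightarrow> integrable N f" "(\<integral>x. f x \<partial>\<mu>) = (\<integral>x. f x \<partial>N)"
    if "f \<in> borel_measurable borel" for f
    unfolding N_def using that by (simp_all add: integrable_distr_eq[OF id] integral_distr[OF id])
  show ?case
  proof (intro allI impI)
    fix e :: real assume e: "e > 0"
    define k where "k = \<bar>c\<bar> + 1"
    have k: "0 < k" "\<bar>c\<bar> < k" by (simp_all add: k_def)
    define e' where "e' = e / (2 * k)"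
    have e': "e' > 0" using e k by (simp add: e'_def)
    have "\<bar>c\<bar> * (e' + e') < k * (e' + e')" using k e' by (intro mult_strict_right_mono) auto
    also have "k * (e' + e') = e" using k by (simp add: e'_def)
    finally have ce: "\<bar>c\<bar> * (e' + e') < e" .
    have SUP: "emeasure N A = (SUP K\<in>{K. K \<subseteq> A \<and> compact K}. emeasure N K)"
      by (rule inner_regular[OF sN _ A]) simp
    obtain K where K: "K \<subseteq> A" "compact K" and mAK: "measure N A < measure N K + e'"
    proof (cases "emeasure N A = 0")
      case True
      then have "measure N A < measure N {} + e'" using e' by (simp add: measure_def)
      then show ?thesis by (intro that[of "{}"]) auto
    next
      case False
      then have "emeasure N A - ennreal e' < emeasure N A"
        using e' by (intro ennreal_between) (auto simp: zero_less_iff_neq_zero less_top[symmetric])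
      then have "\<exists>K\<in>{K. K \<subseteq> A \<and> compact K}. emeasure N A - ennreal e' < emeasure N K"
        unfolding less_SUP_iff[symmetric] SUP[symmetric] .
      then obtain K where K: "K \<subseteq> A" "compact K" "emeasure N A - ennreal e' < emeasure N K" by blast
      have "\<not> measure N K \<le> measure N A - e'"
      proof
        assume "measure N K \<le> measure N A - e'"
        then have "ennreal (measure N K) \<le> ennreal (measure N A) - ennreal e'"
          using e' by (simp add: ennreal_minus ennreal_leI)
        with K(3) show False by (simp add: N.emeasure_eq_measure)
      qed
      with K show ?thesis by (intro that[of K]) auto
    qed
    have Kb: "K \<in> sets borel" using K(2) by (simp add: borel_compact)
    define g where "g j x = max 0 (1 - real j * infdist x K)" for j :: nat and x
    have gc: "continuous_on UNIV (g j)" for j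
      unfolding g_def by (intro continuous_intros)
    have gb: "0 \<le> g j x" "g j x \<le> 1" for j x by (auto simp: g_def infdist_nonneg)
    have gK: "\<bar>indicat_real K x - g j x\<bar> \<le> 1" for j x
      using gb[of j x] by (auto simp: indicator_def)
    show "\<exists>g. continuous_on UNIV g \<and> (\<integral>x. \<bar>indicat_real A x *\<^sub>R c - g x\<bar> \<partial>\<mu>) < e"
    \<comment> \<open>\<open>infdist\<close> to the empty set is 0 by convention, so every
      \<open>g j\<close> would be constantly 1; in this case the approximant is 0.\<close>
    proof (cases "K = {}")
      case True
      have "(\<integral>x. \<bar>indicat_real A x *\<^sub>R c - 0\<bar> \<partial>\<mu>) = (\<integral>x. \<bar>c\<bar> * indicat_real A x \<partial>N)"
        using A by (subst gen(2)) (auto simp: abs_mult mult.commute)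
      also have "\<dots> = \<bar>c\<bar> * measure N A" using A by (simp add: sN)
      also have "\<dots> \<le> \<bar>c\<bar> * (e' + e')" using mAK e' True by (intro mult_left_mono) auto
      also note ce
      finally show ?thesis by (intro exI[of _ "\<lambda>x. 0"]) (auto intro: continuous_intros)
    next
      case False
      have gm [measurable]: "g j \<in> borel_measurable N" for j
        using gc by (auto simp: measurable_cong_sets[OF sN refl] intro!: borel_measurable_continuous_onI)
      have [measurable]: "indicat_real A \<in> borel_measurable N" "indicat_real K \<in> borel_measurable N"
        using A Kb by (simp_all only: borel_measurable_indicator sN)
      have "(\<lambda>j. \<integral>x. \<bar>indicat_real K x - g j x\<bar> \<partial>N) \<longlonglongrightarrow> (\<integral>x. 0 \<partial>N)"
      proof (rule integral_dominated_convergence[where w="\<lambda>_. 1"])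
        show "AE x in N. (\<lambda>j. \<bar>indicat_real K x - g j x\<bar>) \<longlonglongrightarrow> 0"
        proof (rule AE_I2)
          fix x
          show "(\<lambda>j. \<bar>indicat_real K x - g j x\<bar>) \<longlonglongrightarrow> 0"
          proof (cases "x \<in> K")
            case True
            then have "g j x = 1" for j by (simp add: g_def)
            then show ?thesis using True by simp
          next
            case nK: False
            have "infdist x K > 0"
              using nK False compact_imp_closed[OF K(2)] by (simp add: infdist_pos_not_in_closed)
            then obtain i where i: "1 < real i * infdist x K"
              using reals_Archimedean3 by blast
            have "g j x = 0" if "j \<ge> i" for j
            proof -
              have "real i * infdist x K \<le> real j * infdist x K"
                using that by (intro mult_right_mono) (auto simp: infdist_nonneg)
              then show ?thesis using i by (simp add: g_def)
            qed
            then have "\<forall>\<^sub>F j in sequentially. \<bar>indicat_real K x - g j x\<bar> = 0"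
              using nK by (auto simp: eventually_sequentially)
            then show ?thesis by (rule tendsto_eventually)
          qed
        qed
        show "AE x in N. norm \<bar>indicat_real K x - g j x\<bar> \<le> 1" for j
          using gK by simp
      qed auto
      then have "\<forall>\<^sub>F j in sequentially. (\<integral>x. \<bar>indicat_real K x - g j x\<bar> \<partial>N) < e'"
        using e' by (intro order_tendstoD) auto
      then obtain j where j: "(\<integral>x. \<bar>indicat_real K x - g j x\<bar> \<partial>N) < e'"
        by (auto simp: eventually_sequentially)
      have i1: "integrable N (\<lambda>x. \<bar>indicat_real K x - g j x\<bar>)"
        by (rule N.integrable_const_bound[where B=1]) (use gK in auto)
      have i2: "integrable N (\<lambda>x. indicat_real A x - indicat_real K x)"
        using A Kb by (auto simp: sN N.emeasure_eq_measure)
      have "(\<integral>x. \<bar>indicat_real A x *\<^sub>R c - c * g j x\<bar> \<partial>\<mu>) = (\<integral>x. \<bar>indicat_real A x *\<^sub>R c - c * g j x\<bar> \<partial>N)"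
      proof (rule gen(2))
        have "(\<lambda>x. \<bar>indicat_real A x *\<^sub>R c - c * g j x\<bar>) \<in> borel_measurable N" by measurable
        then show "(\<lambda>x. \<bar>indicat_real A x *\<^sub>R c - c * g j x\<bar>) \<in> borel_measurable borel"
          by (simp only: measurable_cong_sets[OF sN refl])
      qed
      also have "\<dots> \<le> (\<integral>x. \<bar>c\<bar> * ((indicat_real A x - indicat_real K x) + \<bar>indicat_real K x - g j x\<bar>) \<partial>N)"
      proof (rule integral_mono_AE')
        show "integrable N (\<lambda>x. \<bar>c\<bar> * ((indicat_real A x - indicat_real K x) + \<bar>indicat_real K x - g j x\<bar>))"
          using i1 i2 by (intro integrable_mult_right Bochner_Integration.integrable_add) auto
        have *: "\<bar>indicat_real A x *\<^sub>R c - c * g j x\<bar> \<le> \<bar>c\<bar> * ((indicat_real A x - indicat_real K x) + \<bar>indicat_real K x - g j x\<bar>)" for x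
        proof -
          have "\<bar>indicat_real A x - g j x\<bar> \<le> (indicat_real A x - indicat_real K x) + \<bar>indicat_real K x - g j x\<bar>"
            using K(1) by (auto simp: indicator_def)
          from mult_left_mono[OF this, of "\<bar>c\<bar>"] show ?thesis
            by (simp add: abs_mult[symmetric] algebra_simps)
        qed
        show "AE x in N. \<bar>indicat_real A x *\<^sub>R c - c * g j x\<bar> \<le> \<bar>c\<bar> * ((indicat_real A x - indicat_real K x) + \<bar>indicat_real K x - g j x\<bar>)"
          by (intro AE_I2 *)
        show "AE x in N. 0 \<le> \<bar>c\<bar> * ((indicat_real A x - indicat_real K x) + \<bar>indicat_real K x - g j x\<bar>)"
          by (intro AE_I2 order_trans[OF abs_ge_zero *])
      qed
      also have "\<dots> = \<bar>c\<bar> * ((measure N A - measure N K) + (\<integral>x. \<bar>indicat_real K x - g j x\<bar> \<partial>N))"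
        using i1 i2 A Kb by (simp add: Bochner_Integration.integral_add Bochner_Integration.integral_diff sN N.emeasure_eq_measure)
      also have "\<dots> \<le> \<bar>c\<bar> * (e' + e')" using j mAK by (intro mult_left_mono) auto
      also note ce
      finally show ?thesis using gc by (intro exI[of _ "\<lambda>x. c * g j x"]) (auto intro!: continuous_intros)
    qed
  qed
next
  case (add f g)
  show ?case
  proof (intro allI impI)
    fix e :: real assume e: "e > 0"
    obtain f' where f': "continuous_on UNIV f'" "(\<integral>x. \<bar>f x - f' x\<bar> \<partial>\<mu>) < e / 2" using add(2)[rule_format, of "e / 2"] e by auto
    obtain g' where g': "continuous_on UNIV g'" "(\<integral>x. \<bar>g x - g' x\<bar> \<partial>\<mu>) < e / 2" using add(4)[rule_format, of "e / 2"] e by auto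
    have i: "integrable \<mu> f'" "integrable \<mu> g'"
      using f'(1) g'(1) by (auto intro!: integrable_sphere_continuous intro: continuous_on_subset)
    have "(\<integral>x. \<bar>f x + g x - (f' x + g' x)\<bar> \<partial>\<mu>) \<le> (\<integral>x. \<bar>f x - f' x\<bar> + \<bar>g x - g' x\<bar> \<partial>\<mu>)"
      using add(1,3) i by (intro integral_mono) auto
    also have "\<dots> = (\<integral>x. \<bar>f x - f' x\<bar> \<partial>\<mu>) + (\<integral>x. \<bar>g x - g' x\<bar> \<partial>\<mu>)"
      using add(1,3) i by (intro Bochner_Integration.integral_add) auto
    also have "\<dots> < e" using f'(2) g'(2) by simp
    finally show "\<exists>h. continuous_on UNIV h \<and> (\<integral>x. \<bar>f x + g x - h x\<bar> \<partial>\<mu>) < e"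
      using f'(1) g'(1) by (intro exI[of _ "\<lambda>x. f' x + g' x"]) (auto intro!: continuous_intros)
  qed
next
  case (lim f s)
  show ?case
  proof (intro allI impI)
    fix e :: real assume e: "e > 0"
    have "(\<lambda>i. \<integral>x. \<bar>f x - s i x\<bar> \<partial>\<mu>) \<longlonglongrightarrow> (\<integral>x. 0 \<partial>(\<mu> :: 'a measure))"
    proof (rule integral_dominated_convergence[where w="\<lambda>x. 3 * norm (f x)"])
      show "AE x in \<mu>. (\<lambda>i. \<bar>f x - s i x\<bar>) \<longlonglongrightarrow> 0"
      proof (rule AE_I2)
        fix x :: 'a assume "x \<in> space \<mu>"
        from tendsto_diff[OF tendsto_const[of "f x"] lim(3)[OF this]]
        show "(\<lambda>i. \<bar>f x - s i x\<bar>) \<longlonglongrightarrow> 0" by (simp add: tendsto_rabs_zero)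
      qed
      show "AE x in \<mu>. norm \<bar>f x - s i x\<bar> \<le> 3 * norm (f x)" for i
      proof (rule AE_I2)
        fix x :: 'a assume "x \<in> space \<mu>"
        from lim(4)[OF this, of i] show "norm \<bar>f x - s i x\<bar> \<le> 3 * norm (f x)" by simp
      qed
    qed (use lim(1,5) in auto)
    then have "\<forall>\<^sub>F i in sequentially. (\<integral>x. \<bar>f x - s i x\<bar> \<partial>\<mu>) < e / 2"
      using e by (intro order_tendstoD) auto
    then obtain i where i: "(\<integral>x. \<bar>f x - s i x\<bar> \<partial>\<mu>) < e / 2" by (auto simp: eventually_sequentially)
    obtain g where g: "continuous_on UNIV g" "(\<integral>x. \<bar>s i x - g x\<bar> \<partial>\<mu>) < e / 2" using lim(2)[of i, rule_format, of "e / 2"] e by auto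
    have ig: "integrable \<mu> g" using g(1) by (auto intro!: integrable_sphere_continuous intro: continuous_on_subset)
    have "(\<integral>x. \<bar>f x - g x\<bar> \<partial>\<mu>) \<le> (\<integral>x. \<bar>f x - s i x\<bar> + \<bar>s i x - g x\<bar> \<partial>\<mu>)"
      using lim(1)[of i] lim(5) ig by (intro integral_mono) auto
    also have "\<dots> = (\<integral>x. \<bar>f x - s i x\<bar> \<partial>\<mu>) + (\<integral>x. \<bar>s i x - g x\<bar> \<partial>\<mu>)"
      using lim(1)[of i] lim(5) ig by (intro Bochner_Integration.integral_add) auto
    also have "\<dots> < e" using i g(2) by simp
    finally show "\<exists>g. continuous_on UNIV g \<and> (\<integral>x. \<bar>f x - g x\<bar> \<partial>\<mu>) < e"
      using g(1) by blast
  qed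
qed

section \<open>The normalised kernel as an approximate identity\<close>

definition zonal_const :: "'a::euclidean_space itself \<Rightarrow> nat \<Rightarrow> real" where
  "zonal_const _ d = zonal d (\<lambda>_. 1) (SOME b. b \<in> (Basis :: 'a set))"

definition mollify :: "nat \<Rightarrow> ('a::euclidean_space \<Rightarrow> real) \<Rightarrow> 'a \<Rightarrow> real" where
  "mollify d u x = zonal d u x / zonal_const TYPE('a) d"

text \<open>Rotation invariance makes the arbitrary basis vector behind \<open>zonal_const\<close>
  immaterial.\<close>

lemma zonal_const:
  fixes x :: "real^'m" assumes "norm x = 1"
  shows "zonal d (\<lambda>_. 1) x = zonal_const TYPE(real^'m) d"
proof -
  have "(SOME b. b \<in> (Basis :: (real^'m) set)) \<in> Basis" by (rule someI_ex) (use nonempty_Basis in blast)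
  then have "norm (SOME b. b \<in> (Basis :: (real^'m) set)) = norm x" using assms by simp
  from integral_zonal_eq[OF this, of "\<lambda>t. (1 + t) ^ d"] show ?thesis
    by (simp add: zonal_def zonal_const_def)
qed

text \<open>The open cone over the cap contains x/2, hence a ball of positive Lebesgue
  measure.\<close>

lemma cap_measure_pos:
  fixes x :: "'a::euclidean_space"
  assumes x: "norm x = 1" and t: "t < 1"
  shows "0 < measure \<mu> {y \<in> sphere 0 1. t < x \<bullet> y}"
proof -
  interpret finite_measure "\<mu> :: 'a measure" by (rule finite_sphere_measure)
  define U where "U = {w::'a. norm w < 1} \<inter> {w. t * norm w < x \<bullet> w} \<inter> - {0}"
  have "open {w::'a. norm w < 1}" "open {w. t * norm w < x \<bullet> w}"
    by (rule open_Collect_less; intro continuous_intros)+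
  then have "open U" unfolding U_def by (intro open_Int) auto
  moreover have "(1/2) *\<^sub>R x \<in> U"
    using x t by (auto simp: U_def dot_square_norm)
  ultimately obtain r where r: "r > 0" "ball ((1/2) *\<^sub>R x) r \<subseteq> U" by (auto simp: open_contains_ball)
  have m: "(\<lambda>y. indicator {y. t < x \<bullet> y} y :: ennreal) \<in> borel_measurable borel" by measurable
  have "0 < emeasure lborel (ball ((1/2) *\<^sub>R x) r)"
    using r by (simp add: emeasure_ball unit_ball_vol_pos)
  also have "\<dots> = (\<integral>\<^sup>+w. indicator (ball ((1/2) *\<^sub>R x) r) w \<partial>lborel)" by simp
  also have "\<dots> \<le> (\<integral>\<^sup>+w. indicator {y. t < x \<bullet> y} (w /\<^sub>R norm w) * indicator (cball 0 1 - {0}) w \<partial>lborel)"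
  proof (rule nn_integral_mono)
    fix w :: 'a
    have "norm w < 1 \<and> w \<noteq> 0 \<and> t < x \<bullet> (w /\<^sub>R norm w)" if "w \<in> ball ((1/2) *\<^sub>R x) r"
    proof -
      have "w \<in> U" using r(2) that by blast
      then have w: "norm w < 1" "t * norm w < x \<bullet> w" "w \<noteq> 0" by (simp_all add: U_def)
      have "t < (x \<bullet> w) / norm w" using w by (simp only: less_divide_eq zero_less_norm_iff) simp
      with w show ?thesis by (simp add: divide_inverse mult.commute)
    qed
    then show "indicator (ball ((1/2) *\<^sub>R x) r) w \<le> (indicator {y. t < x \<bullet> y} (w /\<^sub>R norm w) * indicator (cball 0 1 - {0}) w :: ennreal)"
      by (auto simp: indicator_def)
  qed
  finally have "0 < of_nat DIM('a) * (\<integral>\<^sup>+w. indicator {y. t < x \<bullet> y} (w /\<^sub>R norm w) * indicator (cball 0 1 - {0}) w \<partial>lborel)"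
    by (simp add: ennreal_zero_less_mult_iff)
  also have "\<dots> = (\<integral>\<^sup>+y. indicator {y. t < x \<bullet> y} y \<partial>\<mu>)"
    by (rule nn_integral_sphere_measure[OF m, symmetric])
  also have "\<dots> = (\<integral>\<^sup>+y. indicator {y \<in> sphere 0 1. t < x \<bullet> y} y \<partial>\<mu>)"
    by (rule nn_integral_cong) (auto simp: indicator_def)
  also have "\<dots> = emeasure \<mu> {y \<in> sphere 0 1. t < x \<bullet> y}"
  proof (rule nn_integral_indicator)
    have "{y. t < x \<bullet> y} \<in> sets borel" by measurable
    then show "{y \<in> sphere 0 1. t < x \<bullet> y} \<in> sets \<mu>"
      by (auto simp: sets_sphere_measure sets_restrict_space)
  qed
  finally show ?thesis by (simp add: emeasure_eq_measure)
qed

lemma zonal_weight_nonneg: "norm x = 1 \<Longrightarrow> norm y = 1 \<Longrightarrow> 0 \<le> 1 + x \<bullet> y"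
  using Cauchy_Schwarz_ineq2[of x y] by simp

lemma zonal_mono:
  fixes f g :: "'a::euclidean_space \<Rightarrow> real"
  assumes "norm x = 1" "integrable \<mu> f" "integrable \<mu> g"
    and "\<And>y. norm y = 1 \<Longrightarrow> f y \<le> g y"
  shows "zonal d f x \<le> zonal d g x"
  unfolding zonal_def using assms
  by (intro integral_mono integrable_zonal mult_left_mono zero_le_power zonal_weight_nonneg) auto

text \<open>Keeping only the cap of height \<open>t\<close> gives growth like (1 + t)^d. For
  \<open>t\<close> close to 1 this outgrows the kernel off any fixed larger cap.\<close>

lemma zonal_const_lower:
  fixes x :: "real^'m"
  assumes x: "norm x = 1" and t: "-1 < t" "t < 1"
  shows "(1 + t) ^ d * measure \<mu> {y \<in> sphere 0 1. t < x \<bullet> y} \<le> zonal_const TYPE(real^'m) d"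
proof -
  interpret finite_measure "\<mu> :: (real^'m) measure" by (rule finite_sphere_measure)
  define C where "C = {y \<in> sphere 0 1. t < x \<bullet> y}"
  have "{y. t < x \<bullet> y} \<in> sets borel" by measurable
  then have C: "C \<in> sets \<mu>"
    by (auto simp: C_def sets_sphere_measure sets_restrict_space)
  have "(1 + t) ^ d * measure \<mu> C = (\<integral>y. (1 + t) ^ d * indicator C y \<partial>\<mu>)"
  proof -
    have "C \<inter> sphere 0 1 = C" by (auto simp: C_def)
    then show ?thesis by simp
  qed
  also have "\<dots> \<le> zonal d (\<lambda>_. 1) x"
    unfolding zonal_def
  proof (rule integral_mono)
    show "integrable \<mu> (\<lambda>y. (1 + t) ^ d * indicat_real C y)" using C by (auto simp: emeasure_eq_measure)
    show "integrable \<mu> (\<lambda>y. (1 + x \<bullet> y) ^ d * 1)" by (intro integrable_zonal) simp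
    fix y assume "y \<in> space (\<mu> :: (real^'m) measure)"
    then show "(1 + t) ^ d * indicat_real C y \<le> (1 + x \<bullet> y) ^ d * 1"
      using t zonal_weight_nonneg[OF x, of y] by (auto simp: C_def indicator_def intro!: power_mono)
  qed
  finally show ?thesis by (simp add: C_def zonal_const[OF x])
qed

lemma zonal_const_pos: "0 < zonal_const TYPE(real^'m) d"
proof -
  obtain b :: "real^'m" where b: "b \<in> Basis" using nonempty_Basis by blast
  then have "0 < (1 + (0::real)) ^ d * measure \<mu> {y \<in> sphere 0 1. 0 < b \<bullet> y}"
    using cap_measure_pos[of b 0] by simp
  also have "\<dots> \<le> zonal_const TYPE(real^'m) d" by (rule zonal_const_lower) (use b in auto)
  finally show ?thesis .
qed

lemma mollify_mono:
  fixes f g :: "real^'m \<Rightarrow> real"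
  assumes "norm x = 1" "integrable \<mu> f" "integrable \<mu> g"
    and "\<And>y. norm y = 1 \<Longrightarrow> f y \<le> g y"
  shows "mollify d f x \<le> mollify d g x"
  unfolding mollify_def using zonal_mono[OF assms] zonal_const_pos[where 'm='m, of d]
  by (intro divide_right_mono) auto

lemma mollify_nonneg:
  fixes f :: "real^'m \<Rightarrow> real"
  assumes "norm x = 1" "integrable \<mu> f" "\<And>y. norm y = 1 \<Longrightarrow> 0 \<le> f y"
  shows "0 \<le> mollify d f x"
  using mollify_mono[of x "\<lambda>_. 0" f d] assms by (simp add: mollify_def zonal_def)

lemma mollify_diff:
  fixes f g :: "real^'m \<Rightarrow> real"
  assumes "integrable \<mu> f" "integrable \<mu> g"
  shows "mollify d (\<lambda>y. f y - g y) x = mollify d f x - mollify d g x"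
  unfolding mollify_def zonal_def diff_divide_distrib[symmetric]
  by (subst Bochner_Integration.integral_diff[symmetric])
     (auto intro!: integrable_zonal assms simp: right_diff_distrib)

lemma mollify_const:
  fixes x :: "real^'m"
  assumes "norm x = 1" shows "mollify d (\<lambda>_. c) x = c"
proof -
  have "zonal d (\<lambda>_. c) x = c * zonal d (\<lambda>_. 1) x" by (simp add: zonal_def mult.commute)
  then show ?thesis using zonal_const_pos[where 'm='m, of d] by (simp add: mollify_def zonal_const[OF assms])
qed

lemma abs_mollify_le:
  fixes f :: "real^'m \<Rightarrow> real"
  assumes that: "norm x = 1" "integrable \<mu> f"
  shows "\<bar>mollify d f x\<bar> \<le> mollify d (\<lambda>y. \<bar>f y\<bar>) x"
proof -
  have "mollify d f x \<le> mollify d (\<lambda>y. \<bar>f y\<bar>) x" using that by (intro mollify_mono) auto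
  moreover have "mollify d (\<lambda>y. - f y) x \<le> mollify d (\<lambda>y. \<bar>f y\<bar>) x" using that by (intro mollify_mono) auto
  moreover have "mollify d (\<lambda>y. - f y) x = - mollify d f x" by (simp add: mollify_def zonal_def)
  ultimately show ?thesis by linarith
qed

lemma continuous_on_mollify: "integrable \<mu> u \<Longrightarrow> continuous_on S (mollify d u)"
  unfolding mollify_def[abs_def] divide_inverse by (intro continuous_intros continuous_on_zonal)

lemma mollify_symmetric:
  fixes f g :: "real^'m \<Rightarrow> real"
  assumes "integrable \<mu> f" "integrable \<mu> g"
  shows "(\<integral>x. mollify d f x * g x \<partial>\<mu>) = (\<integral>y. f y * mollify d g y \<partial>\<mu>)"
  using zonal_symmetric[OF assms, of d] by (simp add: mollify_def)

text \<open>Self-adjointness tested with the constant 1, which the mollifier fixes.\<close>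

lemma integral_mollify:
  fixes f :: "real^'m \<Rightarrow> real"
  assumes f: "integrable \<mu> f"
  shows "(\<integral>x. mollify d f x \<partial>\<mu>) = (\<integral>x. f x \<partial>\<mu>)"
proof -
  interpret finite_measure "\<mu> :: (real^'m) measure" by (rule finite_sphere_measure)
  have "(\<integral>x. mollify d f x * 1 \<partial>\<mu>) = (\<integral>x. f x * mollify d (\<lambda>_. 1) x \<partial>\<mu>)"
    by (rule mollify_symmetric[OF f]) simp
  also have "\<dots> = (\<integral>x. f x \<partial>\<mu>)"
    by (rule Bochner_Integration.integral_cong) (auto simp: mollify_const)
  finally show ?thesis by simp
qed

text \<open>The normalised kernel is a probability density on the sphere, so Jensen's inequality
  applies.\<close>

lemma mollify_powr_le:
  fixes f :: "real^'m \<Rightarrow> real"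
  assumes x: "norm x = 1" and p: "1 < p" and f: "integrable \<mu> f" "integrable \<mu> (\<lambda>y. f y powr p)"
    and nn: "\<And>y. norm y = 1 \<Longrightarrow> 0 \<le> f y"
  shows "mollify d f x powr p \<le> mollify d (\<lambda>y. f y powr p) x"
proof -
  define w where "w y = (1 + x \<bullet> y) ^ d / zonal_const TYPE(real^'m) d" for y :: "real^'m"
  have w0: "AE y in \<mu>. 0 \<le> w y"
    using zonal_const_pos[where 'm='m, of d] x by (intro AE_I2) (auto simp: w_def intro!: divide_nonneg_pos zero_le_power zonal_weight_nonneg)
  have wm: "w \<in> borel_measurable \<mu>"
    unfolding w_def[abs_def] by (intro borel_measurable_sphere_measure) measurable
  define D where "D = density \<mu> (\<lambda>y. ennreal (w y))"
  have eq: "(\<integral>y. g y \<partial>D) = mollify d g x" if "integrable \<mu> g" for g :: "real^'m \<Rightarrow> real"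
    using integral_density[OF borel_measurable_integrable[OF that] wm w0] zonal_const_pos[where 'm='m, of d]
    by (simp add: D_def w_def mollify_def zonal_def)
  have int: "integrable D g" if "integrable \<mu> g" for g :: "real^'m \<Rightarrow> real"
    using integrable_density[OF borel_measurable_integrable[OF that] wm w0] integrable_zonal[OF that, of x d]
    by (simp add: D_def w_def)
  interpret finite_measure "\<mu> :: (real^'m) measure" by (rule finite_sphere_measure)
  have "integrable \<mu> (\<lambda>y. w y)"
    using integrable_zonal[of "\<lambda>_. 1" x d] by (simp add: w_def)
  then have nnw: "(\<integral>\<^sup>+y. ennreal (w y) \<partial>\<mu>) = ennreal (\<integral>y. w y \<partial>\<mu>)"
    using w0 by (rule nn_integral_eq_integral)
  have "emeasure D (space D) = (\<integral>\<^sup>+y. 1 \<partial>D)" by simp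
  also have "\<dots> = (\<integral>\<^sup>+y. ennreal (w y) * 1 \<partial>\<mu>)"
    unfolding D_def using wm by (intro nn_integral_density) auto
  also have "\<dots> = ennreal (\<integral>y. w y \<partial>\<mu>)" using nnw by simp
  also have "(\<integral>y. w y \<partial>\<mu>) = mollify d (\<lambda>_. 1) x"
    by (simp add: w_def mollify_def zonal_def)
  also have "\<dots> = 1" by (rule mollify_const[OF x])
  finally interpret D: prob_space D by (intro prob_spaceI) simp
  have "(\<integral>y. f y \<partial>D) powr p \<le> (\<integral>y. f y powr p \<partial>D)"
    using f nn p by (intro D.expectation_powr_le int) (auto simp: D_def)
  then show ?thesis by (simp add: eq f)
qed

text \<open>Near \<open>x\<close> the oscillation of \<open>f\<close> is small. Away from
  \<open>x\<close> the kernel is at most (2 - \<eta>)^d, while its total mass is at least (2 -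
  \<eta>/2)^d m, so that part decays geometrically. The decay is uniform because the total mass does
  not depend on \<open>x\<close>.\<close>

lemma mollify_uniform_limit:
  fixes f :: "real^'m \<Rightarrow> real"
  assumes f: "continuous_on (sphere 0 1) f" and e: "e > 0"
  shows "\<exists>D. \<forall>d\<ge>D. \<forall>x\<in>sphere 0 1. \<bar>mollify d f x - f x\<bar> \<le> e"
proof -
  interpret finite_measure "\<mu> :: (real^'m) measure" by (rule finite_sphere_measure)
  have fint: "integrable \<mu> f" by (rule integrable_sphere_continuous[OF f])
  have "uniformly_continuous_on (sphere 0 1) f"
    by (rule compact_uniformly_continuous[OF f]) simp
  then obtain r where r: "r > 0" "\<And>x y. x \<in> sphere 0 1 \<Longrightarrow> y \<in> sphere 0 1 \<Longrightarrow> dist y x < r \<Longrightarrow> dist (f y) (f x) < e / 2"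
    using e unfolding uniformly_continuous_on_def by (metis half_gt_zero)
  have "bounded (f ` sphere 0 1)" by (intro compact_imp_bounded compact_continuous_image f) auto
  then obtain B where B: "\<And>x. x \<in> sphere 0 1 \<Longrightarrow> \<bar>f x\<bar> \<le> B"
    unfolding bounded_iff by force
  \<comment> \<open>On the sphere |x - y|^2 = 2 - 2 x.y, so x.y > 1 - \<eta> with \<eta> \<le> r^2/2
    forces |x - y| < r. The bound 1/2 keeps the bases of the powers positive.\<close>
  define \<eta> where "\<eta> = min (r\<^sup>2 / 2) (1 / 2)"
  have \<eta>: "0 < \<eta>" "\<eta> \<le> 1 / 2" "\<eta> \<le> r\<^sup>2 / 2" using r by (auto simp: \<eta>_def)
  define K where "K d = zonal_const TYPE(real^'m) d" for d
  have K0: "K d > 0" for d unfolding K_def by (rule zonal_const_pos)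
  define V where "V = measure \<mu> (sphere (0::real^'m) 1)"
  obtain b :: "real^'m" where b: "b \<in> Basis" using nonempty_Basis by blast
  define m where "m = measure \<mu> {y \<in> sphere 0 1. 1 - \<eta> / 2 < b \<bullet> y}"
  have m: "m > 0" unfolding m_def using b \<eta> by (intro cap_measure_pos) auto
  have Klow: "(2 - \<eta> / 2) ^ d * m \<le> K d" for d
    using zonal_const_lower[of b "1 - \<eta> / 2" d] b \<eta> by (simp add: K_def m_def)
  have B0: "0 \<le> B" using B[of b] b by simp
  have main: "\<bar>mollify d f x - f x\<bar> \<le> e / 2 + (2 * B * V / m) * ((2 - \<eta>) / (2 - \<eta> / 2)) ^ d" if x: "x \<in> sphere 0 1" for x d
  proof -
    have nx: "norm x = 1" using x by simp
    have ci: "integrable \<mu> (\<lambda>y. f y - f x)" using fint by simp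
    have "mollify d f x - f x = mollify d (\<lambda>y. f y - f x) x"
      using mollify_diff[OF fint, of "\<lambda>_. f x" d x] by (simp add: mollify_const[OF nx])
    then have "\<bar>mollify d f x - f x\<bar> \<le> mollify d (\<lambda>y. \<bar>f y - f x\<bar>) x"
      using abs_mollify_le[OF nx ci, of d] by simp
    also have "\<dots> \<le> (e / 2 * K d + 2 * B * (2 - \<eta>) ^ d * V) / K d"
      unfolding mollify_def K_def[symmetric]
    proof (rule divide_right_mono)
      have "zonal d (\<lambda>y. \<bar>f y - f x\<bar>) x \<le> (\<integral>y. e / 2 * ((1 + x \<bullet> y) ^ d * 1) + 2 * B * (2 - \<eta>) ^ d \<partial>\<mu>)"
        unfolding zonal_def
      proof (rule integral_mono)
        show "integrable \<mu> (\<lambda>y. (1 + x \<bullet> y) ^ d * \<bar>f y - f x\<bar>)"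
          using ci by (intro integrable_zonal) auto
        show "integrable \<mu> (\<lambda>y. e / 2 * ((1 + x \<bullet> y) ^ d * 1) + 2 * B * (2 - \<eta>) ^ d)"
          by (intro Bochner_Integration.integrable_add integrable_mult_right integrable_zonal) auto
        fix y assume "y \<in> space (\<mu> :: (real^'m) measure)"
        then have y: "y \<in> sphere 0 1" by simp
        have w: "0 \<le> 1 + x \<bullet> y" using zonal_weight_nonneg[of x y] nx y by simp
        show "(1 + x \<bullet> y) ^ d * \<bar>f y - f x\<bar> \<le> e / 2 * ((1 + x \<bullet> y) ^ d * 1) + 2 * B * (2 - \<eta>) ^ d"
        proof (cases "x \<bullet> y > 1 - \<eta>")
          case True
          have "(dist y x)\<^sup>2 = 2 - 2 * (x \<bullet> y)"
            using nx y by (simp add: dist_norm power2_norm_eq_inner inner_diff_left inner_diff_right inner_commute norm_eq_1)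
          also have "\<dots> < r\<^sup>2" using True \<eta> by simp
          finally have "dist y x < r" using r(1) by (simp add: power2_less_imp_less)
          from r(2)[OF x y this] have "\<bar>f y - f x\<bar> \<le> e / 2" by (simp add: dist_real_def)
          then have "(1 + x \<bullet> y) ^ d * \<bar>f y - f x\<bar> \<le> (1 + x \<bullet> y) ^ d * (e / 2)"
            using w by (intro mult_left_mono) auto
          moreover have "0 \<le> 2 * B * (2 - \<eta>) ^ d" using B0 \<eta> by simp
          ultimately show ?thesis by (simp add: mult.commute)
        next
          case False
          have "\<bar>f y - f x\<bar> \<le> 2 * B" using B[OF x] B[OF y] by linarith
          moreover have "(1 + x \<bullet> y) ^ d \<le> (2 - \<eta>) ^ d" using False w by (intro power_mono) auto
          ultimately have "(1 + x \<bullet> y) ^ d * \<bar>f y - f x\<bar> \<le> (2 - \<eta>) ^ d * (2 * B)"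
            using \<eta> by (intro mult_mono) auto
          moreover have "0 \<le> e / 2 * ((1 + x \<bullet> y) ^ d * 1)" using e w by simp
          ultimately show ?thesis by (simp add: mult.commute)
        qed
      qed
      also have "\<dots> = (\<integral>y. e / 2 * ((1 + x \<bullet> y) ^ d * 1) \<partial>\<mu>) + (\<integral>y. 2 * B * (2 - \<eta>) ^ d \<partial>(\<mu> :: (real^'m) measure))"
        by (intro Bochner_Integration.integral_add integrable_mult_right integrable_zonal) auto
      also have "\<dots> = e / 2 * K d + 2 * B * (2 - \<eta>) ^ d * V"
        using zonal_const[OF nx, of d] by (simp add: zonal_def K_def V_def)
      finally show "zonal d (\<lambda>y. \<bar>f y - f x\<bar>) x \<le> e / 2 * K d + 2 * B * (2 - \<eta>) ^ d * V" .
    qed (use K0[of d] in simp)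
    also have "\<dots> = e / 2 + 2 * B * (2 - \<eta>) ^ d * V / K d"
      using K0[of d] by (simp add: add_divide_distrib)
    also have "2 * B * (2 - \<eta>) ^ d * V / K d \<le> 2 * B * (2 - \<eta>) ^ d * V / ((2 - \<eta> / 2) ^ d * m)"
      using Klow[of d] B0 \<eta> m K0[of d] by (intro divide_left_mono) (auto simp: V_def)
    also have "\<dots> = (2 * B * V / m) * ((2 - \<eta>) / (2 - \<eta> / 2)) ^ d"
      by (simp add: power_divide mult_ac)
    finally show ?thesis by simp
  qed
  have "(\<lambda>d. (2 * B * V / m) * ((2 - \<eta>) / (2 - \<eta> / 2)) ^ d) \<longlonglongrightarrow> (2 * B * V / m) * 0"
    using \<eta> by (intro tendsto_intros LIMSEQ_power_zero) (auto simp: abs_if divide_less_eq)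
  then have "\<forall>\<^sub>F d in sequentially. (2 * B * V / m) * ((2 - \<eta>) / (2 - \<eta> / 2)) ^ d < e / 2"
    using e by (intro order_tendstoD(2)) auto
  then obtain D where D: "\<And>d. d \<ge> D \<Longrightarrow> (2 * B * V / m) * ((2 - \<eta>) / (2 - \<eta> / 2)) ^ d < e / 2"
    by (auto simp: eventually_sequentially)
  show ?thesis
  proof (intro exI[of _ D] allI impI ballI)
    fix d :: nat and x :: "real^'m" assume d: "D \<le> d" and x: "x \<in> sphere 0 1"
    show "\<bar>mollify d f x - f x\<bar> \<le> e" using main[OF x, of d] D[OF d] by linarith
  qed
qed

text \<open>A nearby continuous \<open>g\<close> converges uniformly, and the remainder u - g stays
  small in L^1 because the mollifier preserves order and integrals.\<close>

lemma mollify_L1_tendsto: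
  fixes u :: "real^'m \<Rightarrow> real"
  assumes u: "integrable \<mu> u"
  shows "(\<lambda>d. \<integral>x. \<bar>mollify d u x - u x\<bar> \<partial>\<mu>) \<longlonglongrightarrow> 0"
proof (rule LIMSEQ_I)
  fix e :: real assume e: "e > 0"
  interpret finite_measure "\<mu> :: (real^'m) measure" by (rule finite_sphere_measure)
  define V where "V = measure \<mu> (sphere (0::real^'m) 1)"
  have V: "0 \<le> V" by (simp add: V_def)
  obtain g where g: "continuous_on UNIV g" "(\<integral>x. \<bar>u x - g x\<bar> \<partial>\<mu>) < e / 4"
    using integrable_approx_continuous[OF u, rule_format, of "e / 4"] e by auto
  have gc: "continuous_on (sphere 0 1) g" using g(1) by (rule continuous_on_subset) simp
  have gi: "integrable \<mu> g" by (rule integrable_sphere_continuous[OF gc])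
  have "0 < e / (4 * (V + 1))" using e V by simp
  from mollify_uniform_limit[OF gc this] obtain D where
    D: "\<And>d x. d \<ge> D \<Longrightarrow> x \<in> sphere 0 1 \<Longrightarrow> \<bar>mollify d g x - g x\<bar> \<le> e / (4 * (V + 1))" by blast
  have mi: "integrable \<mu> (mollify d v)" if "integrable \<mu> v" for v :: "real^'m \<Rightarrow> real" and d
    by (intro integrable_sphere_continuous continuous_on_mollify that)
  have ui: "integrable \<mu> (\<lambda>y. u y - g y)" using u gi by simp
  show "\<exists>no. \<forall>n\<ge>no. norm ((\<integral>x. \<bar>mollify n u x - u x\<bar> \<partial>\<mu>) - 0) < e"
  proof (intro exI[of _ D] allI impI)
    fix d assume d: "D \<le> d"
    have "(\<integral>x. \<bar>mollify d u x - u x\<bar> \<partial>\<mu>)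
      \<le> (\<integral>x. (mollify d (\<lambda>y. \<bar>u y - g y\<bar>) x + e / (4 * (V + 1))) + \<bar>u x - g x\<bar> \<partial>\<mu>)"
    proof (rule integral_mono)
      show "integrable \<mu> (\<lambda>x. \<bar>mollify d u x - u x\<bar>)" using mi[OF u] u by simp
      show "integrable \<mu> (\<lambda>x. (mollify d (\<lambda>y. \<bar>u y - g y\<bar>) x + e / (4 * (V + 1))) + \<bar>u x - g x\<bar>)"
        using mi ui by (intro Bochner_Integration.integrable_add) auto
      fix x assume "x \<in> space (\<mu> :: (real^'m) measure)"
      then have x: "x \<in> sphere 0 1" "norm x = 1" by auto
      have "\<bar>mollify d u x - mollify d g x\<bar> \<le> mollify d (\<lambda>y. \<bar>u y - g y\<bar>) x"
        using abs_mollify_le[OF x(2) ui, of d] mollify_diff[OF u gi, of d x] by simp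
      then show "\<bar>mollify d u x - u x\<bar> \<le> (mollify d (\<lambda>y. \<bar>u y - g y\<bar>) x + e / (4 * (V + 1))) + \<bar>u x - g x\<bar>"
        using D[OF d x(1)] by linarith
    qed
    also have "\<dots> = (\<integral>x. mollify d (\<lambda>y. \<bar>u y - g y\<bar>) x \<partial>\<mu>) + V * (e / (4 * (V + 1))) + (\<integral>x. \<bar>u x - g x\<bar> \<partial>\<mu>)"
      using mi[of "\<lambda>y. \<bar>u y - g y\<bar>" d] ui
      by (simp add: Bochner_Integration.integral_add V_def)
    also have "(\<integral>x. mollify d (\<lambda>y. \<bar>u y - g y\<bar>) x \<partial>\<mu>) = (\<integral>x. \<bar>u x - g x\<bar> \<partial>\<mu>)"
      using ui by (intro integral_mollify) auto
    also have "V * (e / (4 * (V + 1))) \<le> (V + 1) * (e / (4 * (V + 1)))"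
      using e V by (intro mult_right_mono) auto
    also have "(V + 1) * (e / (4 * (V + 1))) = e / 4"
    proof -
      have "W * (e / (4 * W)) = e / 4" if "W > 0" for W :: real using that by simp
      from this[of "V + 1"] V show ?thesis by simp
    qed
    finally have "(\<integral>x. \<bar>mollify d u x - u x\<bar> \<partial>\<mu>) < e" using g(2) e by linarith
    then show "norm ((\<integral>x. \<bar>mollify d u x - u x\<bar> \<partial>\<mu>) - 0) < e" by simp
  qed
qed

lemma mollify_AE_subseq:
  fixes u :: "real^'m \<Rightarrow> real"
  assumes u: "integrable \<mu> u"
  shows "\<exists>r. strict_mono r \<and> (AE x in \<mu>. (\<lambda>i. mollify (r i) u x) \<longlonglongrightarrow> u x)"
proof -
  have i: "integrable \<mu> (\<lambda>x. mollify d u x - u x)" for d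
    by (intro Bochner_Integration.integrable_diff u integrable_sphere_continuous continuous_on_mollify)
  have "(\<lambda>d. \<integral>x. norm (mollify d u x - u x) \<partial>\<mu>) \<longlonglongrightarrow> 0"
    using mollify_L1_tendsto[OF u] by simp
  from tendsto_L1_AE_subseq[OF i this] show ?thesis by (simp add: LIM_zero_iff)
qed

section \<open>The Sobolev inequality on small caps\<close>

text \<open>Separates the gradient term, with a factor as close to 1 as desired, from the zero-order
  term. With (1 + \<delta>)^p = 1 + \<eta>, either b \<le> \<delta> a and the first summand
  suffices, or a \<le> b/\<delta> and the second does.\<close>

lemma powr_add_le_weighted:
  fixes p \<eta> :: real
  assumes p: "1 < p" and \<eta>: "0 < \<eta>"
  shows "\<exists>C\<ge>0. \<forall>a\<ge>0. \<forall>b\<ge>0. (a + b) powr p \<le> (1 + \<eta>) * a powr p + C * b powr p"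
proof -
  define \<delta> where "\<delta> = (1 + \<eta>) powr (1 / p) - 1"
  have "1 powr (1 / p) < (1 + \<eta>) powr (1 / p)" using p \<eta> by (intro powr_less_mono2) auto
  then have \<delta>: "\<delta> > 0" by (simp add: \<delta>_def)
  have \<delta>p: "(1 + \<delta>) powr p = 1 + \<eta>" using p \<eta> by (simp add: \<delta>_def powr_powr)
  show ?thesis
  proof (intro exI[of _ "(1 / \<delta> + 1) powr p"] conjI allI impI)
    fix a b :: real assume a: "0 \<le> a" and b: "0 \<le> b"
    show "(a + b) powr p \<le> (1 + \<eta>) * a powr p + (1 / \<delta> + 1) powr p * b powr p"
    proof (cases "b \<le> \<delta> * a")
      case True
      have "(a + b) powr p \<le> ((1 + \<delta>) * a) powr p"
        using p a b True by (intro powr_mono2) (auto simp: algebra_simps)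
      also have "\<dots> = (1 + \<eta>) * a powr p" by (simp only: powr_mult \<delta>p)
      also have "\<dots> \<le> (1 + \<eta>) * a powr p + (1 / \<delta> + 1) powr p * b powr p" by simp
      finally show ?thesis .
    next
      case False
      then have "a \<le> (1 / \<delta>) * b" using \<delta> by (simp add: field_simps)
      then have "a + b \<le> (1 / \<delta> + 1) * b" by (simp add: distrib_right)
      then have "(a + b) powr p \<le> ((1 / \<delta> + 1) * b) powr p"
        using p a b by (intro powr_mono2) auto
      also have "\<dots> = (1 / \<delta> + 1) powr p * b powr p" by (rule powr_mult)
      also have "\<dots> \<le> (1 + \<eta>) * a powr p + (1 / \<delta> + 1) powr p * b powr p" using \<eta> by simp
      finally show ?thesis .
    qed
  qed simp
qed

section \<open>Derivative estimates for the gnomonic chart\<close>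

lemma gnomonic_scale_has_derivative:
  "(gnomonic_scale has_derivative (\<lambda>h. - (gnomonic_scale y ^ 3) * (y \<bullet> h))) (at (y::'a::euclidean_space))"
proof -
  have pos: "0 < 1 + y \<bullet> y" by (smt (verit) inner_ge_zero)
  have "((\<lambda>y. 1 + y \<bullet> y) has_derivative (\<lambda>h. 2 * (y \<bullet> h))) (at y)"
    by (rule has_derivative_eq_rhs[OF has_derivative_add[OF has_derivative_const has_derivative_inner[OF has_derivative_ident has_derivative_ident]]])
       (simp add: fun_eq_iff inner_commute)
  from DERIV_compose_FDERIV[OF has_real_derivative_powr[OF pos, of "- 1 / 2"] this]
  have "(gnomonic_scale has_derivative (\<lambda>h. 2 * (y \<bullet> h) * (- 1 / 2 * (1 + y \<bullet> y) powr (- 1 / 2 - 1)))) (at y)"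
    unfolding gnomonic_scale_def[abs_def] .
  moreover have "(1 + y \<bullet> y) powr (- 1 / 2 - 1) = gnomonic_scale y ^ 3"
  proof -
    have "(- 1 / 2 - 1 :: real) = - 1 / 2 + - 1 / 2 + - 1 / 2" by simp
    then show ?thesis by (simp only: powr_add power3_eq_cube gnomonic_scale_def)
  qed
  ultimately show ?thesis by (simp add: mult.commute)
qed

lemma times_cont_diff_gnomonic_scale: "times_cont_diff k (gnomonic_scale :: 'a::euclidean_space \<Rightarrow> real)"
proof -
  have "times_cont_diff k (\<lambda>y::'a. 1 + (\<Sum>b\<in>Basis. (y \<bullet> b) * (y \<bullet> b)))"
    by (intro times_cont_diff_add times_cont_diff_const times_cont_diff_sum times_cont_diff_mult
        times_cont_diff_bounded_linear bounded_linear_inner_left)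
  then have "times_cont_diff k (\<lambda>y::'a. 1 + y \<bullet> y)" by (simp add: euclidean_inner[symmetric])
  moreover have "0 < 1 + y \<bullet> y" for y :: 'a by (smt (verit) inner_ge_zero)
  ultimately show ?thesis unfolding gnomonic_scale_def[abs_def] by (rule times_cont_diff_powr)
qed

lemma gnomonic_scale_mult_norm_le: "gnomonic_scale y * norm y \<le> 1"
proof -
  have "(gnomonic_scale y * norm y)\<^sup>2 = (gnomonic_scale y)\<^sup>2 * (y \<bullet> y)" by (simp add: power_mult_distrib power2_norm_eq_inner)
  also have "\<dots> \<le> (gnomonic_scale y)\<^sup>2 * (1 + y \<bullet> y)" by (intro mult_left_mono) auto
  also have "\<dots> = 1\<^sup>2" using gnomonic_scale_square[of y] by simp
  finally show ?thesis by (rule power2_le_imp_le) simp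
qed

locale gnomonic_chart =
  fixes z :: "real^'m" and L :: "real^'n \<Rightarrow> real^'m"
  assumes card: "CARD('m) = CARD('n) + 1" and z: "norm z = 1"
    and L: "linear L" "\<And>y. norm (L y) = norm y" "\<And>y. L y \<bullet> z = 0"
    and J: "distr (lborel \<Otimes>\<^sub>M lborel) borel (\<lambda>(t, y). t *\<^sub>R z + L y) = lborel"
begin

definition \<psi> where "\<psi> y = gnomonic_scale y *\<^sub>R (z + L y)"

definition d\<psi> where "d\<psi> y h = gnomonic_scale y *\<^sub>R L h + (- (gnomonic_scale y ^ 3) * (y \<bullet> h)) *\<^sub>R (z + L y)"

lemma inner_L: "L x \<bullet> L y = x \<bullet> y"
  unfolding dot_norm linear_add[OF L(1), symmetric] L(2) ..

lemma inner_zL: "(z + L y) \<bullet> (z + L y) = 1 + y \<bullet> y" "L h \<bullet> (z + L y) = h \<bullet> y" "(z + L y) \<bullet> z = 1"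
  using z L(3)[of y] L(3)[of h]
  by (simp_all add: inner_add_left inner_add_right inner_L inner_commute[of z "L y"] norm_eq_1)

lemma norm_\<psi>: "norm (\<psi> y) = 1" and inner_\<psi>_z: "\<psi> y \<bullet> z = gnomonic_scale y"
proof -
  have "\<psi> y \<bullet> \<psi> y = (gnomonic_scale y)\<^sup>2 * (1 + y \<bullet> y)"
    unfolding \<psi>_def inner_scaleR_left inner_scaleR_right inner_zL by (simp add: power2_eq_square)
  then show "norm (\<psi> y) = 1" by (simp add: gnomonic_scale_square norm_eq_1)
  show "\<psi> y \<bullet> z = gnomonic_scale y" unfolding \<psi>_def inner_scaleR_left inner_zL by simp
qed

lemma has_derivative_\<psi>: "(\<psi> has_derivative d\<psi> y) (at y)"
proof -
  have "((\<lambda>y. z + L y) has_derivative L) (at y)"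
    using has_derivative_add[OF has_derivative_const linear_imp_has_derivative[OF L(1)], of z] by simp
  from has_derivative_scaleR[OF gnomonic_scale_has_derivative this]
  show ?thesis unfolding \<psi>_def[abs_def] d\<psi>_def[abs_def] .
qed

lemma d\<psi>_orthogonal: "d\<psi> y h \<bullet> \<psi> y = 0"
proof -
  define s where "s = gnomonic_scale y"
  have "d\<psi> y h \<bullet> \<psi> y = s * s * (h \<bullet> y) - s * s * (y \<bullet> h) * ((s\<^sup>2) * (1 + y \<bullet> y))"
    unfolding d\<psi>_def \<psi>_def inner_scaleR_left inner_scaleR_right inner_add_left[of "_ *\<^sub>R L h"] inner_zL s_def[symmetric]
    by (simp add: power2_eq_square power3_eq_cube algebra_simps)
  then show ?thesis using gnomonic_scale_square[of y] by (simp add: s_def inner_commute)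
qed

text \<open>The squared length is s^2 |h|^2 - s^4 (y.h)^2 with s \<le> 1. The chart thus contracts
  tangent vectors, and gradients do not grow under pull-back.\<close>

lemma norm_d\<psi>_le: "norm (d\<psi> y h) \<le> norm h"
proof -
  define s where "s = gnomonic_scale y"
  have s: "s\<^sup>2 * (1 + y \<bullet> y) = 1" "0 < s" "s \<le> 1"
    by (simp_all add: s_def gnomonic_scale_square gnomonic_scale_pos gnomonic_scale_le_1)
  have "d\<psi> y h \<bullet> d\<psi> y h = s\<^sup>2 * (h \<bullet> h) + (s ^ 4 * (y \<bullet> h)\<^sup>2) * (s\<^sup>2 * (1 + y \<bullet> y)) - 2 * s ^ 4 * (y \<bullet> h)\<^sup>2"
    unfolding d\<psi>_def inner_add_left[of "_ *\<^sub>R L h"] inner_add_right[of _ "_ *\<^sub>R L h"] inner_scaleR_left inner_scaleR_right inner_zL inner_L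
      inner_commute[of "z + L y" "L h"] s_def[symmetric]
    by (simp add: inner_commute[of h y] power2_eq_square power3_eq_cube eval_nat_numeral algebra_simps)
  also have "\<dots> = s\<^sup>2 * (h \<bullet> h) - s ^ 4 * (y \<bullet> h)\<^sup>2" by (simp only: s(1))
  also have "\<dots> \<le> s\<^sup>2 * (h \<bullet> h)" by simp
  also have "\<dots> \<le> 1 * (h \<bullet> h)" using s by (intro mult_right_mono) (auto simp: power_le_one)
  finally show ?thesis by (simp add: norm_le)
qed

lemma nn_integral_chart:
  assumes "F \<in> borel_measurable borel"
  shows "(\<integral>\<^sup>+x. F x * indicator {x. 0 < x \<bullet> z} x \<partial>\<mu>)
    = (\<integral>\<^sup>+y. F (\<psi> y) * ennreal (gnomonic_scale y ^ CARD('m)) \<partial>lborel)"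
  unfolding \<psi>_def by (rule nn_integral_gnomonic[OF card z L J assms])

lemma times_cont_diff_\<psi>: "times_cont_diff k (\<lambda>y. \<psi> y \<bullet> b)"
proof -
  have "bounded_linear (\<lambda>y. L y \<bullet> b)"
    using L(1) by (intro bounded_linear_compose[OF bounded_linear_inner_left]) (simp add: linear_conv_bounded_linear)
  then show ?thesis
    unfolding \<psi>_def inner_scaleR_left inner_add_left
    by (intro times_cont_diff_mult times_cont_diff_gnomonic_scale times_cont_diff_add times_cont_diff_const
        times_cont_diff_bounded_linear)
qed

end

section \<open>The cap inequality for mollified functions\<close>

context gnomonic_chart
begin

text \<open>The cut-off function, read in the chart, is a Euclidean test function whose gradient is
  at most b g + 2 |v|, by \<open>zonal_gradient_bound\<close> and \<open>norm_d\<psi>_le\<close>.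
  The chart density s^(n+1) is compared on each side separately: s \<le> 1 has the right direction
  on the left, and s > \<tau> on the cap costs the factor 1/\<tau>^(n+1) on the right, which is
  close to 1 for small caps. The degree is \<open>Suc d\<close>, as in the gradient bound.\<close>

lemma local_sobolev:
  fixes u :: "real^'m \<Rightarrow> real" and G :: "real^'m \<Rightarrow> real^'m" and p \<tau> \<eta> C :: real and d :: nat
  assumes p: "1 < p" "p < CARD('n)" and \<tau>: "0 < \<tau>"
    and wg: "sphere_weak_gradient p u G"
    and ui: "integrable \<mu> u" and Gi: "integrable \<mu> (\<lambda>y. norm (G y))"
    and \<eta>: "0 < \<eta>" and C: "0 \<le> C" "\<And>a b. 0 \<le> a \<Longrightarrow> 0 \<le> b \<Longrightarrow> (a + b) powr p \<le> (1 + \<eta>) * a powr p + C * b powr p"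
  defines "q \<equiv> sobolev_exponent CARD('n) p"
  defines "v \<equiv> mollify (Suc d) u" and "g \<equiv> mollify (Suc d) (\<lambda>y. norm (G y))"
  shows "(\<integral>x. (bump (x \<bullet> z - \<tau>) * \<bar>v x\<bar>) powr q \<partial>\<mu>) powr (p / q)
    \<le> sobolev_const TYPE(real^'n) p powr p * (1 / \<tau> ^ CARD('m))
       * (\<integral>x. (1 + \<eta>) * (bump (x \<bullet> z - \<tau>) * g x) powr p + C * (2 * \<bar>v x\<bar>) powr p \<partial>\<mu>)"
proof -
  define n where "n = real CARD('n)"
  have q: "q = p * n / (n - p)" by (simp add: q_def sobolev_exponent_def n_def)
  have q0: "0 < q" using p by (simp add: q n_def)
  define K where "K = zonal_const TYPE(real^'m) (Suc d)"
  have K: "0 < K" unfolding K_def by (rule zonal_const_pos)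
  define Dv where "Dv x h = real (Suc d) * zonal d (\<lambda>y. (h \<bullet> y) * u y) x / K" for x h
  have Dv: "(v has_derivative Dv x) (at x)" for x
    using bounded_linear.has_derivative[OF bounded_linear_divide[of K] has_derivative_zonal[OF ui, of "Suc d" x]]
    unfolding v_def mollify_def[abs_def] K_def[symmetric] Dv_def[abs_def] by simp
  have Dvb: "\<bar>Dv x h\<bar> \<le> norm h * g x" if "norm x = 1" "h \<bullet> x = 0" for x h
    using divide_right_mono[OF zonal_gradient_bound[OF wg Gi that, of d], of K] K
    by (simp add: Dv_def g_def mollify_def K_def[symmetric] abs_divide abs_mult)
  have g0: "0 \<le> g x" if "norm x = 1" for x
    unfolding g_def by (intro mollify_nonneg that Gi) simp
  have vc: "continuous_on S v" and gc: "continuous_on S g" for S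
    unfolding v_def g_def by (intro continuous_on_mollify ui Gi)+
  have \<psi>c: "continuous_on UNIV \<psi>"
    by (intro continuous_at_imp_continuous_on ballI has_derivative_continuous[OF has_derivative_\<psi>])
  define s where "s = (gnomonic_scale :: real^'n \<Rightarrow> real)"
  have s: "0 < s y" "s y \<le> 1" for y by (simp_all add: s_def gnomonic_scale_pos gnomonic_scale_le_1)
  have \<psi>s: "\<psi> y \<bullet> z = s y" for y by (simp add: inner_\<psi>_z s_def)
  define b where "b y = bump (s y - \<tau>)" for y
  have b01: "0 \<le> b y" for y by (simp add: b_def bump_nonneg)
  define w where "w y = b y * v (\<psi> y)" for y
  define M where "M y = b y * g (\<psi> y) + 2 * \<bar>v (\<psi> y)\<bar>" for y
  have M0: "0 \<le> M y" for y unfolding M_def using b01[of y] g0[OF norm_\<psi>, of y] by simp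
  define Dw where "Dw y h = b y * Dv (\<psi> y) (d\<psi> y h) + (- (s y ^ 3) * (y \<bullet> h) * bump' (s y - \<tau>)) * v (\<psi> y)" for y h
  have wder: "(w has_derivative Dw y) (at y)" for y
  proof -
    have "((\<lambda>y. s y - \<tau>) has_derivative (\<lambda>h. - (s y ^ 3) * (y \<bullet> h))) (at y)"
      unfolding s_def using has_derivative_diff[OF gnomonic_scale_has_derivative[of y] has_derivative_const[of \<tau>]] by simp
    from DERIV_compose_FDERIV[OF DERIV_bump this]
    have "(b has_derivative (\<lambda>h. - (s y ^ 3) * (y \<bullet> h) * bump' (s y - \<tau>))) (at y)"
      unfolding b_def[abs_def] .
    from has_derivative_mult[OF this has_derivative_compose[OF has_derivative_\<psi> Dv]]
    show ?thesis unfolding w_def[abs_def] Dw_def[abs_def] .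
  qed
  have Dwb: "\<bar>Dw y h\<bar> \<le> norm h * M y" for y h
  proof -
    have "\<bar>b y * Dv (\<psi> y) (d\<psi> y h)\<bar> \<le> norm h * (b y * g (\<psi> y))"
    proof -
      have "\<bar>Dv (\<psi> y) (d\<psi> y h)\<bar> \<le> norm (d\<psi> y h) * g (\<psi> y)"
        by (rule Dvb[OF norm_\<psi> d\<psi>_orthogonal])
      also have "\<dots> \<le> norm h * g (\<psi> y)" by (intro mult_right_mono norm_d\<psi>_le g0 norm_\<psi>)
      finally show ?thesis
        using b01[of y] mult_left_mono[of "\<bar>Dv (\<psi> y) (d\<psi> y h)\<bar>" "norm h * g (\<psi> y)" "b y"]
        by (simp add: abs_mult mult_ac)
    qed
    moreover have "\<bar>(- (s y ^ 3) * (y \<bullet> h) * bump' (s y - \<tau>)) * v (\<psi> y)\<bar> \<le> norm h * (2 * \<bar>v (\<psi> y)\<bar>)"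
    proof -
      \<comment> \<open>The derivative of the scale factor is harmless, as both s and s |y| are at
        most 1.\<close>
      have "s y ^ 3 * \<bar>y \<bullet> h\<bar> \<le> s y ^ 3 * (norm y * norm h)"
        using s[of y] by (intro mult_left_mono Cauchy_Schwarz_ineq2) auto
      also have "\<dots> = (s y)\<^sup>2 * (s y * norm y) * norm h" by (simp add: power2_eq_square power3_eq_cube)
      also have "\<dots> \<le> 1 * 1 * norm h"
        using s[of y] gnomonic_scale_mult_norm_le[of y]
        by (intro mult_right_mono mult_mono) (auto simp: s_def power_le_one)
      finally have 1: "s y ^ 3 * \<bar>y \<bullet> h\<bar> \<le> norm h" by simp
      have "s y ^ 3 * \<bar>y \<bullet> h\<bar> * bump' (s y - \<tau>) \<le> norm h * 2"
        using 1 bump'_bounds(1,2)[of "s y - \<tau>"] by (intro mult_mono) auto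
      then have "s y ^ 3 * \<bar>y \<bullet> h\<bar> * bump' (s y - \<tau>) * \<bar>v (\<psi> y)\<bar> \<le> norm h * 2 * \<bar>v (\<psi> y)\<bar>"
        by (intro mult_right_mono) auto
      then show ?thesis using s[of y] bump'_bounds(1)[of "s y - \<tau>"] by (simp add: abs_mult mult.assoc)
    qed
    ultimately show ?thesis unfolding Dw_def M_def by (simp add: distrib_left)
  qed
  have Dw0: "Dw y h = 0" if "s y \<le> \<tau>" for y h
    using that by (simp add: Dw_def b_def bump_eq_0 bump'_bounds(3))
  have w0: "w y = 0" if "s y \<le> \<tau>" for y using that by (simp add: w_def b_def bump_eq_0)
  \<comment> \<open>From s |y| \<le> 1, the cap s > \<tau> corresponds to a bounded set of the
    chart; this yields the compact support.\<close>
  have far: "s y \<le> \<tau>" if "norm y > 1 / \<tau>" for y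
  proof (rule ccontr)
    assume "\<not> s y \<le> \<tau>"
    then have "\<tau> * norm y \<le> s y * norm y" by (intro mult_right_mono) auto
    also have "\<dots> \<le> 1" using gnomonic_scale_mult_norm_le[of y] by (simp add: s_def)
    finally show False using that \<tau> by (simp add: field_simps)
  qed
  have gradb: "norm (grad w y) \<le> (if \<tau> < s y then M y else 0)" for y
  proof -
    \<comment> \<open>Evaluating the derivative at the gradient itself turns the directional bound
      into a bound on its norm.\<close>
    have e: "(norm (grad w y))\<^sup>2 = Dw y (grad w y)"
      by (simp add: power2_norm_eq_inner grad_eqI[OF wder])
    show ?thesis
    proof (cases "\<tau> < s y")
      case True
      have "norm (grad w y) * norm (grad w y) \<le> norm (grad w y) * M y"
        using e Dwb[of y "grad w y"] by (simp add: power2_eq_square)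
      then have "norm (grad w y) \<le> M y" using M0[of y] by (cases "norm (grad w y) = 0") auto
      with True show ?thesis by simp
    next
      case False
      then show ?thesis using e Dw0[of y] by simp
    qed
  qed
  have test: "w \<in> test_functions"
  proof -
    have "times_cont_diff k w" for k
    proof -
      have "times_cont_diff k (\<lambda>y. s y + - \<tau>)"
        unfolding s_def by (intro times_cont_diff_add times_cont_diff_gnomonic_scale times_cont_diff_const)
      then have "times_cont_diff k b" unfolding b_def[abs_def] bump_def by (intro times_cont_diff_exp_flat) simp
      moreover have "times_cont_diff k (\<lambda>y. zonal (Suc d) u (\<psi> y) * (1 / K))"
        by (intro times_cont_diff_mult times_cont_diff_const times_cont_diff_zonal times_cont_diff_\<psi> ui)
      then have "times_cont_diff k (\<lambda>y. v (\<psi> y))" by (simp add: v_def mollify_def K_def)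
      ultimately show ?thesis unfolding w_def[abs_def] by (rule times_cont_diff_mult)
    qed
    moreover have "closure {y. w y \<noteq> 0} \<subseteq> cball 0 (1 / \<tau>)"
      using w0 far by (intro closure_minimal) (auto simp: not_less[symmetric])
    then have "compact (closure {y. w y \<noteq> 0})"
      by (meson bounded_cball bounded_subset closed_closure compact_eq_bounded_closed)
    ultimately show ?thesis by (simp add: test_functions_def smooth_def)
  qed
  have wc: "continuous_on UNIV w"
    by (intro continuous_at_imp_continuous_on ballI has_derivative_continuous[OF wder])
  define W where "W = (\<integral>y. \<bar>w y\<bar> powr q \<partial>lborel)"
  define P where "P = (\<integral>y. norm (grad w y) powr p \<partial>lborel)"
  have WP0: "0 \<le> W" "0 \<le> P" by (simp_all add: W_def P_def)
  have "integrable lborel (\<lambda>y. \<bar>w y\<bar> powr q)"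
    using q0 w0 far by (intro integrable_lborel_compact_support[where R="1 / \<tau>"] continuous_on_powr' continuous_intros wc) auto
  then have Wnn: "(\<integral>\<^sup>+y. ennreal (\<bar>w y\<bar> powr q) \<partial>lborel) = ennreal W"
    unfolding W_def by (rule nn_integral_eq_integral) simp
  have "integrable lborel (\<lambda>y. norm (grad w y) powr p)"
  proof (rule integrable_lborel_compact_support[where R="1 / \<tau>"])
    show "continuous_on UNIV (\<lambda>y. norm (grad w y) powr p)"
      using p by (intro continuous_on_powr' continuous_intros test_function_grad(2)[OF test]) auto
    fix y :: "real^'n" assume "norm y > 1 / \<tau>"
    then have "norm (grad w y) \<le> 0" using gradb[of y] far[of y] by (auto split: if_splits)
    then show "norm (grad w y) powr p = 0" by simp
  qed
  then have Pnn: "(\<integral>\<^sup>+y. ennreal (norm (grad w y) powr p) \<partial>lborel) = ennreal P"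
    unfolding P_def by (rule nn_integral_eq_integral) simp
  have sob: "W powr (p / q) \<le> sobolev_const TYPE(real^'n) p powr p * P"
    using sobolev_inequality[OF p(1) _ test] p q0 WP0
    by (simp add: lp_norm_def W_def[symmetric] P_def[symmetric] powr_powr q_def[symmetric])
  define F where "F x = (bump (x \<bullet> z - \<tau>) * \<bar>v x\<bar>) powr q" for x
  define A where "A = (\<integral>x. F x \<partial>\<mu>)"
  have Fc: "continuous_on S F" for S
    unfolding F_def using q0 bump_nonneg by (intro continuous_on_powr' continuous_intros vc) auto
  have Fm: "F \<in> borel_measurable borel" by (intro borel_measurable_continuous_onI Fc)
  have F0: "0 \<le> F x" for x by (simp add: F_def)
  have "ennreal A = (\<integral>\<^sup>+x. ennreal (F x) \<partial>\<mu>)"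
    unfolding A_def by (rule nn_integral_eq_integral[symmetric, OF integrable_sphere_continuous[OF Fc]]) (simp add: F0)
  \<comment> \<open>As \<tau> > 0, the bump vanishes off the open hemisphere around
    \<open>z\<close>, so a single chart covers everything that contributes.\<close>
  also have "\<dots> = (\<integral>\<^sup>+x. ennreal (F x) * indicator {x. 0 < x \<bullet> z} x \<partial>\<mu>)"
    using \<tau> q0 by (intro nn_integral_cong) (auto simp: indicator_def F_def bump_eq_0)
  also have "\<dots> = (\<integral>\<^sup>+y. ennreal (F (\<psi> y)) * ennreal (s y ^ CARD('m)) \<partial>lborel)"
    unfolding s_def by (rule nn_integral_chart) (use Fm in measurable)
  also have "\<dots> \<le> (\<integral>\<^sup>+y. ennreal (\<bar>w y\<bar> powr q) \<partial>lborel)"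
  proof (rule nn_integral_mono)
    fix y
    have "F (\<psi> y) = \<bar>w y\<bar> powr q" using b01[of y] by (simp add: F_def w_def \<psi>s b_def abs_mult)
    moreover have "s y ^ CARD('m) \<le> 1" using s[of y] by (intro power_le_one) auto
    ultimately have "F (\<psi> y) * s y ^ CARD('m) \<le> \<bar>w y\<bar> powr q" by (simp add: mult_left_le)
    then show "ennreal (F (\<psi> y)) * ennreal (s y ^ CARD('m)) \<le> ennreal (\<bar>w y\<bar> powr q)"
      by (simp add: ennreal_mult'[symmetric] F0 ennreal_leI)
  qed
  also have "\<dots> = ennreal W" by (rule Wnn)
  finally have AW: "A \<le> W" using WP0 by simp
  have A0: "0 \<le> A" unfolding A_def by (intro integral_nonneg_AE AE_I2 F0)
  define R where "R x = (1 + \<eta>) * (bump (x \<bullet> z - \<tau>) * g x) powr p + C * (2 * \<bar>v x\<bar>) powr p" for x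
  have R0: "0 \<le> R x" for x using \<eta> C(1) by (simp add: R_def)
  have Rint: "integrable \<mu> R"
  proof (rule integrable_sphere_continuous)
    show "continuous_on (sphere 0 1) R"
      unfolding R_def using p bump_nonneg g0
      by (intro continuous_intros continuous_on_powr' vc gc) auto
  qed
  define H where "H x = indicator {x. \<tau> < x \<bullet> z} x * ennreal ((bump (x \<bullet> z - \<tau>) * g x + 2 * \<bar>v x\<bar>) powr p)" for x
  have Hm: "H \<in> borel_measurable borel"
  proof -
    have [measurable]: "g \<in> borel_measurable borel" "v \<in> borel_measurable borel"
      by (intro borel_measurable_continuous_onI vc gc)+
    show ?thesis unfolding H_def by measurable
  qed
  have "ennreal P = (\<integral>\<^sup>+y. ennreal (norm (grad w y) powr p) \<partial>lborel)" by (rule Pnn[symmetric])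
  also have "\<dots> \<le> (\<integral>\<^sup>+y. ennreal (1 / \<tau> ^ CARD('m)) * (H (\<psi> y) * ennreal (s y ^ CARD('m))) \<partial>lborel)"
  proof (rule nn_integral_mono)
    fix y
    show "ennreal (norm (grad w y) powr p) \<le> ennreal (1 / \<tau> ^ CARD('m)) * (H (\<psi> y) * ennreal (s y ^ CARD('m)))"
    proof (cases "\<tau> < s y")
      case True
      have "norm (grad w y) powr p \<le> M y powr p"
        using gradb[of y] True p by (intro powr_mono2) auto
      also have "\<dots> = (1 / \<tau> ^ CARD('m)) * (M y powr p * \<tau> ^ CARD('m))" using \<tau> by simp
      also have "\<dots> \<le> (1 / \<tau> ^ CARD('m)) * (M y powr p * s y ^ CARD('m))"
        using True \<tau> by (intro mult_left_mono power_mono) auto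
      finally have "ennreal (norm (grad w y) powr p) \<le> ennreal ((1 / \<tau> ^ CARD('m)) * (M y powr p * s y ^ CARD('m)))"
        by (rule ennreal_leI)
      also have "\<dots> = ennreal (1 / \<tau> ^ CARD('m)) * (ennreal (M y powr p) * ennreal (s y ^ CARD('m)))"
        using \<tau> s[of y] by (subst ennreal_mult, simp, simp, subst ennreal_mult) auto
      also have "ennreal (M y powr p) = H (\<psi> y)" using True by (simp add: H_def \<psi>s M_def b_def)
      finally show ?thesis .
    next
      case False
      then show ?thesis using gradb[of y] by simp
    qed
  qed
  also have "\<dots> = ennreal (1 / \<tau> ^ CARD('m)) * (\<integral>\<^sup>+y. H (\<psi> y) * ennreal (s y ^ CARD('m)) \<partial>lborel)"
  proof (rule nn_integral_cmult)
    have [measurable]: "\<psi> \<in> borel_measurable borel" "s \<in> borel_measurable borel"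
      unfolding s_def by (intro borel_measurable_continuous_onI \<psi>c times_cont_diff_continuous[OF times_cont_diff_gnomonic_scale[where k=0]])+
    show "(\<lambda>y. H (\<psi> y) * ennreal (s y ^ CARD('m))) \<in> borel_measurable lborel"
      using measurable_compose[OF \<open>\<psi> \<in> borel_measurable borel\<close> Hm]
      by (intro borel_measurable_times_ennreal) auto
  qed
  also have "(\<integral>\<^sup>+y. H (\<psi> y) * ennreal (s y ^ CARD('m)) \<partial>lborel) = (\<integral>\<^sup>+x. H x * indicator {x. 0 < x \<bullet> z} x \<partial>\<mu>)"
    unfolding s_def by (rule nn_integral_chart[OF Hm, symmetric])
  also have "\<dots> \<le> (\<integral>\<^sup>+x. ennreal (R x) \<partial>\<mu>)"
  proof (rule nn_integral_mono)
    fix x :: "real^'m" assume "x \<in> space \<mu>"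
    then have "(bump (x \<bullet> z - \<tau>) * g x + 2 * \<bar>v x\<bar>) powr p \<le> R x"
      unfolding R_def using g0[of x] bump_nonneg by (intro C(2)) auto
    then show "H x * indicator {x. 0 < x \<bullet> z} x \<le> ennreal (R x)"
      by (auto simp: H_def indicator_def ennreal_leI)
  qed
  also have "\<dots> = ennreal (\<integral>x. R x \<partial>\<mu>)"
    by (rule nn_integral_eq_integral[OF Rint]) (simp add: R0)
  finally have "ennreal P \<le> ennreal (1 / \<tau> ^ CARD('m)) * ennreal (\<integral>x. R x \<partial>\<mu>)"
    by (simp add: mult_left_mono)
  also have "\<dots> = ennreal (1 / \<tau> ^ CARD('m) * (\<integral>x. R x \<partial>\<mu>))"
    using \<tau> by (intro ennreal_mult'[symmetric]) simp
  finally have "ennreal P \<le> ennreal (1 / \<tau> ^ CARD('m) * (\<integral>x. R x \<partial>\<mu>))" .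
  moreover have "0 \<le> (\<integral>x. R x \<partial>\<mu>)" by (intro integral_nonneg_AE AE_I2 R0)
  ultimately have PR: "P \<le> 1 / \<tau> ^ CARD('m) * (\<integral>x. R x \<partial>\<mu>)"
    using \<tau> by (subst (asm) ennreal_le_iff) auto
  have "A powr (p / q) \<le> W powr (p / q)" using AW A0 p q0 by (intro powr_mono2) auto
  also note sob
  also have "sobolev_const TYPE(real^'n) p powr p * P
    \<le> sobolev_const TYPE(real^'n) p powr p * (1 / \<tau> ^ CARD('m) * (\<integral>x. R x \<partial>\<mu>))"
    by (intro mult_left_mono PR) auto
  finally show ?thesis unfolding A_def F_def R_def by (simp only: mult.assoc)
qed

end

lemma in_Lp_imp_integrable:
  fixes f :: "'a::euclidean_space \<Rightarrow> 'b::euclidean_space"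
  assumes "in_Lp \<mu> p f" "1 < p"
  shows "integrable \<mu> (\<lambda>x. norm (f x))"
proof -
  interpret finite_measure "\<mu> :: 'a measure" by (rule finite_sphere_measure)
  have [measurable]: "f \<in> borel_measurable \<mu>" and i: "integrable \<mu> (\<lambda>x. norm (f x) powr p)"
    using assms by (auto simp: in_Lp_def)
  show ?thesis
  proof (rule Bochner_Integration.integrable_bound)
    show "integrable \<mu> (\<lambda>x. 1 + norm (f x) powr p)" using i by simp
    have "t \<le> 1 + t powr p" if "0 \<le> t" for t :: real
    proof (cases "t \<le> 1")
      case False
      then have "t powr 1 \<le> t powr p" using assms by (intro powr_mono) auto
      then show ?thesis using False by simp
    qed (simp add: add_increasing2)
    then show "AE x in \<mu>. norm (norm (f x)) \<le> norm (1 + norm (f x) powr p)" by simp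
  qed measurable
qed

section \<open>Passage to weakly differentiable functions\<close>

context gnomonic_chart
begin

text \<open>\<open>local_sobolev\<close> is applied to mollifications of \<open>u\<close>. On the
  right, Jensen's inequality bounds the p-th power of the mollified gradient norm by the mollified
  p-th power, and self-adjointness moves the mollifier to \<Phi> = \<phi>^p, where the error is
  uniformly at most e. On the left, Fatou's lemma along an almost everywhere convergent subsequence
  gives both the integrability of (\<phi> |u|)^q and the bound.\<close>

lemma local_sobolev_W1:
  fixes u :: "real^'m \<Rightarrow> real" and G :: "real^'m \<Rightarrow> real^'m" and p \<tau> \<eta> C :: real
  assumes p: "1 < p" "p < CARD('n)" and \<tau>: "0 < \<tau>"
    and wg: "sphere_weak_gradient p u G" and uL: "in_Lp \<mu> p u"
    and \<eta>: "0 < \<eta>" and C: "0 \<le> C" "\<And>a b. 0 \<le> a \<Longrightarrow> 0 \<le> b \<Longrightarrow> (a + b) powr p \<le> (1 + \<eta>) * a powr p + C * b powr p"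
  defines "q \<equiv> sobolev_exponent CARD('n) p" and "S \<equiv> sobolev_const TYPE(real^'n) p powr p * (1 / \<tau> ^ CARD('m))"
  shows "integrable \<mu> (\<lambda>x. (bump (x \<bullet> z - \<tau>) * \<bar>u x\<bar>) powr q)" (is ?A)
    and "(\<integral>x. (bump (x \<bullet> z - \<tau>) * \<bar>u x\<bar>) powr q \<partial>\<mu>) powr (p / q)
    \<le> S * (1 + \<eta>) * (\<integral>x. bump (x \<bullet> z - \<tau>) powr p * norm (G x) powr p \<partial>\<mu>)
      + S * C * 2 powr p * (\<integral>x. \<bar>u x\<bar> powr p \<partial>\<mu>)" (is ?B)
proof -
  interpret finite_measure "\<mu> :: (real^'m) measure" by (rule finite_sphere_measure)
  define n where "n = real CARD('n)"
  have q: "q = p * n / (n - p)" by (simp add: q_def sobolev_exponent_def n_def)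
  have q0: "0 < q" using p by (simp add: q n_def)
  have S0: "0 \<le> S" using \<tau> by (simp add: S_def)
  have GL: "in_Lp \<mu> p G" using wg by (simp add: sphere_weak_gradient_def)
  have um [measurable]: "u \<in> borel_measurable \<mu>" and up: "integrable \<mu> (\<lambda>x. \<bar>u x\<bar> powr p)"
    using uL by (auto simp: in_Lp_def)
  have Gp: "integrable \<mu> (\<lambda>x. norm (G x) powr p)" using GL by (simp add: in_Lp_def)
  have ua: "integrable \<mu> (\<lambda>x. \<bar>u x\<bar>)" using in_Lp_imp_integrable[OF uL p(1)] by simp
  have ui: "integrable \<mu> u" by (rule integrable_abs_cancel[OF ua um])
  have Gi: "integrable \<mu> (\<lambda>x. norm (G x))" by (rule in_Lp_imp_integrable[OF GL p(1)])
  define \<phi> where "\<phi> x = bump (x \<bullet> z - \<tau>)" for x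
  have \<phi>: "0 \<le> \<phi> x" for x by (simp add: \<phi>_def bump_nonneg)
  define \<Phi> where "\<Phi> x = \<phi> x powr p" for x
  have \<phi>c: "continuous_on T \<phi>" for T unfolding \<phi>_def by (intro continuous_intros)
  have \<Phi>c: "continuous_on T \<Phi>" for T unfolding \<Phi>_def using p \<phi> by (intro continuous_on_powr' \<phi>c continuous_intros) auto
  have [measurable]: "\<phi> \<in> borel_measurable \<mu>"
    by (intro borel_measurable_sphere_measure borel_measurable_continuous_onI \<phi>c)
  define U where "U = (\<integral>x. \<bar>u x\<bar> powr p \<partial>\<mu>)"
  define P where "P = (\<integral>x. norm (G x) powr p \<partial>\<mu>)"
  define Q where "Q = (\<integral>x. \<Phi> x * norm (G x) powr p \<partial>\<mu>)"
  have UPQ: "0 \<le> U" "0 \<le> P" "0 \<le> Q" by (simp_all add: U_def P_def Q_def \<Phi>_def)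
  define R where "R = S * (1 + \<eta>) * Q + S * C * 2 powr p * U"
  have R0: "0 \<le> R" unfolding R_def using S0 \<eta> C(1) UPQ by simp
  obtain r where r: "strict_mono r" "AE x in \<mu>. (\<lambda>i. mollify (r i) u x) \<longlonglongrightarrow> u x"
    using mollify_AE_subseq[OF ui] by blast
  define v where "v i = mollify (r i) u" for i
  have vc: "continuous_on T (v i)" for T i unfolding v_def by (rule continuous_on_mollify[OF ui])
  have [measurable]: "v i \<in> borel_measurable \<mu>" for i
    by (intro borel_measurable_sphere_measure borel_measurable_continuous_onI vc)
  define A where "A i = (\<integral>x. (\<phi> x * \<bar>v i x\<bar>) powr q \<partial>\<mu>)" for i
  have A0: "0 \<le> A i" for i by (simp add: A_def)
  have Aint: "integrable \<mu> (\<lambda>x. (\<phi> x * \<bar>v i x\<bar>) powr q)" for i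
    using q0 \<phi> by (intro integrable_sphere_continuous continuous_on_powr' continuous_intros \<phi>c vc) auto
  have step: "A i powr (p / q) \<le> R + S * (1 + \<eta>) * e * P"
    if e: "0 < e" and D: "\<And>d x. D \<le> d \<Longrightarrow> x \<in> sphere 0 1 \<Longrightarrow> \<bar>mollify d \<Phi> x - \<Phi> x\<bar> \<le> e" and i: "i \<ge> Suc D" for e D i
  proof -
    \<comment> \<open>A strictly increasing sequence satisfies i \<le> r i, so from
      \<open>Suc D\<close> on the degree is a successor and at least \<open>D\<close>.\<close>
    have "i \<le> r i" by (rule seq_suble[OF r(1)])
    then obtain d where d: "r i = Suc d" "D \<le> r i" using i by (cases "r i") auto
    define g where "g = mollify (r i) (\<lambda>y. norm (G y))"
    have g0: "0 \<le> g x" if "norm x = 1" for x unfolding g_def by (intro mollify_nonneg that Gi) simp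
    have gc: "continuous_on T g" for T unfolding g_def by (rule continuous_on_mollify[OF Gi])
    have i1: "integrable \<mu> (\<lambda>x. (\<phi> x * g x) powr p)"
      using p \<phi> g0 by (intro integrable_sphere_continuous continuous_on_powr' continuous_intros \<phi>c gc) auto
    have i2: "integrable \<mu> (\<lambda>x. (2 * \<bar>v i x\<bar>) powr p)"
      using p by (intro integrable_sphere_continuous continuous_on_powr' continuous_intros vc) auto
    have "A i powr (p / q) \<le> S * (\<integral>x. (1 + \<eta>) * (\<phi> x * g x) powr p + C * (2 * \<bar>v i x\<bar>) powr p \<partial>\<mu>)"
      using local_sobolev[OF p \<tau> wg ui Gi \<eta> C, of d]
      unfolding A_def \<phi>_def v_def g_def d(1) q_def S_def by simp
    also have "(\<integral>x. (1 + \<eta>) * (\<phi> x * g x) powr p + C * (2 * \<bar>v i x\<bar>) powr p \<partial>\<mu>)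
       = (1 + \<eta>) * (\<integral>x. (\<phi> x * g x) powr p \<partial>\<mu>) + C * (\<integral>x. (2 * \<bar>v i x\<bar>) powr p \<partial>\<mu>)"
      using i1 i2 by simp
    also have "\<dots> \<le> (1 + \<eta>) * (Q + e * P) + C * (2 powr p * U)"
    proof (intro add_mono mult_left_mono)
      have "(\<integral>x. (\<phi> x * g x) powr p \<partial>\<mu>) \<le> (\<integral>x. \<Phi> x * mollify (r i) (\<lambda>y. norm (G y) powr p) x \<partial>\<mu>)"
      proof (rule integral_mono[OF i1])
        show "integrable \<mu> (\<lambda>x. \<Phi> x * mollify (r i) (\<lambda>y. norm (G y) powr p) x)"
          by (intro integrable_sphere_continuous continuous_intros \<Phi>c continuous_on_mollify Gp)
        fix x :: "real^'m" assume "x \<in> space \<mu>"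
        then have x: "norm x = 1" by simp
        have "(\<phi> x * g x) powr p = \<Phi> x * g x powr p" unfolding \<Phi>_def by (rule powr_mult)
        also have "\<dots> \<le> \<Phi> x * mollify (r i) (\<lambda>y. norm (G y) powr p) x"
          unfolding g_def by (intro mult_left_mono mollify_powr_le x p Gi Gp) (auto simp: \<Phi>_def)
        finally show "(\<phi> x * g x) powr p \<le> \<Phi> x * mollify (r i) (\<lambda>y. norm (G y) powr p) x" .
      qed
      also have "\<dots> = (\<integral>x. mollify (r i) \<Phi> x * norm (G x) powr p \<partial>\<mu>)"
        by (rule mollify_symmetric[symmetric, OF integrable_sphere_continuous[OF \<Phi>c] Gp])
      also have "\<dots> \<le> (\<integral>x. \<Phi> x * norm (G x) powr p + e * norm (G x) powr p \<partial>\<mu>)"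
      proof (rule integral_mono)
        show "integrable \<mu> (\<lambda>x. mollify (r i) \<Phi> x * norm (G x) powr p)"
          by (intro integrable_sphere_mult continuous_on_mollify integrable_sphere_continuous \<Phi>c Gp)
        show "integrable \<mu> (\<lambda>x. \<Phi> x * norm (G x) powr p + e * norm (G x) powr p)"
          by (intro Bochner_Integration.integrable_add integrable_sphere_mult \<Phi>c Gp integrable_mult_right)
        fix x :: "real^'m" assume "x \<in> space \<mu>"
        then have "mollify (r i) \<Phi> x \<le> \<Phi> x + e" using D[OF d(2), of x] by auto
        then show "mollify (r i) \<Phi> x * norm (G x) powr p \<le> \<Phi> x * norm (G x) powr p + e * norm (G x) powr p"
          unfolding distrib_right[symmetric] by (intro mult_right_mono) auto
      qed
      also have "\<dots> = Q + e * P"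
        unfolding Q_def P_def
        by (subst Bochner_Integration.integral_add) (auto intro!: integrable_sphere_mult \<Phi>c Gp)
      finally show "(\<integral>x. (\<phi> x * g x) powr p \<partial>\<mu>) \<le> Q + e * P" .
      have "(\<integral>x. (2 * \<bar>v i x\<bar>) powr p \<partial>\<mu>) \<le> (\<integral>x. 2 powr p * mollify (r i) (\<lambda>y. \<bar>u y\<bar> powr p) x \<partial>\<mu>)"
      proof (rule integral_mono[OF i2])
        show "integrable \<mu> (\<lambda>x. 2 powr p * mollify (r i) (\<lambda>y. \<bar>u y\<bar> powr p) x)"
          by (intro integrable_mult_right integrable_sphere_continuous continuous_on_mollify up)
        fix x :: "real^'m" assume "x \<in> space \<mu>"
        then have x: "norm x = 1" by simp
        have "\<bar>v i x\<bar> powr p \<le> (mollify (r i) (\<lambda>y. \<bar>u y\<bar>) x) powr p"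
          unfolding v_def using p by (intro powr_mono2 abs_mollify_le x ui) auto
        also have "\<dots> \<le> mollify (r i) (\<lambda>y. \<bar>u y\<bar> powr p) x"
          by (intro mollify_powr_le x p ua up) auto
        finally show "(2 * \<bar>v i x\<bar>) powr p \<le> 2 powr p * mollify (r i) (\<lambda>y. \<bar>u y\<bar> powr p) x"
          by (simp add: powr_mult)
      qed
      also have "\<dots> = 2 powr p * U" using integral_mollify[OF up, of "r i"] by (simp add: U_def)
      finally show "(\<integral>x. (2 * \<bar>v i x\<bar>) powr p \<partial>\<mu>) \<le> 2 powr p * U" .
    qed (use \<eta> C in auto)
    finally have "A i powr (p / q) \<le> S * ((1 + \<eta>) * (Q + e * P) + C * (2 powr p * U))"
      using S0 by (simp add: mult_left_mono)
    then show ?thesis by (simp add: R_def algebra_simps)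
  qed
  have fatou: "(\<integral>\<^sup>+x. ennreal ((\<phi> x * \<bar>u x\<bar>) powr q) \<partial>\<mu>) \<le> ennreal ((R + S * (1 + \<eta>) * e * P) powr (q / p))"
    if e: "0 < e" for e
  proof -
    obtain D where D: "\<And>d x. D \<le> d \<Longrightarrow> x \<in> sphere 0 1 \<Longrightarrow> \<bar>mollify d \<Phi> x - \<Phi> x\<bar> \<le> e"
      using mollify_uniform_limit[OF \<Phi>c e] by blast
    have Ab: "A i \<le> (R + S * (1 + \<eta>) * e * P) powr (q / p)" if "i \<ge> Suc D" for i
    proof -
      have "(A i powr (p / q)) powr (q / p) \<le> (R + S * (1 + \<eta>) * e * P) powr (q / p)"
        using step[OF e D that] p q0 by (intro powr_mono2) auto
      then show ?thesis using p q0 A0[of i] by (simp add: powr_powr)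
    qed
    have "(\<integral>\<^sup>+x. ennreal ((\<phi> x * \<bar>u x\<bar>) powr q) \<partial>\<mu>)
       = (\<integral>\<^sup>+x. liminf (\<lambda>i. ennreal ((\<phi> x * \<bar>v i x\<bar>) powr q)) \<partial>\<mu>)"
    proof (rule nn_integral_cong_AE)
      show "AE x in \<mu>. ennreal ((\<phi> x * \<bar>u x\<bar>) powr q) = liminf (\<lambda>i. ennreal ((\<phi> x * \<bar>v i x\<bar>) powr q))"
        using r(2)
      proof eventually_elim
        case (elim x)
        have "(\<lambda>i. (\<phi> x * \<bar>v i x\<bar>) powr q) \<longlonglongrightarrow> (\<phi> x * \<bar>u x\<bar>) powr q"
          using elim q0 \<phi> unfolding v_def by (intro tendsto_powr' tendsto_intros) auto
        then have "(\<lambda>i. ennreal ((\<phi> x * \<bar>v i x\<bar>) powr q)) \<longlonglongrightarrow> ennreal ((\<phi> x * \<bar>u x\<bar>) powr q)"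
          by (rule tendsto_ennrealI)
        from lim_imp_Liminf[OF _ this] show ?case by simp
      qed
    qed
    also have "\<dots> \<le> liminf (\<lambda>i. \<integral>\<^sup>+x. ennreal ((\<phi> x * \<bar>v i x\<bar>) powr q) \<partial>\<mu>)"
      by (rule nn_integral_liminf) measurable
    also have "(\<lambda>i. \<integral>\<^sup>+x. ennreal ((\<phi> x * \<bar>v i x\<bar>) powr q) \<partial>\<mu>) = (\<lambda>i. ennreal (A i))"
      unfolding A_def by (intro ext nn_integral_eq_integral Aint) simp
    also have "liminf (\<lambda>i. ennreal (A i)) \<le> limsup (\<lambda>i. ennreal (A i))" by (rule Liminf_le_Limsup) simp
    also have "\<dots> \<le> ennreal ((R + S * (1 + \<eta>) * e * P) powr (q / p))"
      by (rule Limsup_bounded) (auto simp: eventually_sequentially intro!: exI[of _ "Suc D"] ennreal_leI Ab)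
    finally show ?thesis .
  qed
  have fm: "(\<lambda>x. (\<phi> x * \<bar>u x\<bar>) powr q) \<in> borel_measurable \<mu>" by measurable
  have int: "integrable \<mu> (\<lambda>x. (\<phi> x * \<bar>u x\<bar>) powr q)"
    using fatou[of 1] by (intro integrableI_nonneg fm) (auto intro: le_less_trans)
  then show ?A unfolding \<phi>_def .
  define I where "I = (\<integral>x. (\<phi> x * \<bar>u x\<bar>) powr q \<partial>\<mu>)"
  have I0: "0 \<le> I" by (simp add: I_def)
  have Inn: "(\<integral>\<^sup>+x. ennreal ((\<phi> x * \<bar>u x\<bar>) powr q) \<partial>\<mu>) = ennreal I"
    unfolding I_def by (rule nn_integral_eq_integral[OF int]) simp
  have "I powr (p / q) \<le> R + e" if e: "0 < e" for e
  proof -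
    \<comment> \<open>The summand 1 in the denominator covers the case that the coefficient of the
      error vanishes.\<close>
    define e' where "e' = e / (S * (1 + \<eta>) * P + 1)"
    have den: "0 < S * (1 + \<eta>) * P + 1" using S0 \<eta> UPQ by (simp add: add_nonneg_pos)
    have e': "0 < e'" using e den by (simp add: e'_def)
    have "S * (1 + \<eta>) * e' * P \<le> (S * (1 + \<eta>) * P + 1) * e'" using e' by (simp add: algebra_simps)
    also have "\<dots> = e" using den by (simp add: e'_def)
    finally have le: "S * (1 + \<eta>) * e' * P \<le> e" .
    have T0: "0 \<le> S * (1 + \<eta>) * e' * P" using S0 \<eta> e' UPQ by simp
    have "I \<le> (R + S * (1 + \<eta>) * e' * P) powr (q / p)"
      using fatou[OF e'] unfolding Inn by simp
    then have "I powr (p / q) \<le> ((R + S * (1 + \<eta>) * e' * P) powr (q / p)) powr (p / q)"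
      using I0 p q0 by (intro powr_mono2) auto
    also have "\<dots> = R + S * (1 + \<eta>) * e' * P" using p q0 R0 T0 by (simp add: powr_powr)
    also have "\<dots> \<le> R + e" using le by simp
    finally show ?thesis .
  qed
  then have "I powr (p / q) \<le> R" by (rule field_le_epsilon)
  then show ?B unfolding I_def R_def Q_def U_def \<Phi>_def \<phi>_def .
qed

end

section \<open>Hoelder's inequality and quadratic test polynomials\<close>

text \<open>Hoelder's inequality for exponents 1/\<alpha> and 1/\<beta>. After division by the two
  integrals it is the pointwise Young inequality; if one of the integrals is 0, the corresponding
  function vanishes almost everywhere.\<close>

lemma holder_two:
  fixes F H :: "'a \<Rightarrow> real"
  assumes F: "integrable M F" "\<And>x. 0 \<le> F x" and H: "integrable M H" "\<And>x. 0 \<le> H x"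
    and \<alpha>: "0 < \<alpha>" "0 < \<beta>" "\<alpha> + \<beta> = 1"
  shows "integrable M (\<lambda>x. F x powr \<alpha> * H x powr \<beta>)"
    and "(\<integral>x. F x powr \<alpha> * H x powr \<beta> \<partial>M) \<le> (\<integral>x. F x \<partial>M) powr \<alpha> * (\<integral>x. H x \<partial>M) powr \<beta>"
proof -
  have young: "a powr \<alpha> * b powr \<beta> \<le> \<alpha> * a + \<beta> * b" if "0 \<le> a" "0 \<le> b" for a b :: real
    using Youngs_inequality_0[of \<alpha> \<beta> a b] that \<alpha> by (cases "a = 0 \<or> b = 0") auto
  have [measurable]: "F \<in> borel_measurable M" "H \<in> borel_measurable M"
    using F(1) H(1) by auto
  show int: "integrable M (\<lambda>x. F x powr \<alpha> * H x powr \<beta>)"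
  proof (rule Bochner_Integration.integrable_bound)
    show "integrable M (\<lambda>x. \<alpha> * F x + \<beta> * H x)" using F(1) H(1) by simp
    show "AE x in M. norm (F x powr \<alpha> * H x powr \<beta>) \<le> norm (\<alpha> * F x + \<beta> * H x)"
    proof (rule AE_I2)
      fix x
      show "norm (F x powr \<alpha> * H x powr \<beta>) \<le> norm (\<alpha> * F x + \<beta> * H x)"
        using young[OF F(2) H(2), of x x] by simp
    qed
  qed measurable
  define A where "A = (\<integral>x. F x \<partial>M)"
  define B where "B = (\<integral>x. H x \<partial>M)"
  have AB0: "0 \<le> A" "0 \<le> B" unfolding A_def B_def using F(2) H(2) by (auto intro!: integral_nonneg_AE)
  show "(\<integral>x. F x powr \<alpha> * H x powr \<beta> \<partial>M) \<le> (\<integral>x. F x \<partial>M) powr \<alpha> * (\<integral>x. H x \<partial>M) powr \<beta>"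
  proof (cases "A = 0 \<or> B = 0")
    case True
    have "AE x in M. F x powr \<alpha> * H x powr \<beta> = 0"
    proof (cases "A = 0")
      case True
      then have "AE x in M. F x = 0"
        using integral_nonneg_eq_0_iff_AE[OF F(1)] F(2) by (auto simp: A_def)
      then show ?thesis by eventually_elim simp
    next
      case False
      with True have "AE x in M. H x = 0"
        using integral_nonneg_eq_0_iff_AE[OF H(1)] H(2) by (auto simp: B_def)
      then show ?thesis by eventually_elim simp
    qed
    then have "(\<integral>x. F x powr \<alpha> * H x powr \<beta> \<partial>M) = (\<integral>x. 0 \<partial>M)"
      by (intro integral_cong_AE) auto
    then show ?thesis by simp
  next
    case False
    then have AB: "0 < A" "0 < B" using AB0 by auto
    have pw: "(F x / A) powr \<alpha> * (H x / B) powr \<beta> = (F x powr \<alpha> * H x powr \<beta>) / (A powr \<alpha> * B powr \<beta>)" for x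
      using AB F(2) H(2) by (simp add: powr_divide)
    have "(\<integral>x. F x powr \<alpha> * H x powr \<beta> \<partial>M) / (A powr \<alpha> * B powr \<beta>) = (\<integral>x. (F x / A) powr \<alpha> * (H x / B) powr \<beta> \<partial>M)"
      unfolding pw by (rule Bochner_Integration.integral_divide_zero[symmetric])
    also have "\<dots> \<le> (\<integral>x. \<alpha> * (F x / A) + \<beta> * (H x / B) \<partial>M)"
    proof (rule integral_mono)
      show "integrable M (\<lambda>x. (F x / A) powr \<alpha> * (H x / B) powr \<beta>)"
        unfolding pw using int by (rule Bochner_Integration.integrable_divide)
      show "integrable M (\<lambda>x. \<alpha> * (F x / A) + \<beta> * (H x / B))" using F(1) H(1) by simp
      show "(F x / A) powr \<alpha> * (H x / B) powr \<beta> \<le> \<alpha> * (F x / A) + \<beta> * (H x / B)" for x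
        using AB F(2) H(2) by (intro young) auto
    qed
    also have "\<dots> = \<alpha> * (A / A) + \<beta> * (B / B)"
      using F(1) H(1) by (simp add: A_def B_def)
    also have "\<dots> = 1" using AB \<alpha> by simp
    finally show ?thesis using AB unfolding A_def[symmetric] B_def[symmetric] by (simp add: divide_le_eq)
  qed
qed

section \<open>Polynomials of degree at most two\<close>

lemma polys_upto_add: "f \<in> polys_upto k \<Longrightarrow> g \<in> polys_upto k \<Longrightarrow> (\<lambda>x. f x + g x) \<in> polys_upto k"
proof -
  assume "f \<in> polys_upto k" "g \<in> polys_upto k"
  then obtain c d where
    "f = (\<lambda>x. \<Sum>\<alpha> | \<alpha> \<in> Basis \<rightarrow>\<^sub>E {..k} \<and> sum \<alpha> Basis \<le> k. c \<alpha> * (\<Prod>b\<in>Basis. (x \<bullet> b) ^ \<alpha> b))"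
    "g = (\<lambda>x. \<Sum>\<alpha> | \<alpha> \<in> Basis \<rightarrow>\<^sub>E {..k} \<and> sum \<alpha> Basis \<le> k. d \<alpha> * (\<Prod>b\<in>Basis. (x \<bullet> b) ^ \<alpha> b))"
    unfolding polys_upto_def by blast
  then show ?thesis
    unfolding polys_upto_def
    by (intro CollectI exI[of _ "\<lambda>\<alpha>. c \<alpha> + d \<alpha>"]) (simp add: sum.distrib distrib_right)
qed

lemma polys_upto_scale: "f \<in> polys_upto k \<Longrightarrow> (\<lambda>x. r * f x) \<in> polys_upto k"
proof -
  assume "f \<in> polys_upto k"
  then obtain c where
    "f = (\<lambda>x. \<Sum>\<alpha> | \<alpha> \<in> Basis \<rightarrow>\<^sub>E {..k} \<and> sum \<alpha> Basis \<le> k. c \<alpha> * (\<Prod>b\<in>Basis. (x \<bullet> b) ^ \<alpha> b))"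
    unfolding polys_upto_def by blast
  then show ?thesis
    unfolding polys_upto_def
    by (intro CollectI exI[of _ "\<lambda>\<alpha>. r * c \<alpha>"]) (simp add: sum_distrib_left mult.assoc)
qed

lemma polys_upto_monomial:
  fixes \<alpha> :: "'a::euclidean_space \<Rightarrow> nat"
  assumes "\<alpha> \<in> Basis \<rightarrow>\<^sub>E {..k}" "sum \<alpha> Basis \<le> k"
  shows "(\<lambda>x::'a. \<Prod>b\<in>Basis. (x \<bullet> b) ^ \<alpha> b) \<in> polys_upto k"
proof -
  define Al where "Al = {\<alpha>. \<alpha> \<in> (Basis :: 'a set) \<rightarrow>\<^sub>E {..k} \<and> sum \<alpha> Basis \<le> k}"
  have fin: "finite Al"
    by (rule finite_subset[of _ "(Basis :: 'a set) \<rightarrow>\<^sub>E {..k}"]) (auto simp: Al_def intro: finite_PiE)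
  have "\<alpha> \<in> Al" using assms by (simp add: Al_def)
  have "(\<Prod>b\<in>Basis. (x \<bullet> b) ^ \<alpha> b) = (\<Sum>\<beta>\<in>Al. (if \<beta> = \<alpha> then 1 else 0) * (\<Prod>b\<in>Basis. (x \<bullet> b) ^ \<beta> b))" for x :: 'a
  proof -
    have "(\<Sum>\<beta>\<in>Al. (if \<beta> = \<alpha> then 1 else 0) * (\<Prod>b\<in>Basis. (x \<bullet> b) ^ \<beta> b)) = (\<Sum>\<beta>\<in>Al. if \<beta> = \<alpha> then (\<Prod>b\<in>Basis. (x \<bullet> b) ^ \<beta> b) else 0)"
      by (intro sum.cong) auto
    also have "\<dots> = (\<Prod>b\<in>Basis. (x \<bullet> b) ^ \<alpha> b)" using fin \<open>\<alpha> \<in> Al\<close> by (simp add: sum.delta)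
    finally show ?thesis by simp
  qed
  then show ?thesis unfolding polys_upto_def Al_def
    by (intro CollectI exI[of _ "\<lambda>\<beta>. if \<beta> = \<alpha> then 1 else 0"]) (rule ext)
qed

lemma polys_upto_const: "(\<lambda>x::'a::euclidean_space. r) \<in> polys_upto k"
proof -
  \<comment> \<open>Restricted to \<open>Basis\<close>, since multi-indices are taken from an
    extensional function space.\<close>
  define \<alpha> :: "'a \<Rightarrow> nat" where "\<alpha> = (\<lambda>b\<in>Basis. 0)"
  have "sum \<alpha> Basis = 0" by (intro sum.neutral) (auto simp: \<alpha>_def)
  then have "(\<lambda>x::'a. \<Prod>b\<in>Basis. (x \<bullet> b) ^ \<alpha> b) \<in> polys_upto k"
    by (intro polys_upto_monomial) (auto simp: \<alpha>_def)
  moreover have "(\<Prod>b\<in>Basis. (x \<bullet> b) ^ \<alpha> b) = 1" for x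
    by (intro prod.neutral) (auto simp: \<alpha>_def)
  ultimately show ?thesis using polys_upto_scale[of "\<lambda>x. 1" k r] by simp
qed

lemma prod_Basis_power_delta:
  "b0 \<in> Basis \<Longrightarrow> (\<Prod>b\<in>Basis. (x \<bullet> b) ^ (if b = b0 then 1 else 0)) = x \<bullet> (b0::'a::euclidean_space)"
proof -
  assume b0: "b0 \<in> Basis"
  have "(\<Prod>b\<in>Basis. (x \<bullet> b) ^ (if b = b0 then 1 else 0)) = (\<Prod>b\<in>Basis. if b = b0 then x \<bullet> b else 1)"
    by (intro prod.cong) auto
  then show ?thesis using b0 by (simp add: prod.delta)
qed

lemma polys_upto_quadratic:
  fixes b0 b1 :: "'a::euclidean_space"
  assumes "b0 \<in> Basis" "b1 \<in> Basis"
  shows "(\<lambda>x. (x \<bullet> b0) * (x \<bullet> b1)) \<in> polys_upto 2"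
proof -
  define \<alpha> :: "'a \<Rightarrow> nat" where "\<alpha> = (\<lambda>b\<in>Basis. (if b = b0 then 1 else 0) + (if b = b1 then 1 else 0))"
  have "sum \<alpha> Basis = (\<Sum>b\<in>Basis. (if b = b0 then 1 else 0) + (if b = b1 then 1 else 0))"
    by (intro sum.cong) (auto simp: \<alpha>_def)
  also have "\<dots> = 2" using assms by (simp only: sum.distrib) (simp add: sum.delta)
  finally have "(\<lambda>x::'a. \<Prod>b\<in>Basis. (x \<bullet> b) ^ \<alpha> b) \<in> polys_upto 2"
    by (intro polys_upto_monomial) (auto simp: \<alpha>_def)
  moreover have "(\<Prod>b\<in>Basis. (x \<bullet> b) ^ \<alpha> b) = (x \<bullet> b0) * (x \<bullet> b1)" for x
  proof -
    have "(\<Prod>b\<in>Basis. (x \<bullet> b) ^ \<alpha> b) = (\<Prod>b\<in>Basis. (x \<bullet> b) ^ (if b = b0 then 1 else 0) * (x \<bullet> b) ^ (if b = b1 then 1 else 0))"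
      by (intro prod.cong) (auto simp: \<alpha>_def)
    then show ?thesis by (simp only: prod.distrib prod_Basis_power_delta[OF assms(1)] prod_Basis_power_delta[OF assms(2)])
  qed
  ultimately show ?thesis by simp
qed

lemma polys_upto_linear:
  fixes b0 :: "'a::euclidean_space"
  assumes "b0 \<in> Basis"
  shows "(\<lambda>x. x \<bullet> b0) \<in> polys_upto 2"
proof -
  define \<alpha> :: "'a \<Rightarrow> nat" where "\<alpha> = (\<lambda>b\<in>Basis. if b = b0 then 1 else 0)"
  have "sum \<alpha> Basis = (\<Sum>b\<in>Basis. if b = b0 then 1 else 0)"
    by (intro sum.cong) (auto simp: \<alpha>_def)
  also have "\<dots> = 1" using assms by (simp add: sum.delta)
  finally have "(\<lambda>x::'a. \<Prod>b\<in>Basis. (x \<bullet> b) ^ \<alpha> b) \<in> polys_upto 2"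
    by (intro polys_upto_monomial) (auto simp: \<alpha>_def)
  moreover have "(\<Prod>b\<in>Basis. (x \<bullet> b) ^ \<alpha> b) = x \<bullet> b0" for x
    unfolding prod_Basis_power_delta[OF assms, symmetric] by (intro prod.cong) (auto simp: \<alpha>_def)
  ultimately show ?thesis by simp
qed

lemma polys_upto_sum:
  assumes "\<And>i. i \<in> I \<Longrightarrow> f i \<in> polys_upto k"
  shows "(\<lambda>x. \<Sum>i\<in>I. f i x) \<in> polys_upto k"
  using assms by (induction I rule: infinite_finite_induct) (auto intro: polys_upto_const polys_upto_add)

text \<open>By the first two moments of the sphere, a^2 + 1/(n+1) is the mean of (a + x.z)^2;
  membership in the polynomial space is an expansion in coordinates.\<close>

lemma mean_zero_polys_zonal:
  fixes z :: "real^'m" and a :: real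
  assumes z: "norm z = 1"
  shows "(\<lambda>x. (a + x \<bullet> z)\<^sup>2 - (a\<^sup>2 + 1 / CARD('m))) \<in> mean_zero_polys 2"
proof -
  interpret finite_measure "\<mu> :: (real^'m) measure" by (rule finite_sphere_measure)
  define k where "k = a\<^sup>2 + 1 / CARD('m)"
  have e: "x \<bullet> z = (\<Sum>b\<in>Basis. (z \<bullet> b) * (x \<bullet> b))" for x :: "real^'m"
    by (subst euclidean_inner) (simp add: mult.commute)
  have expand: "(\<lambda>x. (a + x \<bullet> z)\<^sup>2 - k) = (\<lambda>x. (a\<^sup>2 - k) + ((\<Sum>b\<in>Basis. (2 * a * (z \<bullet> b)) * (x \<bullet> b))
      + (\<Sum>b\<in>Basis. \<Sum>c\<in>Basis. ((z \<bullet> b) * (z \<bullet> c)) * ((x \<bullet> b) * (x \<bullet> c)))))"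
  proof
    fix x :: "real^'m"
    have "(x \<bullet> z)\<^sup>2 = (\<Sum>b\<in>Basis. \<Sum>c\<in>Basis. ((z \<bullet> b) * (z \<bullet> c)) * ((x \<bullet> b) * (x \<bullet> c)))"
      unfolding e power2_eq_square sum_product by (intro sum.cong refl) (simp add: mult_ac)
    moreover have "2 * a * (x \<bullet> z) = (\<Sum>b\<in>Basis. (2 * a * (z \<bullet> b)) * (x \<bullet> b))"
      unfolding e sum_distrib_left by (intro sum.cong refl) (simp add: mult_ac)
    ultimately show "(a + x \<bullet> z)\<^sup>2 - k = (a\<^sup>2 - k) + ((\<Sum>b\<in>Basis. (2 * a * (z \<bullet> b)) * (x \<bullet> b))
      + (\<Sum>b\<in>Basis. \<Sum>c\<in>Basis. ((z \<bullet> b) * (z \<bullet> c)) * ((x \<bullet> b) * (x \<bullet> c))))"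
      by (simp add: power2_sum)
  qed
  have "(\<lambda>x. (a + x \<bullet> z)\<^sup>2 - k) \<in> polys_upto 2"
    unfolding expand
    by (intro polys_upto_add polys_upto_const polys_upto_sum polys_upto_scale polys_upto_linear polys_upto_quadratic)
  moreover have "(\<integral>x. (a + x \<bullet> z)\<^sup>2 - k \<partial>\<mu>) = 0"
  proof -
    have "(\<integral>x. (a + x \<bullet> z)\<^sup>2 - k \<partial>\<mu>) = (\<integral>x. (a\<^sup>2 - k) + (2 * a * (x \<bullet> z) + (x \<bullet> z)\<^sup>2) \<partial>\<mu>)"
      by (simp add: power2_sum algebra_simps)
    also have "\<dots> = (\<integral>x. (a\<^sup>2 - k) \<partial>(\<mu> :: (real^'m) measure)) + ((\<integral>x. 2 * a * (x \<bullet> z) \<partial>\<mu>) + (\<integral>x. (x \<bullet> z)\<^sup>2 \<partial>\<mu>))"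
      by (subst Bochner_Integration.integral_add, simp, intro integrable_sphere_continuous continuous_intros,
          subst Bochner_Integration.integral_add) (auto intro!: integrable_sphere_continuous continuous_intros)
    also have "\<dots> = 0"
      unfolding integral_sphere_inner_square[OF z] by (simp add: integral_sphere_inner k_def)
    finally show ?thesis .
  qed
  ultimately show ?thesis unfolding mean_zero_polys_def k_def by simp
qed

text \<open>Tonelli's theorem and rotation invariance: the integral of k(x.z) over the centre
  \<open>z\<close> does not depend on \<open>x\<close>. This is how inequalities on single caps are
  summed.\<close>

lemma nn_integral_zonal_average:
  fixes k :: "real \<Rightarrow> real" and H :: "real^'m \<Rightarrow> real" and e :: "real^'m"
  assumes k: "continuous_on UNIV k" "\<And>t. 0 \<le> k t" and H: "H \<in> borel_measurable \<mu>" "\<And>x. 0 \<le> H x"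
    and e: "norm e = 1"
  shows "(\<integral>\<^sup>+z. \<integral>\<^sup>+x. ennreal (k (x \<bullet> z) * H x) \<partial>\<mu> \<partial>\<mu>)
    = ennreal (\<integral>z. k (e \<bullet> z) \<partial>\<mu>) * (\<integral>\<^sup>+x. ennreal (H x) \<partial>\<mu>)"
proof -
  interpret finite_measure "\<mu> :: (real^'m) measure" by (rule finite_sphere_measure)
  have sf: "sigma_finite_measure (\<mu> :: (real^'m) measure)" by unfold_locales
  have [measurable]: "H \<in> borel_measurable \<mu>" by fact
  have km [measurable]: "k \<in> borel_measurable borel" by (rule borel_measurable_continuous_onI[OF k(1)])
  have id: "(\<lambda>x::real^'m. x) \<in> \<mu> \<rightarrow>\<^sub>M borel" by (intro borel_measurable_sphere_measure) simp
  have [measurable]: "fst \<in> (\<mu> :: (real^'m) measure) \<Otimes>\<^sub>M (\<mu> :: (real^'m) measure) \<rightarrow>\<^sub>M borel"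
     "snd \<in> (\<mu> :: (real^'m) measure) \<Otimes>\<^sub>M (\<mu> :: (real^'m) measure) \<rightarrow>\<^sub>M borel"
    by (rule measurable_compose[OF measurable_fst id], rule measurable_compose[OF measurable_snd id])
  have "(\<integral>\<^sup>+z. \<integral>\<^sup>+x. ennreal (k (x \<bullet> z) * H x) \<partial>\<mu> \<partial>\<mu>)
     = (\<integral>\<^sup>+x. \<integral>\<^sup>+z. ennreal (k (x \<bullet> z) * H x) \<partial>\<mu> \<partial>\<mu>)"
    by (rule pair_sigma_finite.Fubini'[symmetric]) (auto simp: pair_sigma_finite_def sf split_beta')
  also have "\<dots> = (\<integral>\<^sup>+x. ennreal (\<integral>z. k (e \<bullet> z) \<partial>\<mu>) * ennreal (H x) \<partial>\<mu>)"
  proof (rule nn_integral_cong)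
    fix x :: "real^'m" assume "x \<in> space \<mu>"
    then have x: "norm x = norm e" by (simp add: e)
    have ki: "integrable \<mu> (\<lambda>z. k (x \<bullet> z))"
      by (intro integrable_sphere_continuous continuous_on_compose2[OF k(1)] continuous_intros) auto
    have "(\<integral>\<^sup>+z. ennreal (k (x \<bullet> z) * H x) \<partial>\<mu>) = (\<integral>\<^sup>+z. ennreal (k (x \<bullet> z)) * ennreal (H x) \<partial>\<mu>)"
      by (simp add: ennreal_mult' k(2))
    also have "\<dots> = (\<integral>\<^sup>+z. ennreal (k (x \<bullet> z)) \<partial>\<mu>) * ennreal (H x)"
      using borel_measurable_integrable[OF ki] by (intro nn_integral_multc) auto
    also have "(\<integral>\<^sup>+z. ennreal (k (x \<bullet> z)) \<partial>\<mu>) = ennreal (\<integral>z. k (x \<bullet> z) \<partial>\<mu>)"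
      by (rule nn_integral_eq_integral[OF ki]) (simp add: k(2))
    also have "(\<integral>z. k (x \<bullet> z) \<partial>\<mu>) = (\<integral>z. k (e \<bullet> z) \<partial>\<mu>)"
      by (rule integral_zonal_eq[OF x km])
    finally show "(\<integral>\<^sup>+z. ennreal (k (x \<bullet> z) * H x) \<partial>\<mu>) = ennreal (\<integral>z. k (e \<bullet> z) \<partial>\<mu>) * ennreal (H x)" .
  qed
  also have "\<dots> = ennreal (\<integral>z. k (e \<bullet> z) \<partial>\<mu>) * (\<integral>\<^sup>+x. ennreal (H x) \<partial>\<mu>)"
    by (rule nn_integral_cmult) simp
  finally show ?thesis .
qed

section \<open>The improved inequality\<close>

text \<open>A bump vanishing almost everywhere would make its cap a null set. Positivity is needed
  because these integrals are divided out after averaging over the centres.\<close>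

lemma bump_zonal_integral_pos:
  fixes e :: "'a::euclidean_space"
  assumes e: "norm e = 1" and \<tau>: "\<tau> < 1" and s: "0 < s"
  shows "0 < (\<integral>y. bump (e \<bullet> y - \<tau>) powr s \<partial>\<mu>)"
proof -
  interpret finite_measure "\<mu> :: 'a measure" by (rule finite_sphere_measure)
  define k where "k y = bump (e \<bullet> y - \<tau>) powr s" for y
  have ki: "integrable \<mu> k"
    unfolding k_def using s bump_nonneg
    by (intro integrable_sphere_continuous continuous_on_powr' continuous_intros) auto
  define A where "A = {y \<in> sphere 0 1. \<tau> < e \<bullet> y}"
  have "{y. \<tau> < e \<bullet> y} \<in> sets borel" by measurable
  then have A: "A \<in> sets \<mu>"
    by (auto simp: A_def sets_sphere_measure sets_restrict_space)
  have "(\<integral>y. k y \<partial>\<mu>) \<noteq> 0"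
  proof
    assume "(\<integral>y. k y \<partial>\<mu>) = 0"
    moreover have "AE y in \<mu>. 0 \<le> k y" by (simp add: k_def)
    ultimately have "AE y in \<mu>. k y = 0"
      using integral_nonneg_eq_0_iff_AE[OF ki] by blast
    then have "AE y in \<mu>. y \<notin> A"
    proof eventually_elim
      case (elim y)
      then have "bump (e \<bullet> y - \<tau>) = 0" by (simp add: k_def)
      then show ?case using bump_pos_iff[of "e \<bullet> y - \<tau>"] by (simp add: A_def)
    qed
    then have "A \<in> null_sets \<mu>" using A by (simp add: AE_iff_null_sets)
    then have "measure \<mu> A = 0" by (simp add: null_sets_def measure_def)
    with cap_measure_pos[OF e \<tau>] show False by (simp add: A_def)
  qed
  moreover have "0 \<le> (\<integral>y. k y \<partial>\<mu>)" by (simp add: k_def)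
  ultimately have "0 < (\<integral>y. k y \<partial>\<mu>)" by linarith
  then show ?thesis by (simp only: k_def)
qed

text \<open>Testing the moment condition with the square of an affine function shows that the mass of
  \<open>\<bar>u\<bar>\<^sup>q\<close> in a small cap is at most about \<open>1 / (n + 2)\<close> of the total; the choice \<open>a = 1 / (n + 1)\<close>
  is optimal.\<close>

lemma cap_mass_le:
  fixes w :: "real^'m \<Rightarrow> real" and z :: "real^'m"
  assumes w: "integrable \<mu> w" "\<And>x. 0 \<le> w x" and z: "norm z = 1" and a: "0 \<le> a" and \<tau>: "0 < \<tau>"
    and mom: "\<And>f. f \<in> mean_zero_polys 2 \<Longrightarrow> (\<integral>x. f x * w x \<partial>\<mu>) = 0"
  shows "integrable \<mu> (\<lambda>x. indicator {x. \<tau> < x \<bullet> z} x * w x)"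
    and "(\<integral>x. indicator {x. \<tau> < x \<bullet> z} x * w x \<partial>\<mu>)
      \<le> (a\<^sup>2 + 1 / CARD('m)) / (a + \<tau>)\<^sup>2 * (\<integral>x. w x \<partial>\<mu>)"
proof -
  have wm [measurable]: "w \<in> borel_measurable \<mu>" using w(1) by simp
  have im: "(indicator {x. \<tau> < x \<bullet> z} :: real^'m \<Rightarrow> real) \<in> borel_measurable \<mu>"
    by (intro borel_measurable_sphere_measure) measurable
  show int: "integrable \<mu> (\<lambda>x. indicator {x. \<tau> < x \<bullet> z} x * w x)"
  proof (rule Bochner_Integration.integrable_bound[OF w(1)])
    show "(\<lambda>x. indicator {x. \<tau> < x \<bullet> z} x * w x) \<in> borel_measurable \<mu>"
      by (rule borel_measurable_times[OF im wm])
  qed (auto simp: indicator_def)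
  define k where "k = a\<^sup>2 + 1 / CARD('m)"
  have i2: "integrable \<mu> (\<lambda>x. (a + x \<bullet> z)\<^sup>2 * w x)"
    by (intro integrable_sphere_mult continuous_intros w(1))
  \<comment> \<open>The moment condition gives (a + x.z)^2 the same mean under \<open>w\<close> as
    under the surface measure.\<close>
  have "(\<integral>x. ((a + x \<bullet> z)\<^sup>2 - k) * w x \<partial>\<mu>) = 0"
    unfolding k_def by (rule mom[OF mean_zero_polys_zonal[OF z]])
  then have "(\<integral>x. (a + x \<bullet> z)\<^sup>2 * w x - k * w x \<partial>\<mu>) = 0" by (simp add: left_diff_distrib)
  then have eq: "(\<integral>x. (a + x \<bullet> z)\<^sup>2 * w x \<partial>\<mu>) = k * (\<integral>x. w x \<partial>\<mu>)"
    using i2 w(1) by simp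
  have "(a + \<tau>)\<^sup>2 * (\<integral>x. indicator {x. \<tau> < x \<bullet> z} x * w x \<partial>\<mu>)
      = (\<integral>x. (a + \<tau>)\<^sup>2 * (indicator {x. \<tau> < x \<bullet> z} x * w x) \<partial>\<mu>)" by simp
  also have "\<dots> \<le> (\<integral>x. (a + x \<bullet> z)\<^sup>2 * w x \<partial>\<mu>)"
  proof (rule integral_mono[OF _ i2])
    show "integrable \<mu> (\<lambda>x. (a + \<tau>)\<^sup>2 * (indicator {x. \<tau> < x \<bullet> z} x * w x))" using int by simp
    fix x
    \<comment> \<open>On the cap both bases are nonnegative, so squaring keeps their order; off the
      cap the square is nonnegative and is discarded.\<close>
    have "(a + \<tau>)\<^sup>2 \<le> (a + x \<bullet> z)\<^sup>2" if "\<tau> < x \<bullet> z" using that a \<tau> by (intro power_mono) auto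
    then show "(a + \<tau>)\<^sup>2 * (indicator {x. \<tau> < x \<bullet> z} x * w x) \<le> (a + x \<bullet> z)\<^sup>2 * w x"
      using w(2)[of x] by (auto simp: indicator_def intro!: mult_right_mono)
  qed
  also note eq
  finally have "(\<integral>x. indicator {x. \<tau> < x \<bullet> z} x * w x \<partial>\<mu>) * (a + \<tau>)\<^sup>2 \<le> k * (\<integral>x. w x \<partial>\<mu>)"
    by (simp add: mult.commute)
  moreover have "0 < (a + \<tau>)\<^sup>2" using a \<tau> by simp
  ultimately have "(\<integral>x. indicator {x. \<tau> < x \<bullet> z} x * w x \<partial>\<mu>) \<le> k * (\<integral>x. w x \<partial>\<mu>) / (a + \<tau>)\<^sup>2"
    by (simp add: pos_le_divide_eq)
  then show "(\<integral>x. indicator {x. \<tau> < x \<bullet> z} x * w x \<partial>\<mu>)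
      \<le> (a\<^sup>2 + 1 / CARD('m)) / (a + \<tau>)\<^sup>2 * (\<integral>x. w x \<partial>\<mu>)"
    by (simp add: k_def)
qed

text \<open>The caps centred at \<open>z\<close>, averaged over \<open>z\<close>, replace a partition of unity: Hoelder's inequality on
  each cap produces the factor \<open>\<theta>\<close>, while the averaged gradient terms add up exactly.\<close>

lemma improved_sobolev_cap:
  fixes u :: "real^'m \<Rightarrow> real" and G :: "real^'m \<Rightarrow> real^'m" and p \<tau> \<eta> C a :: real and e :: "real^'m"
  assumes card: "CARD('m) = CARD('n::finite) + 1"
    and p: "1 < p" "p < CARD('n)" and \<tau>: "0 < \<tau>" "\<tau> < 1" and a: "0 \<le> a" and e: "norm e = 1"
    and wg: "sphere_weak_gradient p u G" and uL: "in_Lp \<mu> p u"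
    and \<eta>: "0 < \<eta>" and C: "0 \<le> C" "\<And>a b. 0 \<le> a \<Longrightarrow> 0 \<le> b \<Longrightarrow> (a + b) powr p \<le> (1 + \<eta>) * a powr p + C * b powr p"
    and mom: "\<And>f. f \<in> mean_zero_polys 2 \<Longrightarrow>
      (\<integral>x. f x * \<bar>u x\<bar> powr sobolev_exponent CARD('n) p \<partial>\<mu>) = 0"
  defines "q \<equiv> sobolev_exponent CARD('n) p"
    and "S \<equiv> sobolev_const TYPE(real^'n) p powr p * (1 / \<tau> ^ CARD('m))"
    and "\<theta> \<equiv> (a\<^sup>2 + 1 / CARD('m)) / (a + \<tau>)\<^sup>2"
    and "V \<equiv> measure \<mu> (sphere (0::real^'m) 1)"
    and "c \<equiv> (\<integral>y. bump (e \<bullet> y - \<tau>) powr p \<partial>\<mu>)"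
  shows "in_Lp \<mu> q u"
    and "(\<integral>x. \<bar>u x\<bar> powr q \<partial>\<mu>) powr (p / q)
      \<le> \<theta> powr (p / CARD('n)) * (S * (1 + \<eta>)) * (\<integral>x. norm (G x) powr p \<partial>\<mu>)
       + \<theta> powr (p / CARD('n)) * (S * C * 2 powr p * V / c) * (\<integral>x. \<bar>u x\<bar> powr p \<partial>\<mu>)"
proof -
  interpret finite_measure "\<mu> :: (real^'m) measure" by (rule finite_sphere_measure)
  define n where "n = real CARD('n)"
  have np: "0 < n" "p < n" using p by (auto simp: n_def)
  have q: "q = p * n / (n - p)" by (simp add: q_def sobolev_exponent_def n_def)
  have q0: "0 < q" using p np by (simp add: q)
  have pq: "p / q + p / n = 1" using p np q0 by (simp add: q field_simps)
  have qpn: "q * (p / n) = q - p" using p np by (simp add: q field_simps)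
  have S0: "0 \<le> S" using \<tau> by (simp add: S_def)
  have um [measurable]: "u \<in> borel_measurable \<mu>" and up: "integrable \<mu> (\<lambda>x. \<bar>u x\<bar> powr p)"
    using uL by (auto simp: in_Lp_def)
  have Gp: "integrable \<mu> (\<lambda>x. norm (G x) powr p)"
    using wg by (simp add: sphere_weak_gradient_def in_Lp_def)
  define \<beta> where "\<beta> t = bump (t - \<tau>)" for t
  have \<beta>: "0 \<le> \<beta> t" "\<beta> t \<le> 1" for t by (simp_all add: \<beta>_def bump_nonneg bump_le_1)
  have \<beta>c: "continuous_on UNIV (\<lambda>t. \<beta> t powr s)" if "0 < s" for s
    unfolding \<beta>_def using that bump_nonneg by (intro continuous_on_powr' continuous_intros) auto
  have \<beta>zc: "continuous_on T (\<lambda>x. \<beta> (x \<bullet> z) powr s)" if "0 < s" for s T and z :: "real^'m"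
    by (rule continuous_on_compose2[OF \<beta>c[OF that]]) (auto intro!: continuous_intros)
  have cs: "0 < (\<integral>y. \<beta> (e \<bullet> y) powr s \<partial>\<mu>)" if "0 < s" for s
    unfolding \<beta>_def by (rule bump_zonal_integral_pos[OF e \<tau>(2) that])
  have c_eq: "c = (\<integral>y. \<beta> (e \<bullet> y) powr p \<partial>\<mu>)" by (simp add: c_def \<beta>_def)
  have c: "0 < c" unfolding c_eq using p by (intro cs) simp
  define U where "U = (\<integral>x. \<bar>u x\<bar> powr p \<partial>\<mu>)"
  define P where "P = (\<integral>x. norm (G x) powr p \<partial>\<mu>)"
  define J where "J z = (\<integral>x. \<beta> (x \<bullet> z) powr p * norm (G x) powr p \<partial>\<mu>)" for z
  have UP: "0 \<le> U" "0 \<le> P" by (simp_all add: U_def P_def)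
  define K1 where "K1 = S * (1 + \<eta>)"
  define K2 where "K2 = S * C * 2 powr p"
  have K: "0 \<le> K1" "0 \<le> K2" using S0 \<eta> C(1) by (simp_all add: K1_def K2_def)
  have loc: "integrable \<mu> (\<lambda>x. (\<beta> (x \<bullet> z) * \<bar>u x\<bar>) powr q)"
       "(\<integral>x. (\<beta> (x \<bullet> z) * \<bar>u x\<bar>) powr q \<partial>\<mu>) powr (p / q) \<le> K1 * J z + K2 * U"
    if z: "norm z = 1" for z
  proof -
    obtain L :: "real^'n \<Rightarrow> real^'m" where L: "linear L" "\<And>y. norm (L y) = norm y" "\<And>y. L y \<bullet> z = 0"
      "distr (lborel \<Otimes>\<^sub>M lborel) borel (\<lambda>(t, y). t *\<^sub>R z + L y) = lborel"
      using orthogonal_coordinates[OF card z] by blast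
    interpret gnomonic_chart z L by (rule gnomonic_chart.intro[OF card z L])
    show "integrable \<mu> (\<lambda>x. (\<beta> (x \<bullet> z) * \<bar>u x\<bar>) powr q)"
      unfolding \<beta>_def q_def by (rule local_sobolev_W1(1)[OF p \<tau>(1) wg uL \<eta> C])
    show "(\<integral>x. (\<beta> (x \<bullet> z) * \<bar>u x\<bar>) powr q \<partial>\<mu>) powr (p / q) \<le> K1 * J z + K2 * U"
      unfolding \<beta>_def q_def K1_def K2_def J_def U_def S_def by (rule local_sobolev_W1(2)[OF p \<tau>(1) wg uL \<eta> C])
  qed
  have Jint: "integrable \<mu> (\<lambda>x. \<beta> (x \<bullet> z) powr p * norm (G x) powr p)" for z
    using p by (intro integrable_sphere_mult \<beta>zc Gp) simp
  have JP: "J z \<le> P" for z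
    unfolding J_def P_def
  proof (rule integral_mono[OF Jint Gp])
    fix x
    have "\<beta> (x \<bullet> z) powr p \<le> 1 powr p" using \<beta>[of "x \<bullet> z"] p by (intro powr_mono2) auto
    then show "\<beta> (x \<bullet> z) powr p * norm (G x) powr p \<le> norm (G x) powr p"
      by (simp add: mult_left_le_one_le)
  qed
  have J0: "0 \<le> J z" for z by (simp add: J_def)
  define w where "w x = \<bar>u x\<bar> powr q" for x
  have w0: "0 \<le> w x" for x by (simp add: w_def)
  have wm: "w \<in> borel_measurable \<mu>" unfolding w_def by measurable
  \<comment> \<open>Finiteness of the total mass, on which the cap estimate and the final division
    rest. Averaging with the weight \<beta>^q works because each inner integral is bounded by the
    same \<open>B\<close>.\<close>
  have wi: "integrable \<mu> w"
  proof (rule integrableI_nonneg[OF wm])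
    define B where "B = (K1 * P + K2 * U) powr (q / p)"
    have "ennreal (\<integral>y. \<beta> (e \<bullet> y) powr q \<partial>\<mu>) * (\<integral>\<^sup>+x. ennreal (w x) \<partial>\<mu>)
      = (\<integral>\<^sup>+z. \<integral>\<^sup>+x. ennreal (\<beta> (x \<bullet> z) powr q * w x) \<partial>\<mu> \<partial>\<mu>)"
      by (rule nn_integral_zonal_average[symmetric, OF \<beta>c[OF q0] _ wm w0 e]) simp
    also have "\<dots> \<le> (\<integral>\<^sup>+z. ennreal B \<partial>(\<mu> :: (real^'m) measure))"
    proof (rule nn_integral_mono)
      fix z :: "real^'m" assume "z \<in> space \<mu>"
      then have z: "norm z = 1" by simp
      define I where "I = (\<integral>x. (\<beta> (x \<bullet> z) * \<bar>u x\<bar>) powr q \<partial>\<mu>)"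
      have I0: "0 \<le> I" by (simp add: I_def)
      have "(\<integral>\<^sup>+x. ennreal (\<beta> (x \<bullet> z) powr q * w x) \<partial>\<mu>) = (\<integral>\<^sup>+x. ennreal ((\<beta> (x \<bullet> z) * \<bar>u x\<bar>) powr q) \<partial>\<mu>)"
        by (simp add: w_def powr_mult)
      also have "\<dots> = ennreal I" unfolding I_def by (rule nn_integral_eq_integral[OF loc(1)[OF z]]) simp
      also have "I \<le> B"
      proof -
        have "I powr (p / q) \<le> K1 * J z + K2 * U" unfolding I_def by (rule loc(2)[OF z])
        also have "\<dots> \<le> K1 * P + K2 * U" using JP[of z] K by (intro add_right_mono mult_left_mono) auto
        finally have "(I powr (p / q)) powr (q / p) \<le> B" unfolding B_def using p q0 by (intro powr_mono2) auto
        then show ?thesis using p q0 I0 by (simp add: powr_powr)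
      qed
      finally show "(\<integral>\<^sup>+x. ennreal (\<beta> (x \<bullet> z) powr q * w x) \<partial>\<mu>) \<le> ennreal B"
        by (simp add: ennreal_leI)
    qed
    also have "\<dots> < \<infinity>" by (simp add: ennreal_mult_less_top emeasure_eq_measure)
    finally show "(\<integral>\<^sup>+x. ennreal (w x) \<partial>\<mu>) < \<infinity>"
      using cs[OF q0] by (auto simp: ennreal_mult_less_top ennreal_mult_eq_top_iff)
  qed (simp add: w0)
  show "in_Lp \<mu> q u" unfolding in_Lp_def using wi by (simp add: w_def[abs_def])
  define M where "M = (\<integral>x. w x \<partial>\<mu>)"
  have M0: "0 \<le> M" unfolding M_def by (simp add: w0)
  have Mnn: "(\<integral>\<^sup>+x. ennreal (w x) \<partial>\<mu>) = ennreal M"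
    unfolding M_def by (rule nn_integral_eq_integral[OF wi]) (simp add: w0)
  have \<theta>0: "0 \<le> \<theta>" by (simp add: \<theta>_def)
  have mom': "(\<integral>x. f x * w x \<partial>\<mu>) = 0" if "f \<in> mean_zero_polys 2" for f
    using mom[OF that] by (simp add: w_def q_def)
  define \<kappa> where "\<kappa> = (\<theta> * M) powr (p / n)"
  have capz: "(\<integral>x. \<beta> (x \<bullet> z) powr p * w x \<partial>\<mu>) \<le> \<kappa> * (K1 * J z + K2 * U)" if z: "norm z = 1" for z
  proof -
    define F where "F x = (\<beta> (x \<bullet> z) * \<bar>u x\<bar>) powr q" for x
    define H where "H x = indicator {x. \<tau> < x \<bullet> z} x * w x" for x
    have Fi: "integrable \<mu> F" unfolding F_def by (rule loc(1)[OF z])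
    have H: "integrable \<mu> H" "(\<integral>x. H x \<partial>\<mu>) \<le> \<theta> * M"
      using cap_mass_le[OF wi w0 z a \<tau>(1) mom']
      unfolding H_def \<theta>_def M_def by simp_all
    have H0: "0 \<le> H x" for x using w0[of x] by (simp add: H_def)
    \<comment> \<open>Off the cap both sides are 0, since the bump vanishes there; this is why
      cutting \<open>H\<close> down to the cap loses nothing.\<close>
    have eq: "F x powr (p / q) * H x powr (p / n) = \<beta> (x \<bullet> z) powr p * w x" for x
    proof (cases "\<tau> < x \<bullet> z")
      case True
      have "H x powr (p / n) = \<bar>u x\<bar> powr (q - p)" using True by (simp only: H_def w_def powr_powr qpn) (simp add: powr_powr qpn[simplified])
      moreover have "F x powr (p / q) = \<beta> (x \<bullet> z) powr p * \<bar>u x\<bar> powr p"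
        using q0 by (simp add: F_def powr_powr powr_mult)
      moreover have "\<bar>u x\<bar> powr p * \<bar>u x\<bar> powr (q - p) = w x" by (simp add: w_def flip: powr_add)
      ultimately show ?thesis by (simp add: mult.assoc)
    next
      case False
      then show ?thesis by (simp add: F_def \<beta>_def bump_eq_0)
    qed
    have "(\<integral>x. \<beta> (x \<bullet> z) powr p * w x \<partial>\<mu>) = (\<integral>x. F x powr (p / q) * H x powr (p / n) \<partial>\<mu>)"
      by (simp only: eq)
    also have "\<dots> \<le> (\<integral>x. F x \<partial>\<mu>) powr (p / q) * (\<integral>x. H x \<partial>\<mu>) powr (p / n)"
      using p np q0 pq by (intro holder_two(2) Fi H H0) (auto simp: F_def)
    also have "\<dots> \<le> (K1 * J z + K2 * U) * \<kappa>"
    proof (rule mult_mono)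
      show "(\<integral>x. F x \<partial>\<mu>) powr (p / q) \<le> K1 * J z + K2 * U"
        unfolding F_def by (rule loc(2)[OF z])
      have "0 \<le> (\<integral>x. H x \<partial>\<mu>)" by (simp add: H0)
      then show "(\<integral>x. H x \<partial>\<mu>) powr (p / n) \<le> \<kappa>"
        unfolding \<kappa>_def using H(2) p np by (intro powr_mono2) auto
      show "0 \<le> K1 * J z + K2 * U" using K J0[of z] UP by simp
    qed simp
    finally show ?thesis by (simp add: mult.commute)
  qed
  \<comment> \<open>The constant K2 U is written as the integral of \<beta>^p against K2 U / c, so
    that the whole right-hand side is \<beta>^p integrated against a function that does not depend
    on \<open>z\<close>.\<close>
  define H' where "H' x = \<kappa> * (K1 * norm (G x) powr p + K2 * U / c)" for x
  have \<kappa>0: "0 \<le> \<kappa>" by (simp add: \<kappa>_def)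
  have H'0: "0 \<le> H' x" for x using \<kappa>0 K UP c by (simp add: H'_def)
  have H'i: "integrable \<mu> H'" unfolding H'_def using Gp by simp
  have H'int: "(\<integral>x. H' x \<partial>\<mu>) = \<kappa> * (K1 * P + K2 * U * V / c)"
    using Gp by (simp add: H'_def P_def V_def)
  have p0: "0 < p" using p by simp
  have "ennreal c * ennreal M = (\<integral>\<^sup>+z. \<integral>\<^sup>+x. ennreal (\<beta> (x \<bullet> z) powr p * w x) \<partial>\<mu> \<partial>\<mu>)"
    unfolding c_eq Mnn[symmetric] by (rule nn_integral_zonal_average[symmetric, OF \<beta>c[OF p0] _ wm w0 e]) simp
  also have "\<dots> \<le> (\<integral>\<^sup>+z. \<integral>\<^sup>+x. ennreal (\<beta> (x \<bullet> z) powr p * H' x) \<partial>\<mu> \<partial>\<mu>)"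
  proof (rule nn_integral_mono)
    fix z :: "real^'m" assume "z \<in> space \<mu>"
    then have z: "norm z = 1" by simp
    have \<beta>i: "integrable \<mu> (\<lambda>x. \<beta> (x \<bullet> z) powr p)"
      by (intro integrable_sphere_continuous \<beta>zc p0)
    have cz: "(\<integral>x. \<beta> (x \<bullet> z) powr p \<partial>\<mu>) = c"
      using integral_zonal_eq[of z e "\<lambda>t. \<beta> t powr p"] borel_measurable_continuous_onI[OF \<beta>c[OF p0]] z e
      by (simp add: c_eq inner_commute)
    have i1: "integrable \<mu> (\<lambda>x. \<beta> (x \<bullet> z) powr p * w x)"
      by (intro integrable_sphere_mult \<beta>zc p0 wi)
    have i2: "integrable \<mu> (\<lambda>x. \<beta> (x \<bullet> z) powr p * H' x)"
      by (intro integrable_sphere_mult \<beta>zc p0 H'i)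
    have "(\<integral>x. \<beta> (x \<bullet> z) powr p * H' x \<partial>\<mu>)
       = (\<integral>x. \<kappa> * (K1 * (\<beta> (x \<bullet> z) powr p * norm (G x) powr p) + (K2 * U / c) * \<beta> (x \<bullet> z) powr p) \<partial>\<mu>)"
      by (rule Bochner_Integration.integral_cong[OF refl]) (simp only: H'_def distrib_left mult_ac)
    also have "\<dots> = \<kappa> * (K1 * J z + (K2 * U / c) * c)"
      using Jint[of z] \<beta>i by (simp add: J_def cz)
    also have "(K2 * U / c) * c = K2 * U" using c by simp
    finally have "(\<integral>x. \<beta> (x \<bullet> z) powr p * w x \<partial>\<mu>) \<le> (\<integral>x. \<beta> (x \<bullet> z) powr p * H' x \<partial>\<mu>)"
      using capz[OF z] by simp
    then show "(\<integral>\<^sup>+x. ennreal (\<beta> (x \<bullet> z) powr p * w x) \<partial>\<mu>) \<le> (\<integral>\<^sup>+x. ennreal (\<beta> (x \<bullet> z) powr p * H' x) \<partial>\<mu>)"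
      by (subst (1 2) nn_integral_eq_integral) (auto intro!: i1 i2 ennreal_leI simp: w0 H'0)
  qed
  also have "\<dots> = ennreal c * (\<integral>\<^sup>+x. ennreal (H' x) \<partial>\<mu>)"
    unfolding c_eq
    by (rule nn_integral_zonal_average[OF \<beta>c[OF p0] _ borel_measurable_integrable[OF H'i] H'0 e]) simp
  also have "(\<integral>\<^sup>+x. ennreal (H' x) \<partial>\<mu>) = ennreal (\<kappa> * (K1 * P + K2 * U * V / c))"
    unfolding H'int[symmetric] by (rule nn_integral_eq_integral[OF H'i]) (simp add: H'0)
  finally have "ennreal M \<le> ennreal (\<kappa> * (K1 * P + K2 * U * V / c))"
    using c by (subst (asm) ennreal_mult_le_mult_iff) auto
  moreover have V0: "0 \<le> V" by (simp add: V_def)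
  have X0: "0 \<le> K1 * P + K2 * U * V / c" using K UP V0 c by simp
  ultimately have main: "M \<le> \<kappa> * (K1 * P + K2 * U * V / c)"
    using \<kappa>0 by (subst (asm) ennreal_le_iff) auto
  \<comment> \<open>As 1 - p/n = p/q, dividing out the power p/n of \<open>M\<close> contained in
    \<kappa> leaves the p-th power of the norm.\<close>
  have "M powr (p / q) \<le> \<theta> powr (p / n) * (K1 * P + K2 * U * V / c)"
  proof (cases "M = 0")
    case True
    then show ?thesis using X0 by simp
  next
    case False
    then have Mp: "0 < M" using M0 by simp
    have "p / q = 1 - p / n" using pq by linarith
    then have "M powr (p / q) = M powr (1 - p / n)" by (simp only:)
    also have "\<dots> = M / M powr (p / n)" using Mp by (simp add: powr_diff)
    also have "\<dots> \<le> \<theta> powr (p / n) * (K1 * P + K2 * U * V / c)"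
      using main Mp by (simp add: \<kappa>_def powr_mult divide_le_eq mult_ac)
    finally show ?thesis .
  qed
  also have "\<dots> = \<theta> powr (p / n) * K1 * P + \<theta> powr (p / n) * (K2 * V / c) * U"
    by (simp add: algebra_simps)
  finally show "(\<integral>x. \<bar>u x\<bar> powr q \<partial>\<mu>) powr (p / q)
      \<le> \<theta> powr (p / CARD('n)) * (S * (1 + \<eta>)) * (\<integral>x. norm (G x) powr p \<partial>\<mu>)
       + \<theta> powr (p / CARD('n)) * (S * C * 2 powr p * V / c) * (\<integral>x. \<bar>u x\<bar> powr p \<partial>\<mu>)"
    unfolding M_def w_def K1_def K2_def P_def U_def n_def .
qed

text \<open>The Euclidean constant is attached to the type \<open>real^'n\<close> and the sphere
  lies in \<open>real^'m\<close>, so the cardinalities tie both to \<open>n\<close>. Integrability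
  of |u|^q belongs to the conclusion, as \<open>lp_norm\<close> is meaningful only with it. The
  constant is chosen before \<open>u\<close> and its weak gradient.\<close>

theorem corollary1p1:
  fixes n :: nat and p \<epsilon> :: real
  assumes "CARD('n::finite) = n" and "CARD('m::finite) = n + 1"
    and "1 < p" and "p < real n"
    and "\<epsilon> > 0"
  shows "\<exists>c::real. \<forall>(u :: real^'m \<Rightarrow> real) Du.
    u \<in> sphere_W1 p \<longrightarrow> sphere_weak_gradient p u Du \<longrightarrow>
    (\<forall>f \<in> mean_zero_polys 2.
       (\<integral>x. f x * \<bar>u x\<bar> powr sobolev_exponent n p \<partial>sphere_measure) = 0) \<longrightarrow>
    in_Lp sphere_measure (sobolev_exponent n p) u \<and>
    lp_norm sphere_measure (sobolev_exponent n p) u powr p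
      \<le> (sobolev_const TYPE(real^'n) p powr p / (real n + 2) powr (p / real n) + \<epsilon>)
           * lp_norm sphere_measure p Du powr p
         + c * lp_norm sphere_measure p u powr p"
proof -
  have card: "CARD('m) = CARD('n) + 1" using assms by simp
  have p: "1 < p" "p < CARD('n)" using assms by auto
  have n: "real n = CARD('n)" "real n > 0" using assms by auto
  have N: "real CARD('m) = real n + 1" using assms by simp
  define q where "q = sobolev_exponent n p"
  have q0: "0 < q" using assms by (simp add: q_def sobolev_exponent_def)
  define a where "a = 1 / (real n + 1)"
  have a: "0 < a" using n by (simp add: a_def)
  define S where "S = sobolev_const TYPE(real^'n) p powr p"
  \<comment> \<open>The gradient coefficient as a function of the cap height alone: \<eta> is tied
    to it as 1 - \<tau>, so all losses vanish together at \<tau> = 1, where the target constant is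
    attained.\<close>
  define h where "h \<tau> = ((a\<^sup>2 + 1 / CARD('m)) / (a + \<tau>)\<^sup>2) powr (p / real n) * (S * (1 / \<tau> ^ CARD('m)) * (1 + (1 - \<tau>)))" for \<tau> :: real
  have opt: "(a\<^sup>2 + 1 / CARD('m)) / (a + 1)\<^sup>2 = 1 / (real n + 2)"
  proof -
    define m where "m = real n + 1"
    have m: "m > 0" using n by (simp add: m_def)
    have "a\<^sup>2 + 1 / CARD('m) = (m + 1) / m\<^sup>2"
      using m by (simp add: a_def N flip: m_def) (simp add: field_simps power2_eq_square)
    moreover have "a + 1 = (m + 1) / m" using m by (simp add: a_def flip: m_def) (simp add: field_simps)
    ultimately have "(a\<^sup>2 + 1 / CARD('m)) / (a + 1)\<^sup>2 = ((m + 1) / m\<^sup>2) / ((m + 1)\<^sup>2 / m\<^sup>2)"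
      by (simp add: power_divide)
    also have "\<dots> = 1 / (m + 1)" using m by (simp add: power2_eq_square)
    finally show ?thesis by (simp add: m_def)
  qed
  have h1: "h 1 = S / (real n + 2) powr (p / real n)"
    unfolding h_def opt using n by (simp add: powr_divide)
  have "0 < a\<^sup>2 + 1 / CARD('m)" using a by (intro add_pos_nonneg) auto
  then have "isCont h 1"
    unfolding h_def using a by (intro continuous_intros) auto
  \<comment> \<open>Caps of positive measure require \<tau> < 1, hence the limit from the
    left.\<close>
  then have "(h \<longlongrightarrow> h 1) (at_left 1)"
    unfolding isCont_def by (rule tendsto_within_subset) auto
  then have "\<forall>\<^sub>F \<tau> in at_left 1. h \<tau> < h 1 + \<epsilon>"
    using assms(5) by (intro order_tendstoD) auto
  moreover have "\<forall>\<^sub>F \<tau>::real in at_left 1. 0 < \<tau> \<and> \<tau> < 1"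
    using eventually_at_left_real[of 0 1] by simp
  ultimately have "\<forall>\<^sub>F \<tau> in at_left 1. h \<tau> < h 1 + \<epsilon> \<and> 0 < \<tau> \<and> \<tau> < 1" by eventually_elim auto
  then obtain \<tau> where \<tau>: "h \<tau> < h 1 + \<epsilon>" "0 < \<tau>" "\<tau> < 1"
    using eventually_happens'[OF trivial_limit_at_left_real] by blast
  obtain C where C: "0 \<le> C" "\<And>a b. 0 \<le> a \<Longrightarrow> 0 \<le> b \<Longrightarrow> (a + b) powr p \<le> (1 + (1 - \<tau>)) * a powr p + C * b powr p"
    using powr_add_le_weighted[OF p(1), of "1 - \<tau>"] \<tau> by auto
  \<comment> \<open>By rotation invariance any unit vector can represent the centres in the
    normalising integral, so \<open>c\<close> is fixed before \<open>u\<close>.\<close>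
  obtain e :: "real^'m" where "e \<in> Basis" using nonempty_Basis by blast
  then have e: "norm e = 1" by simp
  define \<theta> where "\<theta> = (a\<^sup>2 + 1 / CARD('m)) / (a + \<tau>)\<^sup>2"
  define c where "c = \<theta> powr (p / real n) * (S * (1 / \<tau> ^ CARD('m)) * C * 2 powr p * measure \<mu> (sphere (0::real^'m) 1)
      / (\<integral>y. bump (e \<bullet> y - \<tau>) powr p \<partial>\<mu>))"
  show ?thesis
  proof (intro exI[of _ c] allI impI)
    fix u :: "real^'m \<Rightarrow> real" and Du
    assume W: "u \<in> sphere_W1 p" and wg: "sphere_weak_gradient p u Du"
      and mom: "\<forall>f \<in> mean_zero_polys 2. (\<integral>x. f x * \<bar>u x\<bar> powr sobolev_exponent n p \<partial>\<mu>) = 0"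
    have uL: "in_Lp \<mu> p u" using W by (simp add: sphere_W1_def)
    have mom': "(\<integral>x. f x * \<bar>u x\<bar> powr sobolev_exponent CARD('n) p \<partial>\<mu>) = 0" if "f \<in> mean_zero_polys 2" for f
      using mom that assms(1) by simp
    define U where "U = (\<integral>x. \<bar>u x\<bar> powr p \<partial>\<mu>)"
    define P where "P = (\<integral>x. norm (Du x) powr p \<partial>\<mu>)"
    define M where "M = (\<integral>x. \<bar>u x\<bar> powr q \<partial>\<mu>)"
    have nn: "0 \<le> U" "0 \<le> P" "0 \<le> M" by (simp_all add: U_def P_def M_def)
    have "0 < 1 - \<tau>" using \<tau> by simp
    note main = improved_sobolev_cap[OF card p \<tau>(2,3) less_imp_le[OF a] e wg uL this C mom']
    have 1: "in_Lp \<mu> q u" using main(1) assms(1) by (simp add: q_def)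
    have "M powr (p / q) \<le> h \<tau> * P + c * U"
      using main(2) assms(1) by (simp add: M_def q_def h_def P_def c_def U_def \<theta>_def S_def)
    also have "\<dots> \<le> (h 1 + \<epsilon>) * P + c * U"
      using \<tau>(1) nn by (intro add_right_mono mult_right_mono) auto
    finally have 2: "M powr (p / q) \<le> (h 1 + \<epsilon>) * P + c * U" .
    have "lp_norm \<mu> q u powr p = M powr (p / q)"
      "lp_norm \<mu> p Du powr p = P" "lp_norm \<mu> p u powr p = U"
      using nn p by (simp_all add: lp_norm_def M_def[symmetric] P_def[symmetric] U_def[symmetric] powr_powr)
    with 1 2 show "in_Lp \<mu> (sobolev_exponent n p) u \<and>
      lp_norm \<mu> (sobolev_exponent n p) u powr p
      \<le> (sobolev_const TYPE(real^'n) p powr p / (real n + 2) powr (p / real n) + \<epsilon>)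
           * lp_norm \<mu> p Du powr p
         + c * lp_norm \<mu> p u powr p"
      unfolding q_def[symmetric] h1 S_def by simp
  qed
qed

end
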